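(* Consider the optimal reinsurance–injection problem with proportional reinsurance, with value function $V$, as defined in the context. Suppose $\delta<\frac{\mu^2+2r\sigma^2}{2\mu}$. Put $$\beta=\frac{1}{\delta}\Big(r+\frac{1}{2}\frac{\mu^2}{\sigma^2}\Big),$$ and let $\alpha$ be the unique solution on the interval $(c/\beta,\infty)$ of the equation $$K+\frac{c}{\beta}\ln\frac{\alpha\beta}{c}+\frac{c}{\beta}-\alpha=0 .$$ Then the value function is $$V(x)=\alpha e^{-\beta x},\qquad x\ge 0 .$$ Moreover, the following policy $\pi^*$ is optimal, i.e. $V(x)=C^{\pi^*}(x)$: the reinsurance control is the constant $$u^*_s\equiv \frac{2\delta\mu}{2r\sigma^2+\mu^2},$$ the cash injections are the constant $$\xi_i^*\equiv\frac{1}{\beta}\ln\frac{\alpha\beta}{c},\qquad i=1,2,\dots,$$ and the injection times $\tau_i^*$, $i=1,2,\dots$, are the successive ruin times of the surplus process under $\pi^*$.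
   Context: Constants: $\mu>0$, $\sigma>0$, $\delta>0$ (debt liability rate), $r>0$ (discount rate), $K>0$ (fixed set-up cost), $c\ge 1$ (proportional cost rate). Let $\{w_s\}_{s\ge0}$ be a standard Brownian motion adapted to a filtration $\{\mathcal F_s\}_{s\ge 0}$ on a probability space $(\Omega,\mathcal F,P)$. A control policy is a triple $\pi=\{u_s,\,s>0;\ (\tau_1,\tau_2,\dots);\ (\xi_1,\xi_2,\dots)\}$, where $u_s$ is a predictable process with values in $[0,1]$ (the fraction of each claim retained by the company), $\tau_1,\tau_2,\dots$ is an increasing sequence of stopping times with respect to $\{\mathcal F_s\}$ (times of cash injections), and each $\xi_i>0$ is an $\mathcal F_{\tau_i}$-measurable random variable (size of the $i$th injection). Proportional reinsurance: $\mu(u)=\mu u$, $\sigma(u)=\sigma u$ for $u\in[0,1]$. Given initial surplus $x\ge 0$, the surplus process under $\pi$ is $$X^\pi_t=x+\int_0^t[\mu(u_s)-\delta]\,ds+\int_0^t\sigma(u_s)\,dw_s+\sum_{\tau_i\le t}\xi_i .$$ The cost of an injection of size $\xi$ is $g(\xi)=K+c\xi$, and the cost function of $\pi$ is $$C^\pi(x)=E_x\Big[\sum_{\tau_i<\infty}e^{-r\tau_i}g(\xi_i)\Big],$$ where $E_x$ is expectation given initial surplus $x$. A policy $\pi$ is admissible if $X^\pi_t\ge 0$ almost surely for all $t$ and $C^\pi(x)<\infty$ for all $x\ge0$; $\Pi$ is the set of admissible policies. The value function is $V(x)=\inf_{\pi\in\Pi}C^\pi(x)$, $x\ge0$. A policy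 $\pi^*\in\Pi$ is optimal if $C^{\pi^*}(x)=V(x)$. Ruin times of the surplus process are the successive times at which the surplus (just before injection) hits zero; if $x=0$ the first ruin time is $0$. *)

theory Defs
  imports "HOL-Probability.Probability"
begin

text \<open>
  Filtrations are indexed by \<open>ennreal\<close>, so that the library notions of stopping time and of the
  sigma-algebra \<open>pre_sigma\<close> of a stopping time apply to times with values in \<open>[0, \<infinity>]\<close>.
  \<open>F \<infinity>\<close> may be any sigma-algebra between the union of the \<open>F t\<close> and the events of \<open>M\<close>. Processes
  are indexed by real numbers, of which only the nonnegative ones matter. No completeness or
  right-continuity of the filtration is assumed.
\<close>

locale brownian_motion = prob_space M + filtration "space M" F
  for M :: "'a measure" and F :: "ennreal \<Rightarrow> 'a measure" +
  fixes w :: "real \<Rightarrow> 'a \<Rightarrow> real"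
  assumes subalgebra_F: "\<And>t. subalgebra M (F t)"
    and adapted: "\<And>t. 0 \<le> t \<Longrightarrow> w t \<in> borel_measurable (F (ennreal t))"
    and initial: "AE \<omega> in M. w 0 \<omega> = 0"
    and continuous_paths: "\<And>\<omega>. \<omega> \<in> space M \<Longrightarrow> continuous_on {0..} (\<lambda>t. w t \<omega>)"
    and gaussian_increments: "\<And>s t. 0 \<le> s \<Longrightarrow> s < t \<Longrightarrow>
      distributed M lborel (\<lambda>\<omega>. w t \<omega> - w s \<omega>) (normal_density 0 (sqrt (t - s)))"
    and independent_increments: "\<And>s t. 0 \<le> s \<Longrightarrow> s < t \<Longrightarrow>
      indep_set (sets (F (ennreal s)))
        (sets (vimage_algebra (space M) (\<lambda>\<omega>. w t \<omega> - w s \<omega>) borel))"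

definition predictable_sigma :: "'a measure \<Rightarrow> (ennreal \<Rightarrow> 'a measure) \<Rightarrow> (real \<times> 'a) measure"
  where "predictable_sigma M F = sigma ({0<..} \<times> space M)
    {{s<..t} \<times> A | s t A. 0 \<le> s \<and> s < t \<and> A \<in> sets (F (ennreal s))}"

definition predictable ::
    "'a measure \<Rightarrow> (ennreal \<Rightarrow> 'a measure) \<Rightarrow> (real \<Rightarrow> 'a \<Rightarrow> real) \<Rightarrow> bool"
  where "predictable M F u \<longleftrightarrow> (\<lambda>(s, \<omega>). u s \<omega>) \<in> borel_measurable (predictable_sigma M F)"


subsection \<open>The stochastic integral\<close>

text \<open>Elementary integrands \<open>\<Sum>i<n. \<phi>\<^sub>i 1\<^bsub>(t\<^sub>i, t\<^sub>i\<^sub>+\<^sub>1]\<^esub>\<close>.\<close>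

definition elementary ::
    "'a measure \<Rightarrow> (ennreal \<Rightarrow> 'a measure) \<Rightarrow> nat \<Rightarrow> (nat \<Rightarrow> real) \<Rightarrow> (nat \<Rightarrow> 'a \<Rightarrow> real) \<Rightarrow> bool"
  where "elementary M F n t \<phi> \<longleftrightarrow>
    0 \<le> t 0 \<and> (\<forall>i<n. t i < t (Suc i)) \<and>
    (\<forall>i<n. \<phi> i \<in> borel_measurable (F (ennreal (t i))) \<and> (\<exists>B. \<forall>\<omega>\<in>space M. \<bar>\<phi> i \<omega>\<bar> \<le> B))"

definition elementary_process ::
    "nat \<Rightarrow> (nat \<Rightarrow> real) \<Rightarrow> (nat \<Rightarrow> 'a \<Rightarrow> real) \<Rightarrow> real \<Rightarrow> 'a \<Rightarrow> real"
  where "elementary_process n t \<phi> s \<omega> = (\<Sum>i<n. \<phi> i \<omega> * indicator {t i<..t (Suc i)} s)"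

definition elementary_integral ::
    "(real \<Rightarrow> 'a \<Rightarrow> real) \<Rightarrow> nat \<Rightarrow> (nat \<Rightarrow> real) \<Rightarrow> (nat \<Rightarrow> 'a \<Rightarrow> real) \<Rightarrow> real \<Rightarrow> 'a \<Rightarrow> real"
  where "elementary_integral w n t \<phi> T \<omega> =
    (\<Sum>i<n. \<phi> i \<omega> * (w (min (t (Suc i)) T) \<omega> - w (min (t i) T) \<omega>))"

text \<open>
  \<open>Y\<close> is a continuous version of the Ito integral process \<open>\<integral>\<^sub>0\<^sup>T h\<^sub>s dw\<^sub>s\<close>, \<open>T \<ge> 0\<close>: the mean-square limit
  of the integrals of elementary processes approximating \<open>h\<close> in mean square on \<open>(0, T]\<close>. The
  process is determined up to indistinguishability. As the filtration need not contain the null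
  sets, \<open>Y T\<close> is only required to be \<open>M\<close>-measurable; it agrees almost surely with an \<open>F T\<close>-measurable
  random variable.
\<close>

definition ito_integral_process :: "'a measure \<Rightarrow> (ennreal \<Rightarrow> 'a measure) \<Rightarrow> (real \<Rightarrow> 'a \<Rightarrow> real) \<Rightarrow>
    (real \<Rightarrow> 'a \<Rightarrow> real) \<Rightarrow> (real \<Rightarrow> 'a \<Rightarrow> real) \<Rightarrow> bool"
  where "ito_integral_process M F w h Y \<longleftrightarrow>
    (\<forall>\<omega>\<in>space M. continuous_on {0..} (\<lambda>T. Y T \<omega>)) \<and>
    (\<forall>T\<ge>0. Y T \<in> borel_measurable M \<and>
      (\<exists>n t \<phi>. (\<forall>k::nat. elementary M F (n k) (t k) (\<phi> k)) \<and>
        (\<lambda>k. \<integral>\<^sup>+\<omega>. (\<integral>\<^sup>+s\<in>{0<..T}.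
            ennreal ((elementary_process (n k) (t k) (\<phi> k) s \<omega> - h s \<omega>)\<^sup>2) \<partial>lborel) \<partial>M) \<longlonglongrightarrow> 0 \<and>
        (\<lambda>k. \<integral>\<^sup>+\<omega>. ennreal ((elementary_integral w (n k) (t k) (\<phi> k) T \<omega> - Y T \<omega>)\<^sup>2) \<partial>M)
          \<longlonglongrightarrow> 0))"


subsection \<open>Control policies\<close>

text \<open>
  A policy prescribes the controls for each initial surplus, which is the first argument of every
  component (the injection times of a policy such as ``inject at ruin'' depend on it). Injections
  are counted from \<open>0\<close>; an injection time \<open>\<infinity>\<close> means that the injection does not take place.
\<close>

record 'a policy =
  retention :: "real \<Rightarrow> real \<Rightarrow> 'a \<Rightarrow> real"
  inj_time :: "real \<Rightarrow> nat \<Rightarrow> 'a \<Rightarrow> ennreal"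
  inj_size :: "real \<Rightarrow> nat \<Rightarrow> 'a \<Rightarrow> real"

definition control_policy :: "'a measure \<Rightarrow> (ennreal \<Rightarrow> 'a measure) \<Rightarrow> 'a policy \<Rightarrow> bool"
  where "control_policy M F \<pi> \<longleftrightarrow> (\<forall>x\<ge>0.
    predictable M F (retention \<pi> x) \<and>
    (\<forall>s>0. \<forall>\<omega>\<in>space M. retention \<pi> x s \<omega> \<in> {0..1}) \<and>
    (\<forall>i. stopping_time F (inj_time \<pi> x i)) \<and>
    (\<forall>i. \<forall>\<omega>\<in>space M. inj_time \<pi> x i \<omega> \<le> inj_time \<pi> x (Suc i) \<omega> \<and>
      (inj_time \<pi> x i \<omega> < \<infinity> \<longrightarrow> inj_time \<pi> x i \<omega> < inj_time \<pi> x (Suc i) \<omega>)) \<and>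
    (\<forall>i. inj_size \<pi> x i \<in> borel_measurable (filtration.pre_sigma (space M) F (inj_time \<pi> x i))) \<and>
    (\<forall>i. \<forall>\<omega>\<in>space M. inj_size \<pi> x i \<omega> > 0))"

text \<open>
  \<open>X\<close> is (a version of) the surplus process under \<open>\<pi>\<close> started at \<open>x\<close>. A sum over infinitely many
  injections before a finite time is \<open>0\<close> by convention; a policy of finite cost performs
  infinitely many injections in bounded time only with probability \<open>0\<close>.
\<close>

definition surplus_process :: "'a measure \<Rightarrow> (ennreal \<Rightarrow> 'a measure) \<Rightarrow> (real \<Rightarrow> 'a \<Rightarrow> real) \<Rightarrow>
    real \<Rightarrow> real \<Rightarrow> real \<Rightarrow> 'a policy \<Rightarrow> real \<Rightarrow> (real \<Rightarrow> 'a \<Rightarrow> real) \<Rightarrow> bool"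
  where "surplus_process M F w \<mu> \<sigma> \<delta> \<pi> x X \<longleftrightarrow>
    (\<exists>Y. ito_integral_process M F w (\<lambda>s \<omega>. \<sigma> * retention \<pi> x s \<omega>) Y \<and>
      (\<forall>t\<ge>0. \<forall>\<omega>\<in>space M. X t \<omega> =
        x + (LINT s:{0<..t}|lborel. \<mu> * retention \<pi> x s \<omega> - \<delta>) + Y t \<omega>
          + (\<Sum>i | inj_time \<pi> x i \<omega> \<le> ennreal t. inj_size \<pi> x i \<omega>)))"

definition injection_cost :: "real \<Rightarrow> real \<Rightarrow> real \<Rightarrow> real"
  where "injection_cost K c \<xi> = K + c * \<xi>"

definition cost :: "'a measure \<Rightarrow> real \<Rightarrow> real \<Rightarrow> real \<Rightarrow> 'a policy \<Rightarrow> real \<Rightarrow> ennreal"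
  where "cost M r K c \<pi> x =
    (\<integral>\<^sup>+\<omega>. (\<Sum>i. if inj_time \<pi> x i \<omega> < \<infinity>
      then ennreal (exp (- r * enn2real (inj_time \<pi> x i \<omega>)) * injection_cost K c (inj_size \<pi> x i \<omega>))
      else 0) \<partial>M)"

definition admissible :: "'a measure \<Rightarrow> (ennreal \<Rightarrow> 'a measure) \<Rightarrow> (real \<Rightarrow> 'a \<Rightarrow> real) \<Rightarrow>
    real \<Rightarrow> real \<Rightarrow> real \<Rightarrow> real \<Rightarrow> real \<Rightarrow> real \<Rightarrow> 'a policy set"
  where "admissible M F w \<mu> \<sigma> \<delta> r K c = {\<pi>. control_policy M F \<pi> \<and>
    (\<forall>x\<ge>0. (\<exists>X. surplus_process M F w \<mu> \<sigma> \<delta> \<pi> x X \<and> (AE \<omega> in M. \<forall>t\<ge>0. X t \<omega> \<ge> 0)) \<and>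
      cost M r K c \<pi> x < \<infinity>)}"

definition value_function :: "'a measure \<Rightarrow> (ennreal \<Rightarrow> 'a measure) \<Rightarrow> (real \<Rightarrow> 'a \<Rightarrow> real) \<Rightarrow>
    real \<Rightarrow> real \<Rightarrow> real \<Rightarrow> real \<Rightarrow> real \<Rightarrow> real \<Rightarrow> real \<Rightarrow> ennreal"
  where "value_function M F w \<mu> \<sigma> \<delta> r K c x =
    (INF \<pi>\<in>admissible M F w \<mu> \<sigma> \<delta> r K c. cost M r K c \<pi> x)"

definition optimal_policy :: "'a measure \<Rightarrow> (ennreal \<Rightarrow> 'a measure) \<Rightarrow> (real \<Rightarrow> 'a \<Rightarrow> real) \<Rightarrow>
    real \<Rightarrow> real \<Rightarrow> real \<Rightarrow> real \<Rightarrow> real \<Rightarrow> real \<Rightarrow> 'a policy \<Rightarrow> bool"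
  where "optimal_policy M F w \<mu> \<sigma> \<delta> r K c \<pi> \<longleftrightarrow>
    \<pi> \<in> admissible M F w \<mu> \<sigma> \<delta> r K c \<and>
    (\<forall>x\<ge>0. cost M r K c \<pi> x = value_function M F w \<mu> \<sigma> \<delta> r K c x)"


subsection \<open>Injection at ruin\<close>

definition surplus_before :: "'a policy \<Rightarrow> real \<Rightarrow> (real \<Rightarrow> 'a \<Rightarrow> real) \<Rightarrow> real \<Rightarrow> 'a \<Rightarrow> real"
  where "surplus_before \<pi> x X t \<omega> =
    X t \<omega> - (\<Sum>i | inj_time \<pi> x i \<omega> = ennreal t. inj_size \<pi> x i \<omega>)"

text \<open>
  The first time, after the preceding injection if there is one, at which the surplus before
  injection is zero; it is \<open>\<infinity>\<close> (the infimum of the empty set) if there is no such time.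
\<close>

fun ruin_time :: "'a policy \<Rightarrow> real \<Rightarrow> (real \<Rightarrow> 'a \<Rightarrow> real) \<Rightarrow> nat \<Rightarrow> 'a \<Rightarrow> ennreal"
  where
    "ruin_time \<pi> x X 0 \<omega> = Inf {ennreal t | t. 0 \<le> t \<and> surplus_before \<pi> x X t \<omega> = 0}"
  | "ruin_time \<pi> x X (Suc i) \<omega> =
      Inf {ennreal t | t. 0 \<le> t \<and> inj_time \<pi> x i \<omega> < ennreal t \<and> surplus_before \<pi> x X t \<omega> = 0}"

definition injects_at_ruin :: "'a measure \<Rightarrow> (ennreal \<Rightarrow> 'a measure) \<Rightarrow> (real \<Rightarrow> 'a \<Rightarrow> real) \<Rightarrow>
    real \<Rightarrow> real \<Rightarrow> real \<Rightarrow> 'a policy \<Rightarrow> bool"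
  where "injects_at_ruin M F w \<mu> \<sigma> \<delta> \<pi> \<longleftrightarrow> (\<forall>x\<ge>0. \<exists>X.
    surplus_process M F w \<mu> \<sigma> \<delta> \<pi> x X \<and>
    (AE \<omega> in M. \<forall>i. inj_time \<pi> x i \<omega> = ruin_time \<pi> x X i \<omega>))"

definition constant_controls :: "'a measure \<Rightarrow> real \<Rightarrow> real \<Rightarrow> 'a policy \<Rightarrow> bool"
  where "constant_controls M u \<xi> \<pi> \<longleftrightarrow> (\<forall>x\<ge>0. \<forall>\<omega>\<in>space M.
    (\<forall>s>0. retention \<pi> x s \<omega> = u) \<and> (\<forall>i. inj_size \<pi> x i \<omega> = \<xi>))"

end

theory Submission
  imports Defs
begin

text \<open>
  The candidate value function is exponential, so no Ito formula is needed. Let \<open>Z\<close> be the surplus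
  without injections, \<open>\<kappa> = \<mu> / \<sigma>\<close> and \<open>h = \<sigma> u\<close>; the choice of \<open>\<beta>\<close> means \<open>\<beta> \<delta> - r = \<kappa>\<^sup>2 / 2\<close>. The
  process \<open>exp (- r t - \<beta> Z\<^sub>t)\<close> is the exponential martingale of \<open>- \<beta> h\<close> times the exponential of
  \<open>\<integral>\<^sub>0\<^sup>t (\<beta> h\<^sub>s - \<kappa>)\<^sup>2 / 2 ds\<close>, hence a submartingale for every retention policy and a martingale
  for \<open>u\<^sup>*\<close>, where \<open>\<beta> h = \<kappa>\<close>. For elementary integrands this follows by conditioning on one cell at
  a time; bounds on higher moments carry it over to mean-square limits and, through finite grids, to
  stopping times.

  Between injections the discounted value \<open>exp (- r t) \<alpha> exp (- \<beta> X\<^sub>t)\<close> therefore increases in mean,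
  and at an injection of size \<open>\<zeta>\<close> it falls by at most the discounted cost of that injection. Summing up,
  and letting the number of injections and then the horizon tend to infinity, gives
  \<open>\<alpha> exp (- \<beta> x) \<le> C\<^sup>\<pi> x\<close>. Under \<open>\<pi>\<^sup>*\<close> the \<open>i\<close>-th injection (counted from \<open>0\<close>) takes place when \<open>Z\<close>
  first reaches \<open>- i \<xi>\<^sup>*\<close>, and its mean discount factor is at most \<open>exp (- \<beta> (x + i \<xi>\<^sup>*))\<close>; the geometric
  series of these bounds has the sum \<open>\<alpha> exp (- \<beta> x)\<close>.
\<close>

section \<open>Gaussian increments of Brownian motion\<close>

text \<open>The constants come from the dynamic programming equation. On
  \<open>exp (- \<beta> * x)\<close> the discounted generator with retention \<open>u\<close> acts
  as multiplication by \<open>((\<beta> * \<sigma> * u - \<kappa>)\<^sup>2 - \<kappa>\<^sup>2) / 2 +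
  \<beta> * \<delta> - r\<close>. Its minimum over \<open>u\<close> is 0 exactly for this
  \<open>\<beta>\<close>, attained at \<open>\<beta> * \<sigma> * u = \<kappa>\<close>; the bound on
  \<open>\<delta>\<close> says that this \<open>u\<close> is below 1. Minimising
  \<open>K + c * \<xi> + \<alpha> * exp (- \<beta> * \<xi>)\<close> yields the injection, and
  equating the minimum with \<open>\<alpha>\<close>, the value at 0, is the equation for
  \<open>\<alpha>\<close>. The obstacle is that the filtration need not be complete or
  right-continuous and that the Ito integral is only \<open>M\<close>-measurable. So the
  submartingale property is tested against \<open>F s\<close>-measurable weights with values in
  [0, 1] instead of being written with conditional expectations. Limits on the smaller side of an
  inequality are handled by Fatou's lemma, those on the larger side by second moments, which is why
  squares are carried along with first powers.\<close>

lemma nn_integral_normal_exp: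
  assumes "0 < s"
  shows "(\<integral>\<^sup>+y. ennreal (exp (a * y)) * ennreal (normal_density 0 s y) \<partial>lborel) = ennreal (exp (a\<^sup>2 * s\<^sup>2 / 2))"
proof -
  \<comment> \<open>Completing the square: the factor \<open>exp (a * y)\<close> moves the mean of
    the density from 0 to \<open>a * s\<^sup>2\<close>.\<close>
  have eq: "exp (a * y) * normal_density 0 s y = exp (a\<^sup>2 * s\<^sup>2 / 2) * normal_density (a * s\<^sup>2) s y" for y
    using assms unfolding normal_density_def
    by (simp add: exp_add[symmetric] field_simps power2_eq_square)
  interpret N: prob_space "density lborel (normal_density (a * s\<^sup>2) s)"
    by (rule prob_space_normal_density[OF assms])
  have "(\<integral>\<^sup>+y. ennreal (normal_density (a * s\<^sup>2) s y) \<partial>lborel) = 1"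
    using N.emeasure_space_1 by (simp add: emeasure_density)
  then show ?thesis
    by (simp add: ennreal_mult'[symmetric] eq)
       (simp add: ennreal_mult' nn_integral_cmult)
qed

context brownian_motion
begin

abbreviation nn_expectation :: "('a \<Rightarrow> ennreal) \<Rightarrow> ennreal" (binder \<open>\<E>\<close> 10)
  where "nn_expectation f \<equiv> integral\<^sup>N M f"

lemma measurable_F_M: "f \<in> measurable (F t) N \<Longrightarrow> f \<in> measurable M N"
  using measurable_from_subalg[OF subalgebra_F] by blast

lemma measurable_F_mono: "s \<le> t \<Longrightarrow> f \<in> measurable (F s) N \<Longrightarrow> f \<in> measurable (F t) N"
  using sets_F_mono[of s t] by (auto simp: measurable_def space_F)

lemma w_measurable_F: "0 \<le> s \<Longrightarrow> s \<le> t \<Longrightarrow> w s \<in> borel_measurable (F (ennreal t))"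
  by (rule measurable_F_mono[OF _ adapted]) (auto intro: ennreal_leI)

lemma w_measurable [measurable]: "0 \<le> s \<Longrightarrow> w s \<in> borel_measurable M"
  by (rule measurable_F_M[OF adapted])

lemma indep_var_increment:
  assumes st: "0 \<le> s" "s < t" and Z: "Z \<in> borel_measurable (F (ennreal s))"
    and f: "f \<in> borel_measurable borel"
  shows "indep_var borel (Z :: 'a \<Rightarrow> real) borel (\<lambda>\<omega>. f (w t \<omega> - w s \<omega>) :: real)"
proof -
  have "sigma_sets (space M) {Z -` A \<inter> space M |A. A \<in> sets borel} \<subseteq> sets (F (ennreal s))"
    using sets.sigma_sets_subset[of "{Z -` A \<inter> space M |A. A \<in> sets borel}" "F (ennreal s)"]
      measurable_sets[OF Z] by (auto simp: space_F)
  moreover have "sigma_sets (space M) {(\<lambda>\<omega>. f (w t \<omega> - w s \<omega>)) -` A \<inter> space M |A. A \<in> sets borel}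
      \<subseteq> sets (vimage_algebra (space M) (\<lambda>\<omega>. w t \<omega> - w s \<omega>) borel)" (is "sigma_sets _ ?G \<subseteq> sets ?V")
  proof -
    have "(\<lambda>\<omega>. f (w t \<omega> - w s \<omega>)) \<in> borel_measurable ?V"
      by (rule measurable_compose[OF measurable_vimage_algebra1 f]) auto
    then have "?G \<subseteq> sets ?V"
      using measurable_sets[of "\<lambda>\<omega>. f (w t \<omega> - w s \<omega>)" ?V borel] by auto
    then show ?thesis
      using sets.sigma_sets_subset[of ?G ?V] by simp
  qed
  moreover have "random_variable borel Z" "random_variable borel (\<lambda>\<omega>. f (w t \<omega> - w s \<omega>))"
    using st f by (auto intro: measurable_F_M[OF Z])
  ultimately show ?thesis
    using independent_increments[OF st] unfolding indep_var_eq indep_sets2_eq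
    by (meson subset_eq subset_trans)
qed

text \<open>Given \<open>F (ennreal s)\<close>, the increment can be integrated out under its normal
  law with the first argument of \<open>g\<close> frozen, because the past and the increment have a
  product law. This takes the place of a conditional expectation.\<close>

lemma nn_integral_increment:
  assumes st: "0 \<le> s" "s < t"
    and g: "case_prod g \<in> borel_measurable (F (ennreal s) \<Otimes>\<^sub>M borel)"
  shows "(\<E> \<omega>. g \<omega> (w t \<omega> - w s \<omega>))
    = (\<E> \<omega>. (\<integral>\<^sup>+y. g \<omega> y * ennreal (normal_density 0 (sqrt (t - s)) y) \<partial>lborel))"
proof -
  let ?S = "F (ennreal s)" and ?D = "\<lambda>\<omega>. w t \<omega> - w s \<omega>"
  \<comment> \<open>\<open>?P\<close> is \<open>M\<close> restricted to the events of the past: the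
    image under the identity, viewed as a map into the smaller sigma-algebra.\<close>
  let ?P = "distr M ?S (\<lambda>\<omega>. \<omega>)" and ?Q = "distr M borel ?D"
  have id: "(\<lambda>\<omega>. \<omega>) \<in> measurable M ?S"
    by (rule measurable_F_M[of _ "ennreal s"]) simp
  have D: "?D \<in> borel_measurable M"
    using st by simp
  interpret P: prob_space ?P using id by (rule prob_space_distr)
  interpret Q: prob_space ?Q using D by (rule prob_space_distr)
  have eq: "?P \<Otimes>\<^sub>M ?Q = distr M (?S \<Otimes>\<^sub>M borel) (\<lambda>\<omega>. (\<omega>, ?D \<omega>))"
  proof (rule pair_measure_eqI[OF P.sigma_finite_measure Q.sigma_finite_measure])
    fix A B assume A: "A \<in> sets ?P" and B: "B \<in> sets ?Q"
    have AM: "A \<in> events" and BM: "?D -` B \<inter> space M \<in> events"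
      using measurable_sets[OF id] measurable_sets[OF D] A B sets.sets_into_space[of A ?S]
      by (auto simp: space_F Int_absorb2 subalgebra_F[unfolded subalgebra_def, THEN conjunct2, THEN subsetD])
    have "?D -` B \<inter> space M \<in> sets (vimage_algebra (space M) ?D borel)"
      using B by (auto intro!: in_vimage_algebra)
    then have "prob (A \<inter> (?D -` B \<inter> space M)) = prob A * prob (?D -` B \<inter> space M)"
      using independent_increments[OF st] A by (auto simp: indep_sets2_eq)
    moreover have "A \<inter> (?D -` B \<inter> space M) = (\<lambda>\<omega>. (\<omega>, ?D \<omega>)) -` (A \<times> B) \<inter> space M"
      by auto
    moreover have "A \<inter> space M = A"
      using sets.sets_into_space[OF AM] by auto
    ultimately show "emeasure ?P A * emeasure ?Q B
      = emeasure (distr M (?S \<Otimes>\<^sub>M borel) (\<lambda>\<omega>. (\<omega>, ?D \<omega>))) (A \<times> B)"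
      using A B AM BM id D
      by (simp add: emeasure_distr emeasure_eq_measure ennreal_mult'[symmetric] vimage_def)
  qed (simp cong: measurable_cong_sets)
  have g': "case_prod g \<in> borel_measurable (?P \<Otimes>\<^sub>M ?Q)"
    using g by (simp cong: measurable_cong_sets)
  have Qd: "?Q = density lborel (normal_density 0 (sqrt (t - s)))"
    using distributed_distr_eq_density[OF gaussian_increments[OF st]]
    by (metis distr_cong sets_lborel)
  have "(\<E> \<omega>. g \<omega> (?D \<omega>)) = (\<integral>\<^sup>+z. case_prod g z \<partial>distr M (?S \<Otimes>\<^sub>M borel) (\<lambda>\<omega>. (\<omega>, ?D \<omega>)))"
    using id D g by (subst nn_integral_distr) auto
  also have "\<dots> = (\<integral>\<^sup>+\<omega>. (\<integral>\<^sup>+y. g \<omega> y \<partial>?Q) \<partial>?P)"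
    using Q.nn_integral_fst[OF g'] by (simp add: eq)
  also have "\<dots> = (\<E> \<omega>. (\<integral>\<^sup>+y. g \<omega> y \<partial>?Q))"
    using id Q.borel_measurable_nn_integral_fst[OF g'] by (subst nn_integral_distr) auto
  also have "\<dots> = (\<E> \<omega>. (\<integral>\<^sup>+y. g \<omega> y * ennreal (normal_density 0 (sqrt (t - s)) y) \<partial>lborel))"
  proof (rule nn_integral_cong)
    fix \<omega> assume "\<omega> \<in> space M"
    then have "(\<lambda>y. g \<omega> y) \<in> borel_measurable borel"
      using measurable_Pair2[OF g, of \<omega>] by (simp add: space_F)
    then show "(\<integral>\<^sup>+y. g \<omega> y \<partial>?Q) = (\<integral>\<^sup>+y. g \<omega> y * ennreal (normal_density 0 (sqrt (t - s)) y) \<partial>lborel)"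
      unfolding Qd by (subst nn_integral_density) (auto simp: mult.commute)
  qed
  finally show ?thesis .
qed

text \<open>With \<open>\<psi>\<close> frozen this is the normal moment generating function.
  Nonnegative integrals allow \<open>Z\<close> to be the unbounded exponential accumulated so
  far.\<close>

lemma nn_integral_exp_increment:
  assumes st: "0 \<le> s" "s \<le> t"
    and [measurable]: "Z \<in> borel_measurable (F (ennreal s))" "\<psi> \<in> borel_measurable (F (ennreal s))"
  shows "(\<E> \<omega>. Z \<omega> * ennreal (exp (\<psi> \<omega> * (w t \<omega> - w s \<omega>))))
    = (\<E> \<omega>. Z \<omega> * ennreal (exp ((\<psi> \<omega>)\<^sup>2 * (t - s) / 2)))"
\<comment> \<open>The law of an increment is assumed for \<open>s < t\<close> only.\<close>
proof (cases "s = t")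
  case False
  then have st': "s < t" using st by simp
  have "(\<E> \<omega>. Z \<omega> * ennreal (exp (\<psi> \<omega> * (w t \<omega> - w s \<omega>))))
    = (\<E> \<omega>. (\<integral>\<^sup>+y. Z \<omega> * ennreal (exp (\<psi> \<omega> * y)) * ennreal (normal_density 0 (sqrt (t - s)) y) \<partial>lborel))"
    by (rule nn_integral_increment[OF st(1) st', where g = "\<lambda>\<omega> y. Z \<omega> * ennreal (exp (\<psi> \<omega> * y))"]) measurable
  also have "\<dots> = (\<E> \<omega>. Z \<omega> * ennreal (exp ((\<psi> \<omega>)\<^sup>2 * (t - s) / 2)))"
    using st' nn_integral_normal_exp[of "sqrt (t - s)"]
    by (simp add: mult.assoc nn_integral_cmult)
  finally show ?thesis .
qed simp

lemma increment_moments: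
  assumes st: "0 \<le> s" "s \<le> t"
  shows "integrable M (\<lambda>\<omega>. w t \<omega> - w s \<omega>)" "(\<integral>\<omega>. w t \<omega> - w s \<omega> \<partial>M) = 0"
    and "integrable M (\<lambda>\<omega>. (w t \<omega> - w s \<omega>)\<^sup>2)" "(\<integral>\<omega>. (w t \<omega> - w s \<omega>)\<^sup>2 \<partial>M) = t - s"
proof -
  have *: "integrable M (\<lambda>\<omega>. w t \<omega> - w s \<omega>)" "(\<integral>\<omega>. w t \<omega> - w s \<omega> \<partial>M) = 0"
    "integrable M (\<lambda>\<omega>. (w t \<omega> - w s \<omega>)\<^sup>2)" "(\<integral>\<omega>. (w t \<omega> - w s \<omega>)\<^sup>2 \<partial>M) = t - s"
    if st': "s < t"
  proof -
    have pos: "0 < sqrt (t - s)" using st' by simp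
    note d = gaussian_increments[OF st(1) st']
    show "integrable M (\<lambda>\<omega>. w t \<omega> - w s \<omega>)"
      using distributed_integrable[OF d, of "\<lambda>x. x"] integrable_normal_moment_nz_1[OF pos, of 0] by simp
    show "(\<integral>\<omega>. w t \<omega> - w s \<omega> \<partial>M) = 0"
      using distributed_integral[OF d, of "\<lambda>x. x"] integral_normal_moment_nz_1[OF pos, of 0] by simp
    show "integrable M (\<lambda>\<omega>. (w t \<omega> - w s \<omega>)\<^sup>2)"
      using distributed_integrable[OF d, of "\<lambda>x. x\<^sup>2"] integrable_normal_moment[OF pos, of 0 2] by simp
    show "(\<integral>\<omega>. (w t \<omega> - w s \<omega>)\<^sup>2 \<partial>M) = t - s"
      using distributed_integral[OF d, of "\<lambda>x. x\<^sup>2"] integral_normal_moment_even[OF pos, of 0 1] st'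
      by (simp add: fact_numeral)
  qed
  show "integrable M (\<lambda>\<omega>. w t \<omega> - w s \<omega>)" "(\<integral>\<omega>. w t \<omega> - w s \<omega> \<partial>M) = 0"
    "integrable M (\<lambda>\<omega>. (w t \<omega> - w s \<omega>)\<^sup>2)" "(\<integral>\<omega>. (w t \<omega> - w s \<omega>)\<^sup>2 \<partial>M) = t - s"
    using * st by (cases "s = t", simp, simp)+
qed

lemma increment_independence:
  assumes st: "0 \<le> s" "s \<le> t" and Z: "Z \<in> borel_measurable (F (ennreal s))" "integrable M Z"
  shows "integrable M (\<lambda>\<omega>. Z \<omega> * (w t \<omega> - w s \<omega>))" "(\<integral>\<omega>. Z \<omega> * (w t \<omega> - w s \<omega>) \<partial>M) = 0"
    and "integrable M (\<lambda>\<omega>. Z \<omega> * (w t \<omega> - w s \<omega>)\<^sup>2)"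
      "(\<integral>\<omega>. Z \<omega> * (w t \<omega> - w s \<omega>)\<^sup>2 \<partial>M) = (t - s) * (\<integral>\<omega>. Z \<omega> \<partial>M)"
proof -
  have *: "integrable M (\<lambda>\<omega>. Z \<omega> * (w t \<omega> - w s \<omega>))" "(\<integral>\<omega>. Z \<omega> * (w t \<omega> - w s \<omega>) \<partial>M) = 0"
    "integrable M (\<lambda>\<omega>. Z \<omega> * (w t \<omega> - w s \<omega>)\<^sup>2)"
      "(\<integral>\<omega>. Z \<omega> * (w t \<omega> - w s \<omega>)\<^sup>2 \<partial>M) = (t - s) * (\<integral>\<omega>. Z \<omega> \<partial>M)"
    if st': "s < t"
  proof -
    have i1: "indep_var borel Z borel (\<lambda>\<omega>. w t \<omega> - w s \<omega>)"
      by (rule indep_var_increment[OF st(1) st' Z(1), of "\<lambda>x. x"]) simp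
    have i2: "indep_var borel Z borel (\<lambda>\<omega>. (w t \<omega> - w s \<omega>)\<^sup>2)"
      by (rule indep_var_increment[OF st(1) st' Z(1), of "\<lambda>x. x\<^sup>2"]) simp
    note m = increment_moments[OF st]
    show "integrable M (\<lambda>\<omega>. Z \<omega> * (w t \<omega> - w s \<omega>))"
      by (rule indep_var_integrable[OF i1 Z(2) m(1)])
    show "(\<integral>\<omega>. Z \<omega> * (w t \<omega> - w s \<omega>) \<partial>M) = 0"
      using indep_var_lebesgue_integral[OF i1 Z(2) m(1)] m(2) by simp
    show "integrable M (\<lambda>\<omega>. Z \<omega> * (w t \<omega> - w s \<omega>)\<^sup>2)"
      by (rule indep_var_integrable[OF i2 Z(2) m(3)])
    show "(\<integral>\<omega>. Z \<omega> * (w t \<omega> - w s \<omega>)\<^sup>2 \<partial>M) = (t - s) * (\<integral>\<omega>. Z \<omega> \<partial>M)"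
      using indep_var_lebesgue_integral[OF i2 Z(2) m(3)] m(4) by simp
  qed
  show "integrable M (\<lambda>\<omega>. Z \<omega> * (w t \<omega> - w s \<omega>))" "(\<integral>\<omega>. Z \<omega> * (w t \<omega> - w s \<omega>) \<partial>M) = 0"
    "integrable M (\<lambda>\<omega>. Z \<omega> * (w t \<omega> - w s \<omega>)\<^sup>2)"
      "(\<integral>\<omega>. Z \<omega> * (w t \<omega> - w s \<omega>)\<^sup>2 \<partial>M) = (t - s) * (\<integral>\<omega>. Z \<omega> \<partial>M)"
    using * st by (cases "s = t", simp, simp)+
qed

end

section \<open>The Ito isometry\<close>

context brownian_motion
begin

text \<open>Only the overlap of the two intervals contributes, with length
  \<open>max 0 (min b d - max a c)\<close>: off the overlap the later factor is independent of the
  rest and has mean 0.\<close>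

lemma increment_product:
  assumes 0: "0 \<le> a" "a \<le> b" "a \<le> c" "c \<le> d"
    and f: "f \<in> borel_measurable (F (ennreal a))" "\<And>\<omega>. \<omega> \<in> space M \<Longrightarrow> \<bar>f \<omega>\<bar> \<le> Bf"
    and g: "g \<in> borel_measurable (F (ennreal c))" "\<And>\<omega>. \<omega> \<in> space M \<Longrightarrow> \<bar>g \<omega>\<bar> \<le> Bg"
  shows "integrable M (\<lambda>\<omega>. f \<omega> * g \<omega> * ((w b \<omega> - w a \<omega>) * (w d \<omega> - w c \<omega>))) \<and>
    (\<integral>\<omega>. f \<omega> * g \<omega> * ((w b \<omega> - w a \<omega>) * (w d \<omega> - w c \<omega>)) \<partial>M)
      = (\<integral>\<omega>. f \<omega> * g \<omega> \<partial>M) * max 0 (min b d - max a c)"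
proof -
  have fc: "f \<in> borel_measurable (F (ennreal c))"
    by (rule measurable_F_mono[OF _ f(1)]) (use 0 in \<open>auto intro: ennreal_leI\<close>)
  have wF: "w s \<in> borel_measurable (F (ennreal t))" if "0 \<le> s" "s \<le> t" for s t
    by (rule w_measurable_F[OF that])
  have fM [measurable]: "f \<in> borel_measurable M" "g \<in> borel_measurable M"
    using measurable_F_M[OF f(1)] measurable_F_M[OF g(1)] by auto
  have bd: "\<bar>f \<omega> * g \<omega>\<bar> \<le> Bf * Bg" if "\<omega> \<in> space M" for \<omega>
    using f(2)[OF that] g(2)[OF that] unfolding abs_mult by (intro mult_mono) auto
  have int0: "integrable M (\<lambda>\<omega>. f \<omega> * g \<omega>)"
    by (rule integrable_const_bound[of _ "Bf * Bg"]) (use bd in auto)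
  have int: "integrable M (\<lambda>\<omega>. f \<omega> * g \<omega> * (w t \<omega> - w s \<omega>))" if "0 \<le> s" "s \<le> t" for s t
  proof (rule Bochner_Integration.integrable_bound)
    show "integrable M (\<lambda>\<omega>. Bf * Bg * (w t \<omega> - w s \<omega>))"
      using increment_moments(1)[OF that] by simp
    show "AE \<omega> in M. norm (f \<omega> * g \<omega> * (w t \<omega> - w s \<omega>)) \<le> norm (Bf * Bg * (w t \<omega> - w s \<omega>))"
    proof (rule AE_I2)
      fix \<omega> assume "\<omega> \<in> space M"
      from bd[OF this] show "norm (f \<omega> * g \<omega> * (w t \<omega> - w s \<omega>)) \<le> norm (Bf * Bg * (w t \<omega> - w s \<omega>))"
        unfolding norm_mult[of "f \<omega> * g \<omega>"] norm_mult[of "Bf * Bg"] by (intro mult_right_mono) auto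
    qed
    show "(\<lambda>\<omega>. f \<omega> * g \<omega> * (w t \<omega> - w s \<omega>)) \<in> borel_measurable M"
      using that by (intro borel_measurable_times borel_measurable_diff fM w_measurable) auto
  qed
  note ac = order_trans[OF 0(1) 0(3)]
  show ?thesis
  proof (cases "b \<le> c")
    case True
    have m: "(\<lambda>\<omega>. f \<omega> * g \<omega> * (w b \<omega> - w a \<omega>)) \<in> borel_measurable (F (ennreal c))"
      using fc g(1) 0 True by (intro borel_measurable_times borel_measurable_diff wF) auto
    from increment_independence(1,2)[OF ac 0(4) m int[OF 0(1,2)]] True 0 show ?thesis
      by (simp add: mult.assoc)
  next
    case False
    define e e' where "e = min b d" and "e' = max b d"
    have e: "c \<le> e" "e \<le> e'" "0 \<le> e" "max a c = c" using False 0 by (auto simp: e_def e'_def)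
    \<comment> \<open>Cutting at \<open>c\<close> and at the earlier end point \<open>e\<close>
      leaves one square, taken over the overlap. In the other two summands the last factor is an
      increment later than everything else, so they integrate to 0.\<close>
    have eq: "f \<omega> * g \<omega> * ((w b \<omega> - w a \<omega>) * (w d \<omega> - w c \<omega>)) =
      f \<omega> * g \<omega> * (w c \<omega> - w a \<omega>) * (w d \<omega> - w c \<omega>) +
      (f \<omega> * g \<omega> * (w e \<omega> - w c \<omega>)\<^sup>2 + f \<omega> * g \<omega> * (w e \<omega> - w c \<omega>) * (w e' \<omega> - w e \<omega>))" for \<omega>
      by (cases "b \<le> d") (simp_all add: e_def e'_def min_def max_def algebra_simps power2_eq_square)
    have fe: "f \<in> borel_measurable (F (ennreal e))" "g \<in> borel_measurable (F (ennreal e))"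
      using e 0 by (auto intro!: measurable_F_mono[OF _ f(1)] measurable_F_mono[OF _ g(1)] ennreal_leI)
    have m1: "(\<lambda>\<omega>. f \<omega> * g \<omega> * (w c \<omega> - w a \<omega>)) \<in> borel_measurable (F (ennreal c))"
      using fc g(1) 0 by (intro borel_measurable_times borel_measurable_diff wF) auto
    have m2: "(\<lambda>\<omega>. f \<omega> * g \<omega>) \<in> borel_measurable (F (ennreal c))"
      using fc g(1) by measurable
    have m3: "(\<lambda>\<omega>. f \<omega> * g \<omega> * (w e \<omega> - w c \<omega>)) \<in> borel_measurable (F (ennreal e))"
      using fe e 0 by (intro borel_measurable_times borel_measurable_diff wF) auto
    note 1 = increment_independence(1,2)[OF ac 0(4) m1 int[OF 0(1,3)]]
    note 2 = increment_independence(3,4)[OF ac e(1) m2 int0]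
    note 3 = increment_independence(1,2)[OF e(3,2) m3 int[OF ac e(1)]]
    show ?thesis
      unfolding eq using 1 2 3 e
      by (simp add: e_def[symmetric] mult.commute)
  qed
qed

lemma increment_product':
  assumes "0 \<le> a" "a \<le> b" "0 \<le> c" "c \<le> d"
    and "f \<in> borel_measurable (F (ennreal a))" "\<And>\<omega>. \<omega> \<in> space M \<Longrightarrow> \<bar>f \<omega>\<bar> \<le> Bf"
    and "g \<in> borel_measurable (F (ennreal c))" "\<And>\<omega>. \<omega> \<in> space M \<Longrightarrow> \<bar>g \<omega>\<bar> \<le> Bg"
  shows "integrable M (\<lambda>\<omega>. (f \<omega> * (w b \<omega> - w a \<omega>)) * (g \<omega> * (w d \<omega> - w c \<omega>))) \<and>
    (\<integral>\<omega>. (f \<omega> * (w b \<omega> - w a \<omega>)) * (g \<omega> * (w d \<omega> - w c \<omega>)) \<partial>M)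
      = (\<integral>\<omega>. f \<omega> * g \<omega> \<partial>M) * max 0 (min b d - max a c)"
proof (cases "a \<le> c")
  case True
  then show ?thesis
    using increment_product[of a b c d f Bf g Bg] assms by (simp add: mult_ac)
next
  case False
  then show ?thesis
    using increment_product[of c d a b g Bg f Bf] assms by (simp add: mult_ac min.commute max.commute)
qed

text \<open>The intervals may overlap, so the difference of two elementary integrals on different
  grids is one such sum and no common refinement of the grids is formed. Both sides expand to the
  same double sum over pairs, weighted by the lengths of the overlaps.\<close>

lemma ito_isometry_sum:
  fixes a b :: "'i \<Rightarrow> real" and \<phi> :: "'i \<Rightarrow> 'a \<Rightarrow> real"
  assumes fin: "finite I" and ab: "\<And>i. i \<in> I \<Longrightarrow> 0 \<le> a i \<and> a i \<le> b i"
    and meas: "\<And>i. i \<in> I \<Longrightarrow> \<phi> i \<in> borel_measurable (F (ennreal (a i)))"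
    and bd: "\<And>i. i \<in> I \<Longrightarrow> \<exists>B. \<forall>\<omega>\<in>space M. \<bar>\<phi> i \<omega>\<bar> \<le> B"
  shows "(\<E> \<omega>. ennreal ((\<Sum>i\<in>I. \<phi> i \<omega> * (w (b i) \<omega> - w (a i) \<omega>))\<^sup>2)) =
    (\<E> \<omega>. (\<integral>\<^sup>+s. ennreal ((\<Sum>i\<in>I. \<phi> i \<omega> * indicator {a i<..b i} s)\<^sup>2) \<partial>lborel))"
proof -
  let ?l = "\<lambda>i j. max 0 (min (b i) (b j) - max (a i) (a j))"
  have \<phi>M [measurable]: "\<phi> i \<in> borel_measurable M" if "i \<in> I" for i
    by (rule measurable_F_M[OF meas[OF that]])
  have pair: "integrable M (\<lambda>\<omega>. (\<phi> i \<omega> * (w (b i) \<omega> - w (a i) \<omega>)) * (\<phi> j \<omega> * (w (b j) \<omega> - w (a j) \<omega>))) \<and>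
    (\<integral>\<omega>. (\<phi> i \<omega> * (w (b i) \<omega> - w (a i) \<omega>)) * (\<phi> j \<omega> * (w (b j) \<omega> - w (a j) \<omega>)) \<partial>M)
      = (\<integral>\<omega>. \<phi> i \<omega> * \<phi> j \<omega> \<partial>M) * ?l i j" if ij: "i \<in> I" "j \<in> I" for i j
  proof -
    from bd[OF ij(1)] bd[OF ij(2)] obtain Bi Bj where
      "\<And>\<omega>. \<omega> \<in> space M \<Longrightarrow> \<bar>\<phi> i \<omega>\<bar> \<le> Bi" "\<And>\<omega>. \<omega> \<in> space M \<Longrightarrow> \<bar>\<phi> j \<omega>\<bar> \<le> Bj"
      by blast
    then show ?thesis
      using ij ab meas by (intro increment_product'[where Bf = Bi and Bg = Bj]) auto
  qed
  have prod_int: "integrable M (\<lambda>\<omega>. \<phi> i \<omega> * \<phi> j \<omega>)" if ij: "i \<in> I" "j \<in> I" for i j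
  proof -
    from bd[OF ij(1)] bd[OF ij(2)] obtain Bi Bj where
      B: "\<And>\<omega>. \<omega> \<in> space M \<Longrightarrow> \<bar>\<phi> i \<omega>\<bar> \<le> Bi" "\<And>\<omega>. \<omega> \<in> space M \<Longrightarrow> \<bar>\<phi> j \<omega>\<bar> \<le> Bj"
      by blast
    have "\<bar>\<phi> i \<omega> * \<phi> j \<omega>\<bar> \<le> Bi * Bj" if "\<omega> \<in> space M" for \<omega>
      using B(1)[OF that] B(2)[OF that] unfolding abs_mult by (intro mult_mono) auto
    with ij show ?thesis
      by (intro integrable_const_bound[of _ "Bi * Bj"]) auto
  qed
  have sq: "(\<Sum>i\<in>I. x i)\<^sup>2 = (\<Sum>i\<in>I. \<Sum>j\<in>I. x i * x j)" for x :: "'i \<Rightarrow> real"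
    by (simp add: power2_eq_square sum_product)
  have ind: "indicator {a i<..b i} s * indicator {a j<..b j} s
      = (indicator {max (a i) (a j)<..min (b i) (b j)} s :: real)" for i j s
    by (auto simp: indicator_def)
  have *: "integrable lborel (\<lambda>s. (\<Sum>i\<in>I. \<phi> i \<omega> * indicator {a i<..b i} s)\<^sup>2) \<and>
      (\<integral>s. (\<Sum>i\<in>I. \<phi> i \<omega> * indicator {a i<..b i} s)\<^sup>2 \<partial>lborel)
        = (\<Sum>i\<in>I. \<Sum>j\<in>I. \<phi> i \<omega> * \<phi> j \<omega> * ?l i j)" for \<omega>
  proof -
    have e: "(\<Sum>i\<in>I. \<phi> i \<omega> * indicator {a i<..b i} s)\<^sup>2
        = (\<Sum>i\<in>I. \<Sum>j\<in>I. \<phi> i \<omega> * \<phi> j \<omega> * indicator {max (a i) (a j)<..min (b i) (b j)} s)" for s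
      unfolding sq ind[symmetric] by (simp add: mult_ac)
    \<comment> \<open>A pair of disjoint cells gives an interval with \<open>q < p\<close>, hence
      the \<open>max\<close>.\<close>
    have "has_bochner_integral lborel (\<lambda>s. x * indicator {p<..q} s :: real) (x * max 0 (q - p))" for x p q :: real
      by (cases "p \<le> q") (auto simp: has_bochner_integral_iff measure_def)
    then show ?thesis
      unfolding e has_bochner_integral_iff[symmetric] by (intro has_bochner_integral_sum) auto
  qed
  then have nn: "0 \<le> (\<Sum>i\<in>I. \<Sum>j\<in>I. \<phi> i \<omega> * \<phi> j \<omega> * ?l i j)" for \<omega>
    by (metis (no_types, lifting) integral_nonneg_AE AE_I2 zero_le_power2)
  have "(\<E> \<omega>. ennreal ((\<Sum>i\<in>I. \<phi> i \<omega> * (w (b i) \<omega> - w (a i) \<omega>))\<^sup>2))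
      = ennreal (\<integral>\<omega>. (\<Sum>i\<in>I. \<phi> i \<omega> * (w (b i) \<omega> - w (a i) \<omega>))\<^sup>2 \<partial>M)"
    unfolding sq using pair
    by (intro nn_integral_eq_integral Bochner_Integration.integrable_sum)
       (auto simp: sq[symmetric])
  also have "\<dots> = ennreal (\<Sum>i\<in>I. \<Sum>j\<in>I. (\<integral>\<omega>. \<phi> i \<omega> * \<phi> j \<omega> \<partial>M) * ?l i j)"
    unfolding sq using pair by (simp add: Bochner_Integration.integral_sum)
  also have "\<dots> = ennreal (\<integral>\<omega>. (\<Sum>i\<in>I. \<Sum>j\<in>I. \<phi> i \<omega> * \<phi> j \<omega> * ?l i j) \<partial>M)"
    using prod_int by (simp add: Bochner_Integration.integral_sum)
  also have "\<dots> = (\<E> \<omega>. ennreal (\<Sum>i\<in>I. \<Sum>j\<in>I. \<phi> i \<omega> * \<phi> j \<omega> * ?l i j))"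
    using prod_int nn by (intro nn_integral_eq_integral[symmetric]) auto
  also have "\<dots> = (\<E> \<omega>. (\<integral>\<^sup>+s. ennreal ((\<Sum>i\<in>I. \<phi> i \<omega> * indicator {a i<..b i} s)\<^sup>2) \<partial>lborel))"
    using * by (auto simp: nn_integral_eq_integral intro!: nn_integral_cong)
  finally show ?thesis .
qed

end

section \<open>Grids of elementary processes and integrals over single cells\<close>

lemma elementary_grid_mono:
  assumes "elementary M F n t \<phi>" "i \<le> j" "j \<le> n"
  shows "t i \<le> t j" "0 \<le> t i"
proof -
  have "i \<le> j \<Longrightarrow> j \<le> n \<Longrightarrow> t i \<le> t j" for i j
  proof (induction j)
    case (Suc j)
    then show ?case
      using assms(1) unfolding elementary_def by (cases "i = Suc j") (fastforce simp: less_eq_Suc_le)+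
  qed auto
  from this[of i j] this[of 0 i] show "t i \<le> t j" "0 \<le> t i"
    using assms unfolding elementary_def by auto
qed

lemma elementary_cells:
  assumes "elementary M F n t \<phi>"
  obtains (cell) i where "i < n" "t i < s" "s \<le> t (Suc i)" "\<And>j. j < n \<Longrightarrow> s \<in> {t j<..t (Suc j)} \<longleftrightarrow> j = i"
  | (outside) "\<And>j. j < n \<Longrightarrow> s \<notin> {t j<..t (Suc j)}"
proof (cases "\<exists>i<n. s \<in> {t i<..t (Suc i)}")
  case True
  then obtain i where i: "i < n" "s \<in> {t i<..t (Suc i)}" by auto
  have "j = i" if "j < n" "s \<in> {t j<..t (Suc j)}" for j
  proof (rule ccontr)
    assume "j \<noteq> i"
    then consider "Suc i \<le> j" | "Suc j \<le> i" by linarith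
    then show False
    proof cases
      case 1
      then show False using elementary_grid_mono(1)[OF assms 1] i that by auto
    next
      case 2
      then show False using elementary_grid_mono(1)[OF assms 2] i that by auto
    qed
  qed
  with i have "s \<in> {t j<..t (Suc j)} \<longleftrightarrow> j = i" if "j < n" for j
    using that by blast
  moreover have "t i < s" "s \<le> t (Suc i)" using i(2) by auto
  ultimately show thesis using i(1) by (intro cell[of i])
next
  case False
  then show thesis by (intro outside) blast
qed

lemma elementary_process_cell:
  "i < n \<Longrightarrow> (\<And>j. j < n \<Longrightarrow> s \<in> {t j<..t (Suc j)} \<longleftrightarrow> j = i) \<Longrightarrow> elementary_process n t \<phi> s \<omega> = \<phi> i \<omega>"
  unfolding elementary_process_def
  by (subst sum.remove[of _ i]) (auto intro!: sum.neutral simp: indicator_def)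

lemma elementary_process_outside:
  "(\<And>j. j < n \<Longrightarrow> s \<notin> {t j<..t (Suc j)}) \<Longrightarrow> elementary_process n t \<phi> s \<omega> = 0"
  unfolding elementary_process_def by (auto intro!: sum.neutral)

text \<open>
  The elementary processes in the definition of the Ito integral need not respect the bounds of the
  integrand; clipping them can only improve the approximation.
\<close>

definition clip :: "real \<Rightarrow> real \<Rightarrow> real" where "clip m y = max 0 (min m y)"

lemma clip_bounds: "0 \<le> m \<Longrightarrow> 0 \<le> clip m y \<and> clip m y \<le> m"
  by (auto simp: clip_def)

lemma clip_square_le: "0 \<le> h \<Longrightarrow> h \<le> m \<Longrightarrow> (clip m y - h)\<^sup>2 \<le> (y - h)\<^sup>2"
  unfolding clip_def by (rule abs_le_square_iff[THEN iffD1]) auto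

lemma elementary_clip: "elementary M F n t \<phi> \<Longrightarrow> 0 \<le> m \<Longrightarrow> elementary M F n t (\<lambda>i \<omega>. clip m (\<phi> i \<omega>))"
  unfolding elementary_def using clip_bounds[of m]
  by (auto simp: abs_if not_less clip_def[abs_def] intro!: exI[of _ m])

lemma elementary_process_clip:
  assumes "elementary M F n t \<phi>" "0 \<le> m"
  shows "elementary_process n t (\<lambda>i \<omega>. clip m (\<phi> i \<omega>)) s \<omega> = clip m (elementary_process n t \<phi> s \<omega>)"
  using assms(1)
proof (cases rule: elementary_cells[where s = s])
  case (cell i)
  then show ?thesis by (simp add: elementary_process_cell)
next
  case outside
  then show ?thesis using assms(2) by (simp add: elementary_process_outside clip_def)
qed

text \<open>The integrator \<open>v\<close> is kept arbitrary because the drift is later absorbed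
  into it, as \<open>w s \<omega> + \<kappa> * s\<close>.\<close>

lemma elementary_integral_increment:
  assumes el: "elementary M F n t \<phi>" and i: "i < n" "t i \<le> a" "a \<le> b" "b \<le> t (Suc i)"
  shows "elementary_integral v n t \<phi> b \<omega> = elementary_integral v n t \<phi> a \<omega> + \<phi> i \<omega> * (v b \<omega> - v a \<omega>)"
proof -
  define g where "g T j = \<phi> j \<omega> * (v (min (t (Suc j)) T) \<omega> - v (min (t j) T) \<omega>)" for T j
  have "g b j = g a j" if "j \<in> {..<n} - {i}" for j
  proof -
    have "j < n" "Suc i \<le> j \<or> Suc j \<le> i" using that by auto
    then consider "Suc i \<le> j" "j < n" | "Suc j \<le> i" by blast
    then show ?thesis
    proof cases
      case 1
      then have "b \<le> t j" "b \<le> t (Suc j)"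
        using elementary_grid_mono(1)[OF el, of "Suc i" j] elementary_grid_mono(1)[OF el, of "Suc i" "Suc j"] i by auto
      then show ?thesis using i by (simp add: min_absorb2 g_def)
    next
      case 2
      then have "t j \<le> a" "t (Suc j) \<le> a"
        using elementary_grid_mono(1)[OF el, of j i] elementary_grid_mono(1)[OF el, of "Suc j" i] i by auto
      then show ?thesis using i by (simp add: min_absorb1 g_def)
    qed
  qed
  then have "sum (g b) ({..<n} - {i}) = sum (g a) ({..<n} - {i})"
    by (intro sum.cong) auto
  moreover have "g b i = g a i + \<phi> i \<omega> * (v b \<omega> - v a \<omega>)"
    using i by (simp add: min_absorb1 min_absorb2 g_def algebra_simps)
  ultimately show ?thesis
    using i(1) unfolding elementary_integral_def g_def[symmetric]
    by (simp add: sum.remove[of "{..<n}" i])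
qed

lemma elementary_integral_outside:
  assumes el: "elementary M F n t \<phi>" and "a \<le> b" "b \<le> t 0 \<or> t n \<le> a"
  shows "elementary_integral v n t \<phi> b \<omega> = elementary_integral v n t \<phi> a \<omega>"
  unfolding elementary_integral_def
proof (intro sum.cong refl)
  fix j assume "j \<in> {..<n}"
  then have "t 0 \<le> t j" "t j \<le> t (Suc j)" "t (Suc j) \<le> t n"
    using elementary_grid_mono(1)[OF el] by auto
  then show "\<phi> j \<omega> * (v (min (t (Suc j)) b) \<omega> - v (min (t j) b) \<omega>)
      = \<phi> j \<omega> * (v (min (t (Suc j)) a) \<omega> - v (min (t j) a) \<omega>)"
    using assms(2,3) by (auto simp: min_absorb1 min_absorb2)
qed

context brownian_motion
begin

lemma elementary_measurable_M: "elementary M F n t \<phi> \<Longrightarrow> i < n \<Longrightarrow> \<phi> i \<in> borel_measurable M"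
  by (rule measurable_F_M) (auto simp: elementary_def)

lemma elementary_process_measurable:
  assumes "elementary M F n t \<phi>"
  shows "(\<lambda>(\<omega>, s). elementary_process n t \<phi> s \<omega>) \<in> borel_measurable (M \<Otimes>\<^sub>M lborel)"
proof -
  have [measurable]: "i < n \<Longrightarrow> \<phi> i \<in> borel_measurable M" for i
    by (rule elementary_measurable_M[OF assms])
  show ?thesis
    unfolding elementary_process_def case_prod_beta
    by (intro borel_measurable_sum) (auto simp: lessThan_iff)
qed

lemma elementary_integral_measurable_F:
  assumes el: "elementary M F n t \<phi>" and "0 \<le> a"
    and v: "\<And>s. 0 \<le> s \<Longrightarrow> s \<le> a \<Longrightarrow> v s \<in> borel_measurable (F (ennreal a))"
  shows "elementary_integral v n t \<phi> a \<in> borel_measurable (F (ennreal a))"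
proof -
  have "(\<lambda>\<omega>. \<phi> i \<omega> * (v (min (t (Suc i)) a) \<omega> - v (min (t i) a) \<omega>)) \<in> borel_measurable (F (ennreal a))"
    if i: "i < n" for i
  proof (cases "t i \<le> a")
    case True
    have "\<phi> i \<in> borel_measurable (F (ennreal a))"
    proof (rule measurable_F_mono)
      show "ennreal (t i) \<le> ennreal a" using True by (rule ennreal_leI)
      show "\<phi> i \<in> borel_measurable (F (ennreal (t i)))"
        using el i unfolding elementary_def by blast
    qed
    moreover have "0 \<le> t i" "0 \<le> t (Suc i)"
      using elementary_grid_mono[OF el, of i "Suc i"] elementary_grid_mono(2)[OF el, of "Suc i" "Suc i"] i by simp_all
    then have "v (min (t (Suc i)) a) \<in> borel_measurable (F (ennreal a))" "v (min (t i) a) \<in> borel_measurable (F (ennreal a))"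
      using assms(2) by (intro v; simp)+
    ultimately show ?thesis
      by (intro borel_measurable_times borel_measurable_diff)
  next
    \<comment> \<open>A cell that begins after \<open>a\<close> drops out, although its weight need
      not be \<open>F (ennreal a)\<close>-measurable.\<close>
    case False
    then have "a \<le> t i" "a \<le> t (Suc i)"
      using elementary_grid_mono[OF el, of i "Suc i"] i by auto
    then show ?thesis by (simp add: min_absorb2)
  qed
  then show ?thesis
    unfolding elementary_integral_def[abs_def] by (intro borel_measurable_sum) auto
qed

lemma elementary_integral_measurable:
  "elementary M F n t \<phi> \<Longrightarrow> 0 \<le> a \<Longrightarrow> elementary_integral w n t \<phi> a \<in> borel_measurable M"
  by (rule measurable_F_M[OF elementary_integral_measurable_F[where v = w]]) (auto intro: w_measurable_F)

text \<open>The two grids are placed side by side in a disjoint sum of index sets, the second with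
  opposite sign, which reduces the claim to \<open>ito_isometry_sum\<close>.\<close>

lemma ito_isometry:
  assumes el: "elementary M F n t \<phi>" "elementary M F n' t' \<phi>'" and T: "0 \<le> T"
  shows "(\<E> \<omega>. ennreal ((elementary_integral w n t \<phi> T \<omega> - elementary_integral w n' t' \<phi>' T \<omega>)\<^sup>2)) =
    (\<E> \<omega>. (\<integral>\<^sup>+s\<in>{0<..T}. ennreal ((elementary_process n t \<phi> s \<omega> - elementary_process n' t' \<phi>' s \<omega>)\<^sup>2) \<partial>lborel))"
proof -
  define I where "I = {..<n} <+> {..<n'}"
  define a where "a = case_sum (\<lambda>i. min (t i) T) (\<lambda>i. min (t' i) T)"
  define b where "b = case_sum (\<lambda>i. min (t (Suc i)) T) (\<lambda>i. min (t' (Suc i)) T)"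
  \<comment> \<open>Truncation at \<open>T\<close> moves the start of a cell to
    \<open>min (t i) T\<close>, where the weight of a cell starting after \<open>T\<close> might not
    be measurable. Such a cell has become empty, so its weight is set to 0.\<close>
  define \<psi> where "\<psi> = case_sum (\<lambda>i \<omega>. if t i \<le> T then \<phi> i \<omega> else 0) (\<lambda>i \<omega>. if t' i \<le> T then - \<phi>' i \<omega> else 0)"
  have sumI: "(\<Sum>i\<in>I. f i) = (\<Sum>i<n. f (Inl i)) + (\<Sum>i<n'. f (Inr i))" for f :: "nat + nat \<Rightarrow> real"
    unfolding I_def by (subst sum.Plus) auto
  have 1: "elementary_integral w n t \<phi> T \<omega> - elementary_integral w n' t' \<phi>' T \<omega>
      = (\<Sum>i\<in>I. \<psi> i \<omega> * (w (b i) \<omega> - w (a i) \<omega>))" for \<omega>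
  proof -
    have *: "\<phi> i \<omega> * (w (min (t (Suc i)) T) \<omega> - w (min (t i) T) \<omega>)
        = (if t i \<le> T then \<phi> i \<omega> else 0) * (w (min (t (Suc i)) T) \<omega> - w (min (t i) T) \<omega>)"
      if "elementary M F n t \<phi>" "i < n" for n t \<phi> i
      using elementary_grid_mono(1)[OF that(1), of i "Suc i"] that(2) by (simp add: min_absorb2)
    have "elementary_integral w n t \<phi> T \<omega> = (\<Sum>i<n. \<psi> (Inl i) \<omega> * (w (b (Inl i)) \<omega> - w (a (Inl i)) \<omega>))"
      unfolding elementary_integral_def
      by (intro sum.cong refl, subst *[OF el(1)]) (simp_all add: a_def b_def \<psi>_def)
    moreover have "elementary_integral w n' t' \<phi>' T \<omega>
        = - (\<Sum>i<n'. \<psi> (Inr i) \<omega> * (w (b (Inr i)) \<omega> - w (a (Inr i)) \<omega>))"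
      unfolding elementary_integral_def sum_negf[symmetric]
      by (intro sum.cong refl, subst *[OF el(2)]) (simp_all add: a_def b_def \<psi>_def)
    ultimately show ?thesis
      unfolding sumI by simp
  qed
  have 2: "(elementary_process n t \<phi> s \<omega> - elementary_process n' t' \<phi>' s \<omega>) * indicator {0<..T} s
      = (\<Sum>i\<in>I. \<psi> i \<omega> * indicator {a i<..b i} s)" for \<omega> s
  proof -
    have *: "\<phi> i \<omega> * indicator {t i<..t (Suc i)} s * indicator {0<..T} s
        = (if t i \<le> T then \<phi> i \<omega> else 0) * indicator {min (t i) T<..min (t (Suc i)) T} s"
      if "elementary M F n t \<phi>" "i < n" for n t i and \<phi> :: "nat \<Rightarrow> 'a \<Rightarrow> real"
      using elementary_grid_mono(2)[OF that(1), of i "Suc i"] that(2) by (auto simp: indicator_def)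
    have "elementary_process n t \<phi> s \<omega> * indicator {0<..T} s = (\<Sum>i<n. \<psi> (Inl i) \<omega> * indicator {a (Inl i)<..b (Inl i)} s)"
      unfolding elementary_process_def sum_distrib_right
      by (intro sum.cong refl, subst *[OF el(1)]) (simp_all add: a_def b_def \<psi>_def)
    moreover have "elementary_process n' t' \<phi>' s \<omega> * indicator {0<..T} s
        = - (\<Sum>i<n'. \<psi> (Inr i) \<omega> * indicator {a (Inr i)<..b (Inr i)} s)"
      unfolding elementary_process_def sum_negf[symmetric] sum_distrib_right
      by (intro sum.cong refl, subst *[OF el(2)]) (simp_all add: a_def b_def \<psi>_def)
    ultimately show ?thesis
      unfolding sumI by (simp add: left_diff_distrib)
  qed
  have "(\<E> \<omega>. ennreal ((elementary_integral w n t \<phi> T \<omega> - elementary_integral w n' t' \<phi>' T \<omega>)\<^sup>2))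
     = (\<E> \<omega>. (\<integral>\<^sup>+s. ennreal ((\<Sum>i\<in>I. \<psi> i \<omega> * indicator {a i<..b i} s)\<^sup>2) \<partial>lborel))"
    unfolding 1
  proof (rule ito_isometry_sum)
    show "finite I" by (simp add: I_def)
    have grid: "0 \<le> t i" "t i \<le> t (Suc i)" if "elementary M F n t \<phi>" "i < n" for n t i and \<phi> :: "nat \<Rightarrow> 'a \<Rightarrow> real"
      using elementary_grid_mono[OF that(1), of i "Suc i"] that(2) by auto
    fix i assume i: "i \<in> I"
    show "0 \<le> a i \<and> a i \<le> b i"
      using i T grid[OF el(1)] grid[OF el(2)]
      by (auto simp: I_def a_def b_def min.coboundedI1 min_le_iff_disj)
    have meas: "(\<lambda>\<omega>. if t i \<le> T then \<phi> i \<omega> else 0) \<in> borel_measurable (F (ennreal (min (t i) T)))"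
      and bd: "\<exists>B. \<forall>\<omega>\<in>space M. \<bar>if t i \<le> T then \<phi> i \<omega> else 0\<bar> \<le> B"
      if "elementary M F n t \<phi>" "i < n" for n t i and \<phi> :: "nat \<Rightarrow> 'a \<Rightarrow> real"
    proof -
      have \<phi>: "\<phi> i \<in> borel_measurable (F (ennreal (t i)))" "\<exists>B. \<forall>\<omega>\<in>space M. \<bar>\<phi> i \<omega>\<bar> \<le> B"
        using that unfolding elementary_def by blast+
      show "(\<lambda>\<omega>. if t i \<le> T then \<phi> i \<omega> else 0) \<in> borel_measurable (F (ennreal (min (t i) T)))"
        using \<phi>(1) by (cases "t i \<le> T") (simp_all add: min_absorb1)
      show "\<exists>B. \<forall>\<omega>\<in>space M. \<bar>if t i \<le> T then \<phi> i \<omega> else 0\<bar> \<le> B"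
        using \<phi>(2) by (cases "t i \<le> T") auto
    qed
    from i consider j where "i = Inl j" "j < n" | j where "i = Inr j" "j < n'"
      by (auto simp: I_def)
    then show "\<psi> i \<in> borel_measurable (F (ennreal (a i)))"
    proof cases
      case 1
      then show ?thesis using meas[OF el(1)] by (simp add: a_def \<psi>_def)
    next
      case 2
      have "(\<lambda>\<omega>. if t' j \<le> T then - \<phi>' j \<omega> else 0) = (\<lambda>\<omega>. - (if t' j \<le> T then \<phi>' j \<omega> else 0))"
        by auto
      with 2 show ?thesis using borel_measurable_uminus[OF meas[OF el(2) 2(2)]] by (simp add: a_def \<psi>_def)
    qed
    from i consider j where "i = Inl j" "j < n" | j where "i = Inr j" "j < n'"
      by (auto simp: I_def)
    then show "\<exists>B. \<forall>\<omega>\<in>space M. \<bar>\<psi> i \<omega>\<bar> \<le> B"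
    proof cases
      case 1
      then show ?thesis using bd[OF el(1)] by (simp add: \<psi>_def)
    next
      case 2
      have "\<bar>if t' j \<le> T then - \<phi>' j \<omega> else 0\<bar> = \<bar>if t' j \<le> T then \<phi>' j \<omega> else 0\<bar>" for \<omega>
        by auto
      with 2 show ?thesis using bd[OF el(2) 2(2)] by (simp only: \<psi>_def sum.case)
    qed
  qed
  also have "\<dots> = (\<E> \<omega>. (\<integral>\<^sup>+s\<in>{0<..T}. ennreal ((elementary_process n t \<phi> s \<omega> - elementary_process n' t' \<phi>' s \<omega>)\<^sup>2) \<partial>lborel))"
    unfolding 2[symmetric] by (intro nn_integral_cong) (auto simp: indicator_def)
  finally show ?thesis .
qed

end

section \<open>Almost sure approximation of Ito integrals\<close>

lemma ennreal_square_diff_le: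
  "ennreal ((x - y)\<^sup>2) \<le> 2 * ennreal ((x - z)\<^sup>2) + 2 * ennreal ((z - y)\<^sup>2)"
proof -
  have "(x - y)\<^sup>2 \<le> 2 * (x - z)\<^sup>2 + 2 * (z - y)\<^sup>2"
    using zero_le_power2[of "x - 2 * z + y"] by (simp add: power2_eq_square algebra_simps)
  then have "ennreal ((x - y)\<^sup>2) \<le> ennreal (2 * (x - z)\<^sup>2 + 2 * (z - y)\<^sup>2)"
    by (rule ennreal_leI)
  then show ?thesis by (simp add: ennreal_mult')
qed

lemma ennreal_tendsto_0_le:
  fixes f g :: "nat \<Rightarrow> ennreal"
  assumes "\<And>k. f k \<le> g k" "g \<longlonglongrightarrow> 0"
  shows "f \<longlonglongrightarrow> 0"
  by (rule tendsto_sandwich[of "\<lambda>_. 0" f sequentially g]) (simp_all add: assms)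

lemma ennreal_suminf_finite_LIMSEQ_zero:
  fixes g :: "nat \<Rightarrow> ennreal"
  assumes fin: "(\<Sum>k. g k) \<noteq> \<infinity>"
  shows "g \<longlonglongrightarrow> 0"
proof -
  have "g k < \<top>" for k
    using fin ennreal_suminf_lessD[of g \<top> k] by (simp add: top.not_eq_extremum)
  then have gk: "g k = ennreal (enn2real (g k))" for k by simp
  have "summable (\<lambda>k. enn2real (g k))"
    using fin gk by (intro summable_suminf_not_top) (auto simp: gk[symmetric])
  from tendsto_ennrealI[OF summable_LIMSEQ_zero[OF this]] show ?thesis
    using gk by simp
qed

text \<open>Along a subsequence with integrals below \<open>(1/2) ^ k\<close> the sum of the
  functions has a finite integral. Hence the series is finite almost everywhere and its terms tend
  to 0.\<close>

lemma nn_integral_tendsto_0_AE_subseq: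
  fixes f :: "nat \<Rightarrow> 'a \<Rightarrow> ennreal"
  assumes [measurable]: "\<And>k. f k \<in> borel_measurable M" and lim: "(\<lambda>k. \<integral>\<^sup>+\<omega>. f k \<omega> \<partial>M) \<longlonglongrightarrow> 0"
  shows "\<exists>q :: nat \<Rightarrow> nat. strict_mono q \<and> (AE \<omega> in M. (\<lambda>k. f (q k) \<omega>) \<longlonglongrightarrow> 0)"
proof -
  have ev: "\<forall>\<^sub>F k in sequentially. (\<integral>\<^sup>+\<omega>. f k \<omega> \<partial>M) < ennreal ((1/2) ^ j)" for j :: nat
    using lim by (rule order_tendstoD) simp
  have "\<exists>q. strict_mono q \<and> (\<forall>k. (\<integral>\<^sup>+\<omega>. f (q k) \<omega> \<partial>M) < ennreal ((1/2) ^ k))"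
  proof -
    have "\<exists>q. \<forall>k. (\<integral>\<^sup>+\<omega>. f (q k) \<omega> \<partial>M) < ennreal ((1/2) ^ k) \<and> q k < q (Suc k)"
    proof (rule dependent_nat_choice)
      show "\<exists>x. (\<integral>\<^sup>+\<omega>. f x \<omega> \<partial>M) < ennreal ((1/2) ^ 0)"
        using eventually_happens'[OF _ ev[of 0]] by simp
      show "\<exists>y. (\<integral>\<^sup>+\<omega>. f y \<omega> \<partial>M) < ennreal ((1/2) ^ Suc k) \<and> x < y" for x k
        using eventually_happens'[OF _ eventually_conj[OF ev[of "Suc k"] eventually_gt_at_top[of x]]] by simp
    qed
    then show ?thesis by (auto simp: strict_mono_Suc_iff)
  qed
  then obtain q where q: "strict_mono q" "\<And>k. (\<integral>\<^sup>+\<omega>. f (q k) \<omega> \<partial>M) < ennreal ((1/2) ^ k)"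
    by auto
  have "(\<integral>\<^sup>+\<omega>. (\<Sum>k. f (q k) \<omega>) \<partial>M) = (\<Sum>k. \<integral>\<^sup>+\<omega>. f (q k) \<omega> \<partial>M)"
    by (rule nn_integral_suminf) simp
  also have "\<dots> \<le> (\<Sum>k. ennreal ((1/2) ^ k))"
    using q(2) by (intro suminf_le summableI) (auto intro: less_imp_le)
  also have "\<dots> < \<infinity>"
    by (subst suminf_ennreal2) (auto intro: summable_geometric)
  finally have "AE \<omega> in M. (\<Sum>k. f (q k) \<omega>) \<noteq> \<infinity>"
    by (intro nn_integral_noteq_infinite) auto
  then have "AE \<omega> in M. (\<lambda>k. f (q k) \<omega>) \<longlonglongrightarrow> 0"
    by (rule eventually_mono) (rule ennreal_suminf_finite_LIMSEQ_zero)
  with q(1) show ?thesis by blast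
qed

text \<open>Cauchy-Schwarz against the indicator of \<open>{0<..S}\<close> turns mean-square
  closeness into closeness of the integrals, at the price of the factor \<open>S\<close>; the bound
  \<open>B\<close> makes these integrals exist.\<close>

lemma set_integral_tendsto_L2:
  fixes f :: "nat \<Rightarrow> real \<Rightarrow> real"
  assumes [measurable]: "\<And>k. f k \<in> borel_measurable lborel"
    and h: "set_borel_measurable lborel {0<..T} h"
    and bf: "\<And>k s. 0 < s \<Longrightarrow> \<bar>f k s\<bar> \<le> B" and bh: "\<And>s. 0 < s \<Longrightarrow> \<bar>h s\<bar> \<le> B"
    and lim: "(\<lambda>k. \<integral>\<^sup>+s\<in>{0<..T}. ennreal ((f k s - h s)\<^sup>2) \<partial>lborel) \<longlonglongrightarrow> 0"
    and S: "0 \<le> S" "S \<le> T"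
  shows "(\<lambda>k. LINT s:{0<..S}|lborel. f k s) \<longlonglongrightarrow> (LINT s:{0<..S}|lborel. h s)"
proof -
  have hS: "set_borel_measurable lborel {0<..S} h"
    by (rule set_borel_measurable_subset[OF h]) (use S in auto)
  have int: "set_integrable lborel {0<..S} g" if "set_borel_measurable lborel {0<..S} g" "\<And>s. 0 < s \<Longrightarrow> \<bar>g s\<bar> \<le> B" for g :: "real \<Rightarrow> real"
    unfolding set_integrable_def using that S
    by (intro integrableI_bounded_set[where A = "{0<..S}" and B = B])
       (auto simp: set_borel_measurable_def indicator_def)
  have fint: "set_integrable lborel {0<..S} (f k)" for k
    by (rule int[OF _ bf]) (simp_all add: set_borel_measurable_def)
  have hint: "set_integrable lborel {0<..S} h"
    by (rule int[OF hS bh])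
  have key: "(ennreal \<bar>(LINT s:{0<..S}|lborel. f k s) - (LINT s:{0<..S}|lborel. h s)\<bar>)\<^sup>2
      \<le> ennreal S * (\<integral>\<^sup>+s\<in>{0<..T}. ennreal ((f k s - h s)\<^sup>2) \<partial>lborel)" for k
  proof -
    let ?d = "\<lambda>s. indicator {0<..S} s * (f k s - h s)"
    have m [measurable]: "?d \<in> borel_measurable lborel"
      using hS by (simp add: set_borel_measurable_def right_diff_distrib)
    have dint: "set_integrable lborel {0<..S} (\<lambda>s. f k s - h s)"
      by (rule set_integral_diff(1)[OF fint hint])
    have "ennreal \<bar>(LINT s:{0<..S}|lborel. f k s) - (LINT s:{0<..S}|lborel. h s)\<bar>
        = ennreal (norm (LINT s:{0<..S}|lborel. f k s - h s))"
      by (simp add: set_integral_diff(2)[OF fint hint])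
    also have "\<dots> \<le> (\<integral>\<^sup>+s. ennreal (norm (?d s)) \<partial>lborel)"
      using integral_norm_bound_ennreal[OF dint[unfolded set_integrable_def]]
      by (simp add: set_lebesgue_integral_def)
    also have "\<dots> = (\<integral>\<^sup>+s. ennreal \<bar>?d s\<bar> * indicator {0<..S} s \<partial>lborel)"
      by (intro nn_integral_cong) (auto simp: indicator_def)
    finally have "(ennreal \<bar>(LINT s:{0<..S}|lborel. f k s) - (LINT s:{0<..S}|lborel. h s)\<bar>)\<^sup>2
        \<le> (\<integral>\<^sup>+s. ennreal \<bar>?d s\<bar> * indicator {0<..S} s \<partial>lborel)\<^sup>2"
      by (rule power_mono) simp
    also have "\<dots> \<le> (\<integral>\<^sup>+s. ennreal \<bar>?d s\<bar> ^ 2 \<partial>lborel) * (\<integral>\<^sup>+s. indicator {0<..S} s ^ 2 \<partial>lborel)"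
      by (rule Cauchy_Schwarz_nn_integral) simp_all
    also have "(\<integral>\<^sup>+s. indicator {0<..S} s ^ 2 \<partial>lborel) = ennreal S"
    proof -
      have "(\<integral>\<^sup>+s. indicator {0<..S} s ^ 2 \<partial>lborel) = (\<integral>\<^sup>+s. indicator {0<..S} s \<partial>lborel)"
        by (intro nn_integral_cong) (auto simp: indicator_def)
      then show ?thesis using S by simp
    qed
    also have "(\<integral>\<^sup>+s. ennreal \<bar>?d s\<bar> ^ 2 \<partial>lborel) * ennreal S
        \<le> (\<integral>\<^sup>+s\<in>{0<..T}. ennreal ((f k s - h s)\<^sup>2) \<partial>lborel) * ennreal S"
      using S by (intro mult_right_mono nn_integral_mono) (auto simp: indicator_def ennreal_power)
    finally show ?thesis by (simp add: mult.commute)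
  qed
  have "(\<lambda>k. ennreal S * (\<integral>\<^sup>+s\<in>{0<..T}. ennreal ((f k s - h s)\<^sup>2) \<partial>lborel)) \<longlonglongrightarrow> 0"
    using ennreal_tendsto_cmult[OF _ lim, of "ennreal S"] by simp
  then have "(\<lambda>k. (ennreal \<bar>(LINT s:{0<..S}|lborel. f k s) - (LINT s:{0<..S}|lborel. h s)\<bar>)\<^sup>2) \<longlonglongrightarrow> 0"
    by (rule ennreal_tendsto_0_le[OF key])
  then have "(\<lambda>k. ((LINT s:{0<..S}|lborel. f k s) - (LINT s:{0<..S}|lborel. h s))\<^sup>2) \<longlonglongrightarrow> 0"
    by (subst tendsto_ennreal_iff[symmetric]) (auto simp: ennreal_power)
  from tendsto_real_sqrt[OF this] have "(\<lambda>k. (LINT s:{0<..S}|lborel. f k s) - (LINT s:{0<..S}|lborel. h s)) \<longlonglongrightarrow> 0"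
    by (simp add: tendsto_rabs_zero_iff)
  then show ?thesis by (simp add: LIM_zero_iff)
qed

text \<open>It expresses the drift through the same grid sum as the stochastic integral, so that one
  elementary sum against \<open>w s \<omega> + \<kappa> * s\<close> approximates both.\<close>

lemma elementary_integral_time:
  assumes el: "elementary M F n t \<phi>" and "0 \<le> S"
  shows "elementary_integral (\<lambda>s \<omega>. s) n t \<phi> S \<omega> = (LINT s:{0<..S}|lborel. elementary_process n t \<phi> s \<omega>)"
proof -
  have cell: "has_bochner_integral lborel (\<lambda>s. indicator {0<..S} s *\<^sub>R (\<phi> i \<omega> * indicator {t i<..t (Suc i)} s))
      (\<phi> i \<omega> * (min (t (Suc i)) S - min (t i) S))" if i: "i < n" for i
  proof -
    have t: "0 \<le> t i" "t i \<le> t (Suc i)" using elementary_grid_mono[OF el, of i "Suc i"] i by auto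
    have eq: "indicator {0<..S} s *\<^sub>R (\<phi> i \<omega> * indicator {t i<..t (Suc i)} s)
      = \<phi> i \<omega> * indicator {min (t i) S<..min (t (Suc i)) S} s" for s
      using t by (auto simp: indicator_def)
    have "min (t i) S \<le> min (t (Suc i)) S" using t by auto
    then show ?thesis
      unfolding eq by (simp add: has_bochner_integral_iff measure_def)
  qed
  have "has_bochner_integral lborel (\<lambda>s. \<Sum>i<n. indicator {0<..S} s *\<^sub>R (\<phi> i \<omega> * indicator {t i<..t (Suc i)} s))
      (\<Sum>i<n. \<phi> i \<omega> * (min (t (Suc i)) S - min (t i) S))"
    by (intro has_bochner_integral_sum) (use cell in auto)
  then show ?thesis
    unfolding elementary_integral_def elementary_process_def set_lebesgue_integral_def scaleR_sum_right
    by (simp add: has_bochner_integral_iff)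
qed

lemma ito_integral_processE:
  assumes "ito_integral_process M F w h Y" "0 \<le> T"
  obtains n t \<phi> where "\<And>k. elementary M F (n k) (t k) (\<phi> k)"
    and "(\<lambda>k. \<integral>\<^sup>+\<omega>. (\<integral>\<^sup>+s\<in>{0<..T}.
            ennreal ((elementary_process (n k) (t k) (\<phi> k) s \<omega> - h s \<omega>)\<^sup>2) \<partial>lborel) \<partial>M) \<longlonglongrightarrow> 0"
    and "(\<lambda>k. \<integral>\<^sup>+\<omega>. ennreal ((elementary_integral w (n k) (t k) (\<phi> k) T \<omega> - Y T \<omega>)\<^sup>2) \<partial>M) \<longlonglongrightarrow> 0"
proof -
  from assms(1)[unfolded ito_integral_process_def, THEN conjunct2, THEN spec, THEN mp, OF assms(2), THEN conjunct2]
  show thesis by (elim exE conjE) (rule that; simp)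
qed

lemma ito_integral_process_measurable:
  "ito_integral_process M F w h Y \<Longrightarrow> 0 \<le> T \<Longrightarrow> Y T \<in> borel_measurable M"
  unfolding ito_integral_process_def by blast

context brownian_motion
begin

text \<open>The definition supplies only some approximating sequence. By the isometry, the integrals
  of any other mean-square approximation of \<open>h\<close> come arbitrarily close to those of the
  supplied one, so they share its limit \<open>Y T\<close>.\<close>

lemma ito_integral_limit:
  assumes Y: "ito_integral_process M F w h Y" and T: "0 \<le> T"
    and hm: "(\<lambda>(\<omega>, s). h s \<omega> * indicator {0<..T} s) \<in> borel_measurable (M \<Otimes>\<^sub>M lborel)"
    and el: "\<And>k. elementary M F (n k) (t k) (\<psi> k)"
    and lim: "(\<lambda>k. \<E> \<omega>. (\<integral>\<^sup>+s\<in>{0<..T}. ennreal ((elementary_process (n k) (t k) (\<psi> k) s \<omega> - h s \<omega>)\<^sup>2) \<partial>lborel)) \<longlonglongrightarrow> 0"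
  shows "(\<lambda>k. \<E> \<omega>. ennreal ((elementary_integral w (n k) (t k) (\<psi> k) T \<omega> - Y T \<omega>)\<^sup>2)) \<longlonglongrightarrow> 0"
proof -
  have YT [measurable]: "Y T \<in> borel_measurable M"
    by (rule ito_integral_process_measurable[OF Y T])
  let ?e = "\<lambda>n t \<psi>. \<E> \<omega>. (\<integral>\<^sup>+s\<in>{0<..T}. ennreal ((elementary_process n t \<psi> s \<omega> - h s \<omega>)\<^sup>2) \<partial>lborel)"
  obtain n' t' \<phi> where el': "\<And>k. elementary M F (n' k) (t' k) (\<phi> k)"
    and lim': "(\<lambda>k. ?e (n' k) (t' k) (\<phi> k)) \<longlonglongrightarrow> 0"
    and limY: "(\<lambda>k. \<E> \<omega>. ennreal ((elementary_integral w (n' k) (t' k) (\<phi> k) T \<omega> - Y T \<omega>)\<^sup>2)) \<longlonglongrightarrow> 0"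
    by (rule ito_integral_processE[OF Y T]) (rule that; assumption)
  define J where "J k \<omega> = elementary_integral w (n k) (t k) (\<psi> k) T \<omega>" for k \<omega>
  define J' where "J' k \<omega> = elementary_integral w (n' k) (t' k) (\<phi> k) T \<omega>" for k \<omega>
  have Jm [measurable]: "J k \<in> borel_measurable M" "J' k \<in> borel_measurable M" for k
    unfolding J_def[abs_def] J'_def[abs_def] using el el' T by (auto intro: elementary_integral_measurable)
  have split_e: "(\<E> \<omega>. (\<integral>\<^sup>+s\<in>{0<..T}. ennreal ((elementary_process n t \<psi> s \<omega> - elementary_process n' t' \<phi> s \<omega>)\<^sup>2) \<partial>lborel))
      \<le> 2 * ?e n t \<psi> + 2 * ?e n' t' \<phi>"
    if e: "elementary M F n t \<psi>" "elementary M F n' t' \<phi>" for n t \<psi> n' t' \<phi>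
  proof -
    have A: "(\<lambda>(\<omega>, s). ennreal ((elementary_process n t \<psi> s \<omega> - h s \<omega>)\<^sup>2) * indicator {0<..T} s) \<in> borel_measurable (M \<Otimes>\<^sub>M lborel)"
      if "elementary M F n t \<psi>" for n t \<psi>
    proof -
      have [measurable]: "(\<lambda>p. elementary_process n t \<psi> (snd p) (fst p)) \<in> borel_measurable (M \<Otimes>\<^sub>M lborel)"
        using elementary_process_measurable[OF that] by (simp add: case_prod_beta)
      have [measurable]: "(\<lambda>p. h (snd p) (fst p) * indicator {0<..T} (snd p)) \<in> borel_measurable (M \<Otimes>\<^sub>M lborel)"
        using hm by (simp add: case_prod_beta)
      \<comment> \<open>Measurability of \<open>h\<close> is assumed on \<open>{0<..T}\<close> only,
        so the indicator is also put inside the square.\<close>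
      have "(\<lambda>(\<omega>, s). ennreal ((elementary_process n t \<psi> s \<omega> - h s \<omega>)\<^sup>2) * indicator {0<..T} s)
        = (\<lambda>p. ennreal ((elementary_process n t \<psi> (snd p) (fst p) - h (snd p) (fst p) * indicator {0<..T} (snd p))\<^sup>2)
            * indicator {0<..T} (snd p))"
        by (auto simp: indicator_def)
      then show ?thesis by simp
    qed
    have A1: "\<omega> \<in> space M \<Longrightarrow> (\<lambda>s. ennreal ((elementary_process n t \<psi> s \<omega> - h s \<omega>)\<^sup>2) * indicator {0<..T} s) \<in> borel_measurable lborel"
      if "elementary M F n t \<psi>" for n t \<psi> \<omega>
      using measurable_Pair2[OF A[OF that], of \<omega>] by simp
    have A2: "(\<lambda>\<omega>. \<integral>\<^sup>+s. ennreal ((elementary_process n t \<psi> s \<omega> - h s \<omega>)\<^sup>2) * indicator {0<..T} s \<partial>lborel) \<in> borel_measurable M"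
      if "elementary M F n t \<psi>" for n t \<psi>
      using lborel.borel_measurable_nn_integral_fst[OF A[OF that]] by simp
    have "(\<E> \<omega>. (\<integral>\<^sup>+s\<in>{0<..T}. ennreal ((elementary_process n t \<psi> s \<omega> - elementary_process n' t' \<phi> s \<omega>)\<^sup>2) \<partial>lborel))
      \<le> (\<E> \<omega>. 2 * (\<integral>\<^sup>+s\<in>{0<..T}. ennreal ((elementary_process n t \<psi> s \<omega> - h s \<omega>)\<^sup>2) \<partial>lborel)
          + 2 * (\<integral>\<^sup>+s\<in>{0<..T}. ennreal ((elementary_process n' t' \<phi> s \<omega> - h s \<omega>)\<^sup>2) \<partial>lborel))"
    proof (rule nn_integral_mono)
      fix \<omega> assume \<omega>: "\<omega> \<in> space M"
      have "(\<integral>\<^sup>+s\<in>{0<..T}. ennreal ((elementary_process n t \<psi> s \<omega> - elementary_process n' t' \<phi> s \<omega>)\<^sup>2) \<partial>lborel)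
        \<le> (\<integral>\<^sup>+s. 2 * (ennreal ((elementary_process n t \<psi> s \<omega> - h s \<omega>)\<^sup>2) * indicator {0<..T} s)
          + 2 * (ennreal ((elementary_process n' t' \<phi> s \<omega> - h s \<omega>)\<^sup>2) * indicator {0<..T} s) \<partial>lborel)"
        using ennreal_square_diff_le[where z = "h _ \<omega>"]
        by (intro nn_integral_mono) (auto simp: indicator_def power2_commute[of "h _ _"])
      then show "(\<integral>\<^sup>+s\<in>{0<..T}. ennreal ((elementary_process n t \<psi> s \<omega> - elementary_process n' t' \<phi> s \<omega>)\<^sup>2) \<partial>lborel)
        \<le> 2 * (\<integral>\<^sup>+s\<in>{0<..T}. ennreal ((elementary_process n t \<psi> s \<omega> - h s \<omega>)\<^sup>2) \<partial>lborel)
          + 2 * (\<integral>\<^sup>+s\<in>{0<..T}. ennreal ((elementary_process n' t' \<phi> s \<omega> - h s \<omega>)\<^sup>2) \<partial>lborel)"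
        using A1[OF e(1) \<omega>] A1[OF e(2) \<omega>] by (simp add: nn_integral_add nn_integral_cmult)
    qed
    then show ?thesis
      using A2[OF e(1)] A2[OF e(2)] by (simp add: nn_integral_add nn_integral_cmult)
  qed
  have bound: "(\<E> \<omega>. ennreal ((J k \<omega> - Y T \<omega>)\<^sup>2))
      \<le> 2 * (2 * ?e (n k) (t k) (\<psi> k) + 2 * ?e (n' k) (t' k) (\<phi> k)) + 2 * (\<E> \<omega>. ennreal ((J' k \<omega> - Y T \<omega>)\<^sup>2))" for k
  proof -
    have "(\<E> \<omega>. ennreal ((J k \<omega> - Y T \<omega>)\<^sup>2))
      \<le> (\<E> \<omega>. 2 * ennreal ((J k \<omega> - J' k \<omega>)\<^sup>2) + 2 * ennreal ((J' k \<omega> - Y T \<omega>)\<^sup>2))"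
      by (intro nn_integral_mono ennreal_square_diff_le)
    also have "\<dots> = 2 * (\<E> \<omega>. ennreal ((J k \<omega> - J' k \<omega>)\<^sup>2)) + 2 * (\<E> \<omega>. ennreal ((J' k \<omega> - Y T \<omega>)\<^sup>2))"
      by (simp add: nn_integral_add nn_integral_cmult)
    also have "\<dots> \<le> 2 * (2 * ?e (n k) (t k) (\<psi> k) + 2 * ?e (n' k) (t' k) (\<phi> k)) + 2 * (\<E> \<omega>. ennreal ((J' k \<omega> - Y T \<omega>)\<^sup>2))"
      unfolding J_def J'_def ito_isometry[OF el el' T]
      by (intro add_right_mono mult_left_mono split_e[OF el el']) simp
    finally show ?thesis .
  qed
  have "(\<lambda>k. 2 * (2 * ?e (n k) (t k) (\<psi> k) + 2 * ?e (n' k) (t' k) (\<phi> k)) + 2 * (\<E> \<omega>. ennreal ((J' k \<omega> - Y T \<omega>)\<^sup>2)))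
      \<longlonglongrightarrow> 2 * (2 * 0 + 2 * 0) + 2 * 0"
    unfolding J'_def by (intro tendsto_add ennreal_tendsto_cmult lim lim' limY) simp_all
  also have "2 * (2 * 0 + 2 * 0) + 2 * 0 = (0 :: ennreal)" by simp
  finally show ?thesis
    unfolding J_def[symmetric] by (rule ennreal_tendsto_0_le[rotated]) (rule bound)
qed

text \<open>A single sequence serves both times and both integrals: it approximates on the longer
  interval, hence also on the shorter one, and a subsequence is chosen once, for the sum
  \<open>g\<close> of all three errors.\<close>

lemma ito_integral_AE_approx:
  assumes Y: "ito_integral_process M F w h Y" and ST: "0 \<le> S" "S \<le> T" and m: "0 \<le> m"
    and hm: "(\<lambda>(\<omega>, s). h s \<omega> * indicator {0<..} s) \<in> borel_measurable (M \<Otimes>\<^sub>M lborel)"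
    and hb: "\<And>s \<omega>. 0 < s \<Longrightarrow> \<omega> \<in> space M \<Longrightarrow> 0 \<le> h s \<omega> \<and> h s \<omega> \<le> m"
  obtains n t \<psi> where "\<And>k. elementary M F (n k) (t k) (\<psi> k)"
    and "\<And>k i \<omega>. 0 \<le> \<psi> k i \<omega> \<and> \<psi> k i \<omega> \<le> m"
    and "AE \<omega> in M. \<forall>R\<in>{S, T}.
      (\<lambda>k. elementary_integral w (n k) (t k) (\<psi> k) R \<omega>) \<longlonglongrightarrow> Y R \<omega> \<and>
      (\<lambda>k. elementary_integral (\<lambda>s \<omega>. s) (n k) (t k) (\<psi> k) R \<omega>) \<longlonglongrightarrow> (LINT s:{0<..R}|lborel. h s \<omega>)"
proof -
  have T: "0 \<le> T" using ST by simp
  let ?e = "\<lambda>n t \<psi> R. \<E> \<omega>. (\<integral>\<^sup>+s\<in>{0<..R}. ennreal ((elementary_process n t \<psi> s \<omega> - h s \<omega>)\<^sup>2) \<partial>lborel)"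
  obtain n t \<phi> where el: "\<And>k. elementary M F (n k) (t k) (\<phi> k)"
    and lim: "(\<lambda>k. ?e (n k) (t k) (\<phi> k) T) \<longlonglongrightarrow> 0"
    by (rule ito_integral_processE[OF Y T]) (rule that; assumption)
  \<comment> \<open>The common bound \<open>m\<close> will make the moments of the exponentials
    uniform in \<open>k\<close>.\<close>
  define \<psi> where "\<psi> k i \<omega> = clip m (\<phi> k i \<omega>)" for k i \<omega>
  have elc: "elementary M F (n k) (t k) (\<psi> k)" for k
    unfolding \<psi>_def[abs_def] by (rule elementary_clip[OF el m])
  have ep: "elementary_process (n k) (t k) (\<psi> k) s \<omega> = clip m (elementary_process (n k) (t k) (\<phi> k) s \<omega>)" for k s \<omega>
    using elementary_process_clip[OF el m] unfolding \<psi>_def[abs_def] .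
  have le: "?e (n k) (t k) (\<psi> k) R \<le> ?e (n k) (t k) (\<phi> k) T" if "R \<le> T" for k R
    using that hb m unfolding ep
    by (intro nn_integral_mono) (auto simp: indicator_def intro!: ennreal_leI clip_square_le)
  have lime: "(\<lambda>k. ?e (n k) (t k) (\<psi> k) R) \<longlonglongrightarrow> 0" if "R \<le> T" for R
    by (rule ennreal_tendsto_0_le[OF _ lim]) (rule le[OF that])
  have hmR: "(\<lambda>(\<omega>, s). h s \<omega> * indicator {0<..R} s) \<in> borel_measurable (M \<Otimes>\<^sub>M lborel)" for R
  proof -
    have [measurable]: "(\<lambda>p. h (snd p) (fst p) * indicator {0<..} (snd p)) \<in> borel_measurable (M \<Otimes>\<^sub>M lborel)"
      using hm by (simp add: case_prod_beta)
    have "(\<lambda>(\<omega>, s). h s \<omega> * indicator {0<..R} s)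
      = (\<lambda>p. h (snd p) (fst p) * indicator {0<..} (snd p) * indicator {..R} (snd p))"
      by (auto simp: indicator_def)
    then show ?thesis by simp
  qed
  define g where "g k \<omega> = ennreal ((elementary_integral w (n k) (t k) (\<psi> k) S \<omega> - Y S \<omega>)\<^sup>2)
    + (ennreal ((elementary_integral w (n k) (t k) (\<psi> k) T \<omega> - Y T \<omega>)\<^sup>2)
    + (\<integral>\<^sup>+s\<in>{0<..T}. ennreal ((elementary_process (n k) (t k) (\<psi> k) s \<omega> - h s \<omega>)\<^sup>2) \<partial>lborel))" for k \<omega>
  have YR [measurable]: "Y S \<in> borel_measurable M" "Y T \<in> borel_measurable M"
    using ito_integral_process_measurable[OF Y] ST T by auto
  have Im [measurable]: "elementary_integral w (n k) (t k) (\<psi> k) S \<in> borel_measurable M"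
    "elementary_integral w (n k) (t k) (\<psi> k) T \<in> borel_measurable M" for k
    using elc ST T by (auto intro: elementary_integral_measurable)
  have em [measurable]: "(\<lambda>\<omega>. \<integral>\<^sup>+s\<in>{0<..T}. ennreal ((elementary_process (n k) (t k) (\<psi> k) s \<omega> - h s \<omega>)\<^sup>2) \<partial>lborel)
    \<in> borel_measurable M" for k
  proof -
    have [measurable]: "(\<lambda>p. elementary_process (n k) (t k) (\<psi> k) (snd p) (fst p)) \<in> borel_measurable (M \<Otimes>\<^sub>M lborel)"
      using elementary_process_measurable[OF elc[of k]] by (simp add: case_prod_beta)
    have [measurable]: "(\<lambda>p. h (snd p) (fst p) * indicator {0<..T} (snd p)) \<in> borel_measurable (M \<Otimes>\<^sub>M lborel)"
      using hmR[of T] by (simp add: case_prod_beta)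
    have "(\<lambda>(\<omega>, s). ennreal ((elementary_process (n k) (t k) (\<psi> k) s \<omega> - h s \<omega>)\<^sup>2) * indicator {0<..T} s)
      = (\<lambda>p. ennreal ((elementary_process (n k) (t k) (\<psi> k) (snd p) (fst p) - h (snd p) (fst p) * indicator {0<..T} (snd p))\<^sup>2)
          * indicator {0<..T} (snd p))"
      by (auto simp: indicator_def)
    then have "(\<lambda>(\<omega>, s). ennreal ((elementary_process (n k) (t k) (\<psi> k) s \<omega> - h s \<omega>)\<^sup>2) * indicator {0<..T} s)
      \<in> borel_measurable (M \<Otimes>\<^sub>M lborel)" by simp
    from lborel.borel_measurable_nn_integral_fst[OF this] show ?thesis by simp
  qed
  have gm: "g k \<in> borel_measurable M" for k
    unfolding g_def[abs_def] by measurable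
  have "(\<E> \<omega>. g k \<omega>) = (\<E> \<omega>. ennreal ((elementary_integral w (n k) (t k) (\<psi> k) S \<omega> - Y S \<omega>)\<^sup>2))
    + ((\<E> \<omega>. ennreal ((elementary_integral w (n k) (t k) (\<psi> k) T \<omega> - Y T \<omega>)\<^sup>2)) + ?e (n k) (t k) (\<psi> k) T)" for k
    unfolding g_def by (simp add: nn_integral_add)
  moreover have "(\<lambda>k. (\<E> \<omega>. ennreal ((elementary_integral w (n k) (t k) (\<psi> k) S \<omega> - Y S \<omega>)\<^sup>2))
    + ((\<E> \<omega>. ennreal ((elementary_integral w (n k) (t k) (\<psi> k) T \<omega> - Y T \<omega>)\<^sup>2)) + ?e (n k) (t k) (\<psi> k) T))
    \<longlonglongrightarrow> 0 + (0 + 0)"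
    using ST T by (intro tendsto_add ito_integral_limit[OF Y _ hmR elc] lime) auto
  ultimately have "(\<lambda>k. \<E> \<omega>. g k \<omega>) \<longlonglongrightarrow> 0" by simp
  from nn_integral_tendsto_0_AE_subseq[OF gm this] obtain q :: "nat \<Rightarrow> nat"
    where q: "strict_mono q" "AE \<omega> in M. (\<lambda>k. g (q k) \<omega>) \<longlonglongrightarrow> 0" by auto
  show thesis
  proof (rule that[of "n \<circ> q" "t \<circ> q" "\<psi> \<circ> q"])
    show "elementary M F ((n \<circ> q) k) ((t \<circ> q) k) ((\<psi> \<circ> q) k)" for k
      using elc by simp
    show "0 \<le> (\<psi> \<circ> q) k i \<omega> \<and> (\<psi> \<circ> q) k i \<omega> \<le> m" for k i \<omega>
      using clip_bounds[OF m] by (simp add: \<psi>_def)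
    show "AE \<omega> in M. \<forall>R\<in>{S, T}.
      (\<lambda>k. elementary_integral w ((n \<circ> q) k) ((t \<circ> q) k) ((\<psi> \<circ> q) k) R \<omega>) \<longlonglongrightarrow> Y R \<omega> \<and>
      (\<lambda>k. elementary_integral (\<lambda>s \<omega>. s) ((n \<circ> q) k) ((t \<circ> q) k) ((\<psi> \<circ> q) k) R \<omega>) \<longlonglongrightarrow> (LINT s:{0<..R}|lborel. h s \<omega>)"
      using q(2) AE_space
    proof eventually_elim
      case (elim \<omega>)
      have sq: "a \<longlonglongrightarrow> b" if le: "\<And>k. ennreal ((a k - b)\<^sup>2) \<le> g (q k) \<omega>" for a and b :: real
      proof -
        have "(\<lambda>k. ennreal ((a k - b)\<^sup>2)) \<longlonglongrightarrow> 0"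
          by (rule ennreal_tendsto_0_le[OF _ elim(1)]) (rule le)
        then have "(\<lambda>k. (a k - b)\<^sup>2) \<longlonglongrightarrow> 0"
          by (subst tendsto_ennreal_iff[symmetric]) auto
        from tendsto_real_sqrt[OF this] have "(\<lambda>k. a k - b) \<longlonglongrightarrow> 0"
          by (simp add: tendsto_rabs_zero_iff)
        then show ?thesis by (simp add: LIM_zero_iff)
      qed
      have "(\<lambda>k. elementary_integral w (n (q k)) (t (q k)) (\<psi> (q k)) S \<omega>) \<longlonglongrightarrow> Y S \<omega>"
        by (rule sq) (simp add: g_def)
      moreover have "(\<lambda>k. elementary_integral w (n (q k)) (t (q k)) (\<psi> (q k)) T \<omega>) \<longlonglongrightarrow> Y T \<omega>"
        by (rule sq) (simp add: g_def add_increasing)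
      moreover have "(\<lambda>k. elementary_integral (\<lambda>s \<omega>. s) (n (q k)) (t (q k)) (\<psi> (q k)) R \<omega>)
          \<longlonglongrightarrow> (LINT s:{0<..R}|lborel. h s \<omega>)" if R: "0 \<le> R" "R \<le> T" for R
        unfolding elementary_integral_time[OF elc R(1)]
      proof (rule set_integral_tendsto_L2[OF _ _ _ _ _ R])
        have "(\<lambda>s. elementary_process (n (q k)) (t (q k)) (\<psi> (q k)) s \<omega>) \<in> borel_measurable lborel" for k
          using measurable_Pair2[OF elementary_process_measurable[OF elc[of "q k"]] elim(2)] by simp
        then show "(\<lambda>s. elementary_process (n (q k)) (t (q k)) (\<psi> (q k)) s \<omega>) \<in> borel_measurable lborel" for k .
        show "set_borel_measurable lborel {0<..T} (\<lambda>s. h s \<omega>)"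
          using measurable_Pair2[OF hmR[of T] elim(2)] by (simp add: set_borel_measurable_def mult.commute)
        show "\<bar>elementary_process (n (q k)) (t (q k)) (\<psi> (q k)) s \<omega>\<bar> \<le> m" for k s
          unfolding ep using clip_bounds[OF m] by (simp add: abs_of_nonneg)
        show "0 < s \<Longrightarrow> \<bar>h s \<omega>\<bar> \<le> m" for s
          using hb[OF _ elim(2)] by (simp add: abs_of_nonneg)
        have "(\<integral>\<^sup>+s\<in>{0<..T}. ennreal ((elementary_process (n (q k)) (t (q k)) (\<psi> (q k)) s \<omega> - h s \<omega>)\<^sup>2) \<partial>lborel)
          \<le> g (q k) \<omega>" for k
          by (simp add: g_def add_increasing)
        then show "(\<lambda>k. \<integral>\<^sup>+s\<in>{0<..T}. ennreal ((elementary_process (n (q k)) (t (q k)) (\<psi> (q k)) s \<omega> - h s \<omega>)\<^sup>2) \<partial>lborel) \<longlonglongrightarrow> 0"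
          by (rule ennreal_tendsto_0_le[OF _ elim(1)])
      qed
      ultimately show ?case
        using ST by auto
    qed
  qed
qed

end

section \<open>Exponential submartingales\<close>

text \<open>Fatou's lemma gives the opposite inequality. Here the second moments keep mass from
  escaping to infinity: truncating at level \<open>R\<close> costs at most \<open>C / R\<close>, and
  the truncated functions converge dominatedly.\<close>

lemma (in finite_measure) nn_integral_liminf_le_L2_bounded:
  fixes f :: "nat \<Rightarrow> 'a \<Rightarrow> real"
  assumes [measurable]: "\<And>k. f k \<in> borel_measurable M" "g \<in> borel_measurable M"
    and nn: "\<And>k \<omega>. 0 \<le> f k \<omega>"
    and lim: "AE \<omega> in M. (\<lambda>k. f k \<omega>) \<longlonglongrightarrow> g \<omega>"
    and bd: "\<And>k. (\<integral>\<^sup>+\<omega>. ennreal ((f k \<omega>)\<^sup>2) \<partial>M) \<le> ennreal C"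
  shows "liminf (\<lambda>k. \<integral>\<^sup>+\<omega>. ennreal (f k \<omega>) \<partial>M) \<le> (\<integral>\<^sup>+\<omega>. ennreal (g \<omega>) \<partial>M)"
proof (rule ennreal_le_epsilon)
  fix e :: real assume e: "0 < e"
  \<comment> \<open>The level is chosen so that \<open>C / R \<le> e\<close>; the 1 keeps it
    positive.\<close>
  define R where "R = max 1 (C / e)"
  have R: "0 < R" "C / R \<le> e"
    using e by (auto simp: R_def divide_le_eq field_simps max_def)
  have tr: "f k \<omega> \<le> min (f k \<omega>) R + (f k \<omega>)\<^sup>2 / R" for k \<omega>
  proof (cases "f k \<omega> \<le> R")
    case False
    then have "f k \<omega> * R \<le> (f k \<omega>)\<^sup>2"
      using nn[of k \<omega>] by (simp add: power2_eq_square mult_left_mono)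
    then have "f k \<omega> \<le> (f k \<omega>)\<^sup>2 / R" using R by (simp add: field_simps)
    then show ?thesis using R False by simp
  qed (use R in simp)
  have "(\<integral>\<^sup>+\<omega>. ennreal (f k \<omega>) \<partial>M) \<le> (\<integral>\<^sup>+\<omega>. ennreal (min (f k \<omega>) R) \<partial>M) + ennreal e" for k
  proof -
    have "(\<integral>\<^sup>+\<omega>. ennreal (f k \<omega>) \<partial>M) \<le> (\<integral>\<^sup>+\<omega>. ennreal (min (f k \<omega>) R) + ennreal (1 / R) * ennreal ((f k \<omega>)\<^sup>2) \<partial>M)"
    proof (rule nn_integral_mono)
      fix \<omega>
      have "ennreal (f k \<omega>) \<le> ennreal (min (f k \<omega>) R + 1 / R * (f k \<omega>)\<^sup>2)"
        using tr[of k \<omega>] by (intro ennreal_leI) simp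
      also have "\<dots> = ennreal (min (f k \<omega>) R) + ennreal (1 / R) * ennreal ((f k \<omega>)\<^sup>2)"
        using nn[of k \<omega>] R by (subst ennreal_plus) (simp_all add: ennreal_mult'[symmetric])
      finally show "ennreal (f k \<omega>) \<le> ennreal (min (f k \<omega>) R) + ennreal (1 / R) * ennreal ((f k \<omega>)\<^sup>2)" .
    qed
    also have "\<dots> = (\<integral>\<^sup>+\<omega>. ennreal (min (f k \<omega>) R) \<partial>M) + ennreal (1 / R) * (\<integral>\<^sup>+\<omega>. ennreal ((f k \<omega>)\<^sup>2) \<partial>M)"
      by (simp add: nn_integral_add nn_integral_cmult)
    also have "\<dots> \<le> (\<integral>\<^sup>+\<omega>. ennreal (min (f k \<omega>) R) \<partial>M) + ennreal (1 / R) * ennreal C"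
      by (intro add_left_mono mult_left_mono bd) simp
    also have "ennreal (1 / R) * ennreal C = ennreal (C / R)"
      using R by (simp add: ennreal_mult'[symmetric])
    also have "(\<integral>\<^sup>+\<omega>. ennreal (min (f k \<omega>) R) \<partial>M) + ennreal (C / R) \<le> (\<integral>\<^sup>+\<omega>. ennreal (min (f k \<omega>) R) \<partial>M) + ennreal e"
      using R by (intro add_left_mono ennreal_leI)
    finally show ?thesis .
  qed
  then have "liminf (\<lambda>k. \<integral>\<^sup>+\<omega>. ennreal (f k \<omega>) \<partial>M)
      \<le> liminf (\<lambda>k. (\<integral>\<^sup>+\<omega>. ennreal (min (f k \<omega>) R) \<partial>M) + ennreal e)"
    by (intro Liminf_mono always_eventually) auto
  also have "(\<lambda>k. \<integral>\<^sup>+\<omega>. ennreal (min (f k \<omega>) R) \<partial>M) \<longlonglongrightarrow> (\<integral>\<^sup>+\<omega>. ennreal (min (g \<omega>) R) \<partial>M)"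
  proof (rule nn_integral_dominated_convergence[where w = "\<lambda>_. ennreal R"])
    show "(\<integral>\<^sup>+\<omega>. ennreal R \<partial>M) < \<infinity>"
      by (simp add: ennreal_mult_less_top emeasure_eq_measure)
    show "AE \<omega> in M. (\<lambda>k. ennreal (min (f k \<omega>) R)) \<longlonglongrightarrow> ennreal (min (g \<omega>) R)"
      using lim by eventually_elim (intro tendsto_ennrealI tendsto_min tendsto_const)
    show "AE \<omega> in M. ennreal (min (f k \<omega>) R) \<le> ennreal R" for k
      by (intro AE_I2 ennreal_leI) simp
  qed simp_all
  then have "(\<lambda>k. (\<integral>\<^sup>+\<omega>. ennreal (min (f k \<omega>) R) \<partial>M) + ennreal e) \<longlonglongrightarrow> (\<integral>\<^sup>+\<omega>. ennreal (min (g \<omega>) R) \<partial>M) + ennreal e"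
    by (intro tendsto_add tendsto_const)
  then have "liminf (\<lambda>k. (\<integral>\<^sup>+\<omega>. ennreal (min (f k \<omega>) R) \<partial>M) + ennreal e) = (\<integral>\<^sup>+\<omega>. ennreal (min (g \<omega>) R) \<partial>M) + ennreal e"
    by (rule lim_imp_Liminf[OF sequentially_bot])
  also have "\<dots> \<le> (\<integral>\<^sup>+\<omega>. ennreal (g \<omega>) \<partial>M) + ennreal e"
    by (intro add_right_mono nn_integral_mono ennreal_leI) simp
  finally show "liminf (\<lambda>k. \<integral>\<^sup>+\<omega>. ennreal (f k \<omega>) \<partial>M) \<le> (\<integral>\<^sup>+\<omega>. ennreal (g \<omega>) \<partial>M) + ennreal e" .
qed

context brownian_motion
begin

text \<open>Integrating out the increment over one cell multiplies the weight by
  \<open>exp (q \<omega>)\<close>. For \<open>p = 1\<close> the exponent is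
  \<open>(\<beta> * \<psi> \<omega> - \<kappa>)\<^sup>2 / 2 * (b - a)\<close>, and it stays
  nonnegative for larger \<open>p\<close>; this is the submartingale property. The second inequality
  bounds the exponent through \<open>\<psi> \<omega> \<le> m\<close>.\<close>

lemma exp_elementary_cell:
  fixes p :: real
  assumes ab: "0 \<le> a" "a \<le> b" and Z: "Z \<in> borel_measurable (F (ennreal a))"
    and I: "Ia \<in> borel_measurable (F (ennreal a))" "\<psi> \<in> borel_measurable (F (ennreal a))"
    and Ib: "\<And>\<omega>. Ib \<omega> = Ia \<omega> + \<psi> \<omega> * ((w b \<omega> + \<kappa> * b) - (w a \<omega> + \<kappa> * a))"
    and bd: "\<And>\<omega>. 0 \<le> \<psi> \<omega> \<and> \<psi> \<omega> \<le> m" and p: "1 \<le> p" and \<beta>: "0 \<le> \<beta>" "0 \<le> \<kappa>"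
  shows "(\<E> \<omega>. Z \<omega> * ennreal (exp (p * (\<kappa>\<^sup>2 / 2 * a - \<beta> * Ia \<omega>))))
      \<le> (\<E> \<omega>. Z \<omega> * ennreal (exp (p * (\<kappa>\<^sup>2 / 2 * b - \<beta> * Ib \<omega>)))) \<and>
    (\<E> \<omega>. Z \<omega> * ennreal (exp (p * (\<kappa>\<^sup>2 / 2 * b - \<beta> * Ib \<omega>))))
      \<le> ennreal (exp (p * (p * \<beta>\<^sup>2 * m\<^sup>2 + \<kappa>\<^sup>2) / 2 * (b - a)))
        * (\<E> \<omega>. Z \<omega> * ennreal (exp (p * (\<kappa>\<^sup>2 / 2 * a - \<beta> * Ia \<omega>))))"
proof -
  \<comment> \<open>The exponent left by \<open>nn_integral_exp_increment\<close>: per unit of time,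
    \<open>p\<^sup>2 * \<beta>\<^sup>2 * (\<psi> \<omega>)\<^sup>2 / 2\<close> comes from the
    increment and the remainder from the drift.\<close>
  define q where "q \<omega> = p * (p * \<beta>\<^sup>2 * (\<psi> \<omega>)\<^sup>2 + \<kappa>\<^sup>2 - 2 * \<beta> * \<psi> \<omega> * \<kappa>) / 2 * (b - a)" for \<omega>
  define Za where "Za \<omega> = Z \<omega> * ennreal (exp (p * (\<kappa>\<^sup>2 / 2 * a - \<beta> * Ia \<omega>)))" for \<omega>
  define Z' where "Z' \<omega> = Za \<omega> * ennreal (exp (p * (\<kappa>\<^sup>2 / 2 - \<beta> * \<psi> \<omega> * \<kappa>) * (b - a)))" for \<omega>
  have Zam: "Za \<in> borel_measurable (F (ennreal a))"
    unfolding Za_def[abs_def] using Z I by measurable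
  have Z'm: "Z' \<in> borel_measurable (F (ennreal a))"
    unfolding Z'_def[abs_def] using Zam I by measurable
  have pm: "(\<lambda>\<omega>. - p * \<beta> * \<psi> \<omega>) \<in> borel_measurable (F (ennreal a))"
    using I by measurable
  have "(\<E> \<omega>. Z \<omega> * ennreal (exp (p * (\<kappa>\<^sup>2 / 2 * b - \<beta> * Ib \<omega>))))
      = (\<E> \<omega>. Z' \<omega> * ennreal (exp ((- p * \<beta> * \<psi> \<omega>) * (w b \<omega> - w a \<omega>))))"
  proof (rule nn_integral_cong)
    fix \<omega>
    have "p * (\<kappa>\<^sup>2 / 2 * b - \<beta> * Ib \<omega>) = p * (\<kappa>\<^sup>2 / 2 * a - \<beta> * Ia \<omega>)
        + p * (\<kappa>\<^sup>2 / 2 - \<beta> * \<psi> \<omega> * \<kappa>) * (b - a) + (- p * \<beta> * \<psi> \<omega>) * (w b \<omega> - w a \<omega>)"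
      unfolding Ib by (simp add: field_simps)
    then show "Z \<omega> * ennreal (exp (p * (\<kappa>\<^sup>2 / 2 * b - \<beta> * Ib \<omega>)))
        = Z' \<omega> * ennreal (exp ((- p * \<beta> * \<psi> \<omega>) * (w b \<omega> - w a \<omega>)))"
      unfolding Z'_def Za_def by (simp only: exp_add ennreal_mult' exp_ge_zero mult.assoc)
  qed
  also have "\<dots> = (\<E> \<omega>. Z' \<omega> * ennreal (exp ((- p * \<beta> * \<psi> \<omega>)\<^sup>2 * (b - a) / 2)))"
    by (rule nn_integral_exp_increment[OF ab Z'm pm])
  also have "\<dots> = (\<E> \<omega>. Za \<omega> * ennreal (exp (q \<omega>)))"
  proof (rule nn_integral_cong)
    fix \<omega>
    have "q \<omega> = p * (\<kappa>\<^sup>2 / 2 - \<beta> * \<psi> \<omega> * \<kappa>) * (b - a) + (- p * \<beta> * \<psi> \<omega>)\<^sup>2 * (b - a) / 2"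
      unfolding q_def by (simp add: field_simps power2_eq_square)
    then show "Z' \<omega> * ennreal (exp ((- p * \<beta> * \<psi> \<omega>)\<^sup>2 * (b - a) / 2)) = Za \<omega> * ennreal (exp (q \<omega>))"
      unfolding Z'_def by (simp only: exp_add ennreal_mult' exp_ge_zero mult.assoc)
  qed
  finally have eq: "(\<E> \<omega>. Z \<omega> * ennreal (exp (p * (\<kappa>\<^sup>2 / 2 * b - \<beta> * Ib \<omega>))))
      = (\<E> \<omega>. Za \<omega> * ennreal (exp (q \<omega>)))" .
  have q0: "0 \<le> q \<omega>" for \<omega>
  proof -
    have "(\<beta> * \<psi> \<omega> - \<kappa>)\<^sup>2 \<le> p * \<beta>\<^sup>2 * (\<psi> \<omega>)\<^sup>2 + \<kappa>\<^sup>2 - 2 * \<beta> * \<psi> \<omega> * \<kappa>"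
      using mult_right_mono[OF p, of "\<beta>\<^sup>2 * (\<psi> \<omega>)\<^sup>2"] by (simp add: power2_diff power_mult_distrib mult.assoc)
    then have "0 \<le> p * \<beta>\<^sup>2 * (\<psi> \<omega>)\<^sup>2 + \<kappa>\<^sup>2 - 2 * \<beta> * \<psi> \<omega> * \<kappa>"
      by (rule order_trans[OF zero_le_power2])
    then show ?thesis unfolding q_def using p ab by (intro mult_nonneg_nonneg divide_nonneg_nonneg) auto
  qed
  have q1: "q \<omega> \<le> p * (p * \<beta>\<^sup>2 * m\<^sup>2 + \<kappa>\<^sup>2) / 2 * (b - a)" for \<omega>
  proof -
    have "p * \<beta>\<^sup>2 * (\<psi> \<omega>)\<^sup>2 \<le> p * \<beta>\<^sup>2 * m\<^sup>2"
      using bd[of \<omega>] p by (intro mult_left_mono power_mono) auto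
    moreover have "0 \<le> 2 * \<beta> * \<psi> \<omega> * \<kappa>" using bd[of \<omega>] \<beta> by simp
    ultimately have "p * \<beta>\<^sup>2 * (\<psi> \<omega>)\<^sup>2 + \<kappa>\<^sup>2 - 2 * \<beta> * \<psi> \<omega> * \<kappa> \<le> p * \<beta>\<^sup>2 * m\<^sup>2 + \<kappa>\<^sup>2"
      by linarith
    then show ?thesis
      unfolding q_def using p ab by (intro mult_right_mono divide_right_mono mult_left_mono) simp_all
  qed
  show ?thesis
    unfolding eq
  proof
    have "Za \<omega> * 1 \<le> Za \<omega> * ennreal (exp (q \<omega>))" for \<omega>
      using q0[of \<omega>] by (intro mult_left_mono) (auto simp: ennreal_1[symmetric] simp del: ennreal_1 intro!: ennreal_leI)
    then show "(\<E> \<omega>. Z \<omega> * ennreal (exp (p * (\<kappa>\<^sup>2 / 2 * a - \<beta> * Ia \<omega>)))) \<le> (\<E> \<omega>. Za \<omega> * ennreal (exp (q \<omega>)))"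
      by (intro nn_integral_mono) (simp add: Za_def)
    have "(\<E> \<omega>. Za \<omega> * ennreal (exp (q \<omega>)))
        \<le> (\<E> \<omega>. ennreal (exp (p * (p * \<beta>\<^sup>2 * m\<^sup>2 + \<kappa>\<^sup>2) / 2 * (b - a))) * Za \<omega>)"
      using q1 by (intro nn_integral_mono) (subst mult.commute, intro mult_right_mono ennreal_leI, auto)
    also have "\<dots> = ennreal (exp (p * (p * \<beta>\<^sup>2 * m\<^sup>2 + \<kappa>\<^sup>2) / 2 * (b - a))) * (\<E> \<omega>. Za \<omega>)"
      by (intro nn_integral_cmult measurable_F_M[OF Zam])
    finally show "(\<E> \<omega>. Za \<omega> * ennreal (exp (q \<omega>))) \<le> ennreal (exp (p * (p * \<beta>\<^sup>2 * m\<^sup>2 + \<kappa>\<^sup>2) / 2 * (b - a)))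
        * (\<E> \<omega>. Z \<omega> * ennreal (exp (p * (\<kappa>\<^sup>2 / 2 * a - \<beta> * Ia \<omega>))))"
      by (simp add: Za_def)
  qed
qed

text \<open>The one-cell bounds compose over adjacent intervals: the first is transitive, and in the
  second the factors multiply to the exponential of the total length. A stretch outside the grid
  counts as one more cell, with weight 0.\<close>

lemma exp_elementary_submartingale:
  fixes p :: real
  assumes el: "elementary M F n t \<phi>" and bd: "\<And>i \<omega>. 0 \<le> \<phi> i \<omega> \<and> \<phi> i \<omega> \<le> m"
    and sT: "0 \<le> s" "s \<le> T" and Z: "Z \<in> borel_measurable (F (ennreal s))"
    and p: "1 \<le> p" and \<beta>: "0 \<le> \<beta>" "0 \<le> \<kappa>"
  defines "G \<equiv> \<lambda>a. \<E> \<omega>. Z \<omega> * ennreal (exp (p * (\<kappa>\<^sup>2 / 2 * a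
    - \<beta> * elementary_integral (\<lambda>s \<omega>. w s \<omega> + \<kappa> * s) n t \<phi> a \<omega>)))"
  shows "G s \<le> G T" "G T \<le> ennreal (exp (p * (p * \<beta>\<^sup>2 * m\<^sup>2 + \<kappa>\<^sup>2) / 2 * (T - s))) * G s"
proof -
  let ?I = "\<lambda>a. elementary_integral (\<lambda>s \<omega>. w s \<omega> + \<kappa> * s) n t \<phi> a"
  define C where "C = p * (p * \<beta>\<^sup>2 * m\<^sup>2 + \<kappa>\<^sup>2) / 2"
  define R where "R a b \<longleftrightarrow> G a \<le> G b \<and> G b \<le> ennreal (exp (C * (b - a))) * G a" for a b
  have R_refl: "R a a" for a by (simp add: R_def)
  have R_trans: "R a c" if "R a b" "R b c" for a b c
  proof -
    have "G c \<le> ennreal (exp (C * (c - b))) * G b" using that(2) by (simp add: R_def)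
    also have "\<dots> \<le> ennreal (exp (C * (c - b))) * (ennreal (exp (C * (b - a))) * G a)"
      using that(1) by (intro mult_left_mono) (simp_all add: R_def)
    also have "\<dots> = ennreal (exp (C * (c - a))) * G a"
    proof -
      have "C * (c - a) = C * (c - b) + C * (b - a)" by (simp add: algebra_simps)
      then show ?thesis by (simp only: exp_add ennreal_mult' exp_ge_zero mult.assoc)
    qed
    finally show ?thesis using that by (auto simp: R_def)
  qed
  have step: "R a b" if ab: "s \<le> a" "a \<le> b" and \<psi>: "\<psi> \<in> borel_measurable (F (ennreal a))"
    "\<And>\<omega>. 0 \<le> \<psi> \<omega> \<and> \<psi> \<omega> \<le> m"
    "\<And>\<omega>. ?I b \<omega> = ?I a \<omega> + \<psi> \<omega> * ((w b \<omega> + \<kappa> * b) - (w a \<omega> + \<kappa> * a))" for a b \<psi>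
  proof -
    have a0: "0 \<le> a" using ab sT by simp
    have Za: "Z \<in> borel_measurable (F (ennreal a))"
      by (rule measurable_F_mono[OF ennreal_leI[OF ab(1)] Z])
    have Ia: "?I a \<in> borel_measurable (F (ennreal a))"
      by (rule elementary_integral_measurable_F[OF el a0])
         (intro borel_measurable_add borel_measurable_const w_measurable_F)
    show ?thesis
      unfolding R_def G_def C_def
      by (rule exp_elementary_cell[OF a0 ab(2) Za Ia \<psi>(1,3,2) p \<beta>])
  qed
  \<comment> \<open>Clamping the grid points to the interval from \<open>s\<close> to
    \<open>T\<close> treats all positions of the grid alike; a cell clamped to a point contributes
    nothing.\<close>
  define P where "P i = max s (min T (t i))" for i
  have outside: "R a b" if "s \<le> a" "a \<le> b" "b \<le> t 0 \<or> t n \<le> a" for a b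
  proof (rule step[OF that(1,2), of "\<lambda>_. 0"])
    show "0 \<le> (0::real) \<and> 0 \<le> m" using bd[of 0 undefined] by auto
    show "?I b \<omega> = ?I a \<omega> + 0 * ((w b \<omega> + \<kappa> * b) - (w a \<omega> + \<kappa> * a))" for \<omega>
      using elementary_integral_outside[OF el that(2,3)] by simp
  qed simp
  have cell: "R (P i) (P (Suc i))" if i: "i < n" for i
  proof (cases "P i = P (Suc i)")
    case False
    have tt: "t i \<le> t (Suc i)" using elementary_grid_mono(1)[OF el, of i "Suc i"] i by simp
    then have Pi: "s \<le> P i" "P i < P (Suc i)" "t i \<le> P i" "P (Suc i) \<le> t (Suc i)"
      using False sT by (auto simp: P_def max_def min_def split: if_splits)
    show ?thesis
    proof (rule step[of _ _ "\<phi> i"])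
      have "\<phi> i \<in> borel_measurable (F (ennreal (t i)))"
        using el i unfolding elementary_def by blast
      then show "\<phi> i \<in> borel_measurable (F (ennreal (P i)))"
        by (rule measurable_F_mono[OF ennreal_leI[OF Pi(3)]])
      show "?I (P (Suc i)) \<omega> = ?I (P i) \<omega> + \<phi> i \<omega> * ((w (P (Suc i)) \<omega> + \<kappa> * P (Suc i)) - (w (P i) \<omega> + \<kappa> * P i))" for \<omega>
        using elementary_integral_increment[OF el i Pi(3) _ Pi(4)] Pi(2) by simp
    qed (use Pi bd in auto)
  qed (simp add: R_refl)
  have P0: "R s (P 0)"
  proof (cases "t 0 \<le> s")
    case True
    then have "P 0 = s" by (simp add: P_def max_def min_def)
    then show ?thesis by (simp add: R_refl)
  next
    case False
    then show ?thesis using sT by (intro outside) (auto simp: P_def)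
  qed
  have "i \<le> n \<Longrightarrow> R s (P i)" for i
    by (induction i) (use P0 cell R_trans in \<open>auto simp: Suc_le_eq\<close>)
  then have "R s (P n)" by simp
  moreover have "R (P n) T"
  proof (cases "T \<le> t n")
    case True
    then have "P n = T" using sT by (simp add: P_def)
    then show ?thesis by (simp add: R_refl)
  next
    case False
    then show ?thesis using sT by (intro outside) (auto simp: P_def)
  qed
  ultimately have "R s T" by (rule R_trans)
  then show "G s \<le> G T" "G T \<le> ennreal (exp (p * (p * \<beta>\<^sup>2 * m\<^sup>2 + \<kappa>\<^sup>2) / 2 * (T - s))) * G s"
    by (simp_all add: R_def C_def)
qed

end

text \<open>For \<open>\<beta> \<delta> - r = \<kappa>\<^sup>2 / 2\<close> and \<open>h = \<sigma> u\<close> this is \<open>exp (\<beta> x) exp (- r t - \<beta> Z\<^sub>t)\<close>.\<close>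

definition discounted_exp :: "real \<Rightarrow> real \<Rightarrow> (real \<Rightarrow> 'a \<Rightarrow> real) \<Rightarrow> (real \<Rightarrow> 'a \<Rightarrow> real) \<Rightarrow> real \<Rightarrow> 'a \<Rightarrow> real"
  where "discounted_exp \<beta> \<kappa> h Y t \<omega> = exp (\<kappa>\<^sup>2 / 2 * t - \<beta> * (Y t \<omega> + \<kappa> * (LINT s:{0<..t}|lborel. h s \<omega>)))"

context brownian_motion
begin

lemma set_integral_measurable:
  fixes h :: "real \<Rightarrow> 'a \<Rightarrow> real"
  assumes "(\<lambda>(\<omega>, s). h s \<omega> * indicator {0<..} s) \<in> borel_measurable (M \<Otimes>\<^sub>M lborel)"
  shows "(\<lambda>\<omega>. LINT s:{0<..t}|lborel. h s \<omega>) \<in> borel_measurable M"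
proof -
  have [measurable]: "(\<lambda>p. h (snd p) (fst p) * indicator {0<..} (snd p)) \<in> borel_measurable (M \<Otimes>\<^sub>M lborel)"
    using assms by (simp add: case_prod_beta)
  have "(\<lambda>(\<omega>, s). indicator {0<..t} s *\<^sub>R h s \<omega>)
    = (\<lambda>p. h (snd p) (fst p) * indicator {0<..} (snd p) * indicator {..t} (snd p))"
    by (rule ext) (auto simp: indicator_def)
  then have "(\<lambda>(\<omega>, s). indicator {0<..t} s *\<^sub>R h s \<omega>) \<in> borel_measurable (M \<Otimes>\<^sub>M lborel)" by simp
  from lborel.borel_measurable_lebesgue_integral[OF this] show ?thesis
    by (simp add: set_lebesgue_integral_def)
qed

text \<open>The elementary inequality is passed to the limit. Fatou's lemma suffices at time
  \<open>s\<close>; at time \<open>t\<close> the \<open>p\<close>-th powers need bounded second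
  moments, that is, moments of order \<open>2 * p\<close> that are uniform in
  \<open>k\<close>.\<close>

lemma discounted_exp_submartingale:
  fixes p :: nat
  assumes Y: "ito_integral_process M F w h Y" and st: "0 \<le> s" "s \<le> t" and m: "0 \<le> m"
    and hm: "(\<lambda>(\<omega>, s). h s \<omega> * indicator {0<..} s) \<in> borel_measurable (M \<Otimes>\<^sub>M lborel)"
    and hb: "\<And>s \<omega>. 0 < s \<Longrightarrow> \<omega> \<in> space M \<Longrightarrow> 0 \<le> h s \<omega> \<and> h s \<omega> \<le> m"
    and \<beta>: "0 \<le> \<beta>" "0 \<le> \<kappa>" and p: "1 \<le> p"
    and z: "z \<in> borel_measurable (F (ennreal s))" "\<And>\<omega>. 0 \<le> z \<omega> \<and> z \<omega> \<le> 1"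
  shows "(\<E> \<omega>. ennreal (z \<omega> * discounted_exp \<beta> \<kappa> h Y s \<omega> ^ p)) \<le> (\<E> \<omega>. ennreal (z \<omega> * discounted_exp \<beta> \<kappa> h Y t \<omega> ^ p))"
    and "(\<E> \<omega>. ennreal (discounted_exp \<beta> \<kappa> h Y t \<omega> ^ p)) < \<infinity>"
proof -
  obtain n g \<psi> where el: "\<And>k. elementary M F (n k) (g k) (\<psi> k)"
    and bd: "\<And>k i \<omega>. 0 \<le> \<psi> k i \<omega> \<and> \<psi> k i \<omega> \<le> m"
    and lim: "AE \<omega> in M. \<forall>R\<in>{s, t}.
      (\<lambda>k. elementary_integral w (n k) (g k) (\<psi> k) R \<omega>) \<longlonglongrightarrow> Y R \<omega> \<and>
      (\<lambda>k. elementary_integral (\<lambda>s \<omega>. s) (n k) (g k) (\<psi> k) R \<omega>) \<longlonglongrightarrow> (LINT s:{0<..R}|lborel. h s \<omega>)"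
    by (rule ito_integral_AE_approx[OF Y st m hm hb]) (assumption | rule that)+
  define D where "D k R \<omega> = exp (\<kappa>\<^sup>2 / 2 * R
    - \<beta> * elementary_integral (\<lambda>s \<omega>. w s \<omega> + \<kappa> * s) (n k) (g k) (\<psi> k) R \<omega>)" for k R \<omega>
  have split: "elementary_integral (\<lambda>s \<omega>. w s \<omega> + \<kappa> * s) (n k) (g k) (\<psi> k) R \<omega>
    = elementary_integral w (n k) (g k) (\<psi> k) R \<omega> + \<kappa> * elementary_integral (\<lambda>s \<omega>. s) (n k) (g k) (\<psi> k) R \<omega>" for k R \<omega>
    unfolding elementary_integral_def
    by (simp add: sum_distrib_left sum.distrib[symmetric] algebra_simps)
  have Dlim: "AE \<omega> in M. \<forall>R\<in>{s, t}. (\<lambda>k. D k R \<omega>) \<longlonglongrightarrow> discounted_exp \<beta> \<kappa> h Y R \<omega>"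
    using lim
  proof eventually_elim
    case (elim \<omega>)
    then show ?case
      unfolding D_def discounted_exp_def split by (intro ballI tendsto_intros) auto
  qed
  have t0: "0 \<le> t" using st by simp
  have Dm: "D k R \<in> borel_measurable M" if "0 \<le> R" for k R
  proof -
    have "elementary_integral (\<lambda>s \<omega>. w s \<omega> + \<kappa> * s) (n k) (g k) (\<psi> k) R \<in> borel_measurable M"
      by (rule measurable_F_M, rule elementary_integral_measurable_F[OF el that])
         (intro borel_measurable_add borel_measurable_const w_measurable_F)
    then show ?thesis unfolding D_def[abs_def] by measurable
  qed
  have em: "discounted_exp \<beta> \<kappa> h Y R \<in> borel_measurable M" if "0 \<le> R" for R
    unfolding discounted_exp_def[abs_def]
    using set_integral_measurable[OF hm] ito_integral_process_measurable[OF Y that] by measurable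
  note [measurable] = Dm[OF st(1)] Dm[OF t0] em[OF st(1)] em[OF t0] measurable_F_M[OF z(1)]
  have Dpow: "D k R \<omega> ^ q = exp (real q * (\<kappa>\<^sup>2 / 2 * R
    - \<beta> * elementary_integral (\<lambda>s \<omega>. w s \<omega> + \<kappa> * s) (n k) (g k) (\<psi> k) R \<omega>))" for k R \<omega> q
    unfolding D_def by (simp add: exp_of_nat_mult)
  have D0: "D k 0 \<omega> = 1" for k \<omega>
  proof -
    have "0 \<le> g k i" if "i \<le> n k" for i
      using elementary_grid_mono(2)[OF el that order_refl] .
    then have "elementary_integral (\<lambda>s \<omega>. w s \<omega> + \<kappa> * s) (n k) (g k) (\<psi> k) 0 \<omega> = 0"
      unfolding elementary_integral_def
      by (intro sum.neutral) (auto simp: min_absorb2 Suc_le_eq less_imp_le)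
    then show ?thesis by (simp add: D_def)
  qed
  \<comment> \<open>The growth bound is started at time 0, where
    \<open>D k 0 \<omega> = 1\<close>.\<close>
  have mom: "(\<E> \<omega>. ennreal (D k t \<omega> ^ q))
      \<le> ennreal (exp (real q * (real q * \<beta>\<^sup>2 * m\<^sup>2 + \<kappa>\<^sup>2) / 2 * t))" if "1 \<le> q" for k q
  proof -
    have "(\<E> \<omega>. 1 * ennreal (D k t \<omega> ^ q)) \<le> ennreal (exp (real q * (real q * \<beta>\<^sup>2 * m\<^sup>2 + \<kappa>\<^sup>2) / 2 * (t - 0)))
        * (\<E> \<omega>. 1 * ennreal (D k 0 \<omega> ^ q))"
      unfolding Dpow using that by (intro exp_elementary_submartingale(2)[OF el bd order_refl t0 _ _ \<beta>]) simp_all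
    then show ?thesis by (simp add: D0 emeasure_space_1)
  qed
  have "(\<E> \<omega>. ennreal (z \<omega> * discounted_exp \<beta> \<kappa> h Y s \<omega> ^ p))
      = (\<E> \<omega>. liminf (\<lambda>k. ennreal (z \<omega> * D k s \<omega> ^ p)))"
  proof (rule nn_integral_cong_AE)
    show "AE \<omega> in M. ennreal (z \<omega> * discounted_exp \<beta> \<kappa> h Y s \<omega> ^ p) = liminf (\<lambda>k. ennreal (z \<omega> * D k s \<omega> ^ p))"
      using Dlim
    proof eventually_elim
      case (elim \<omega>)
      then have "(\<lambda>k. ennreal (z \<omega> * D k s \<omega> ^ p)) \<longlonglongrightarrow> ennreal (z \<omega> * discounted_exp \<beta> \<kappa> h Y s \<omega> ^ p)"
        by (intro tendsto_ennrealI tendsto_intros) auto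
      then show ?case by (rule lim_imp_Liminf[OF sequentially_bot, symmetric])
    qed
  qed
  also have "\<dots> \<le> liminf (\<lambda>k. \<E> \<omega>. ennreal (z \<omega> * D k s \<omega> ^ p))"
    by (rule nn_integral_liminf) measurable
  also have "\<dots> \<le> liminf (\<lambda>k. \<E> \<omega>. ennreal (z \<omega> * D k t \<omega> ^ p))"
  proof (intro Liminf_mono always_eventually allI)
    fix k
    have zm: "(\<lambda>\<omega>. ennreal (z \<omega>)) \<in> borel_measurable (F (ennreal s))" using z(1) by measurable
    show "(\<E> \<omega>. ennreal (z \<omega> * D k s \<omega> ^ p)) \<le> (\<E> \<omega>. ennreal (z \<omega> * D k t \<omega> ^ p))"
    proof -
      have "(\<E> \<omega>. ennreal (z \<omega>) * ennreal (D k s \<omega> ^ p)) \<le> (\<E> \<omega>. ennreal (z \<omega>) * ennreal (D k t \<omega> ^ p))"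
        unfolding Dpow using p by (intro exp_elementary_submartingale(1)[OF el bd st zm _ \<beta>]) simp
      then show ?thesis using z(2) by (simp add: ennreal_mult')
    qed
  qed
  also have "\<dots> \<le> (\<E> \<omega>. ennreal (z \<omega> * discounted_exp \<beta> \<kappa> h Y t \<omega> ^ p))"
  proof (rule nn_integral_liminf_le_L2_bounded)
    show "AE \<omega> in M. (\<lambda>k. z \<omega> * D k t \<omega> ^ p) \<longlonglongrightarrow> z \<omega> * discounted_exp \<beta> \<kappa> h Y t \<omega> ^ p"
      using Dlim by eventually_elim (intro tendsto_intros, auto)
    show "(\<E> \<omega>. ennreal ((z \<omega> * D k t \<omega> ^ p)\<^sup>2))
        \<le> ennreal (exp (real (p * 2) * (real (p * 2) * \<beta>\<^sup>2 * m\<^sup>2 + \<kappa>\<^sup>2) / 2 * t))" for k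
    proof -
      have "(\<E> \<omega>. ennreal ((z \<omega> * D k t \<omega> ^ p)\<^sup>2)) \<le> (\<E> \<omega>. ennreal (D k t \<omega> ^ (p * 2)))"
      proof (intro nn_integral_mono ennreal_leI)
        fix \<omega>
        have "(z \<omega>)\<^sup>2 * (D k t \<omega> ^ p)\<^sup>2 \<le> 1 * (D k t \<omega> ^ p)\<^sup>2"
          using z(2)[of \<omega>] by (intro mult_right_mono power_le_one) auto
        then show "(z \<omega> * D k t \<omega> ^ p)\<^sup>2 \<le> D k t \<omega> ^ (p * 2)"
          by (simp add: power_mult_distrib power_mult)
      qed
      also note mom[of "p * 2" k]
      finally show ?thesis using p by simp
    qed
    show "(\<lambda>\<omega>. z \<omega> * D k t \<omega> ^ p) \<in> borel_measurable M" for k by measurable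
    show "(\<lambda>\<omega>. z \<omega> * discounted_exp \<beta> \<kappa> h Y t \<omega> ^ p) \<in> borel_measurable M" by measurable
    show "0 \<le> z \<omega> * D k t \<omega> ^ p" for k \<omega>
      using z(2)[of \<omega>] by (auto simp: D_def)
  qed
  finally show "(\<E> \<omega>. ennreal (z \<omega> * discounted_exp \<beta> \<kappa> h Y s \<omega> ^ p)) \<le> (\<E> \<omega>. ennreal (z \<omega> * discounted_exp \<beta> \<kappa> h Y t \<omega> ^ p))" .
  have "(\<E> \<omega>. ennreal (discounted_exp \<beta> \<kappa> h Y t \<omega> ^ p)) = (\<E> \<omega>. liminf (\<lambda>k. ennreal (D k t \<omega> ^ p)))"
  proof (rule nn_integral_cong_AE)
    show "AE \<omega> in M. ennreal (discounted_exp \<beta> \<kappa> h Y t \<omega> ^ p) = liminf (\<lambda>k. ennreal (D k t \<omega> ^ p))"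
      using Dlim
    proof eventually_elim
      case (elim \<omega>)
      then have "(\<lambda>k. ennreal (D k t \<omega> ^ p)) \<longlonglongrightarrow> ennreal (discounted_exp \<beta> \<kappa> h Y t \<omega> ^ p)"
        by (intro tendsto_ennrealI tendsto_intros) auto
      then show ?case by (rule lim_imp_Liminf[OF sequentially_bot, symmetric])
    qed
  qed
  also have "\<dots> \<le> liminf (\<lambda>k. \<E> \<omega>. ennreal (D k t \<omega> ^ p))"
    by (rule nn_integral_liminf) measurable
  also have "\<dots> \<le> liminf (\<lambda>k. ennreal (exp (real p * (real p * \<beta>\<^sup>2 * m\<^sup>2 + \<kappa>\<^sup>2) / 2 * t)))"
    using mom[OF p] by (intro Liminf_mono always_eventually allI)
  also have "\<dots> < \<infinity>" by (simp add: Liminf_const)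
  finally show "(\<E> \<omega>. ennreal (discounted_exp \<beta> \<kappa> h Y t \<omega> ^ p)) < \<infinity>" .
qed

end

section \<open>Optional sampling\<close>

lemma measurable_If_pred:
  "Measurable.pred N P \<Longrightarrow> f \<in> measurable N L \<Longrightarrow> g \<in> measurable N L \<Longrightarrow> (\<lambda>x. if P x then f x else g x) \<in> measurable N L"
  by (intro measurable_If) (simp_all add: pred_def)

text \<open>Index of the first grid point not before the minimum of \<open>x\<close> and
  \<open>T\<close>. Rounding up makes the event that the index is at most \<open>j\<close> known at
  grid point \<open>j\<close>, so that a rounded stopping time still does not look ahead.\<close>

definition grid_index :: "nat \<Rightarrow> real \<Rightarrow> ennreal \<Rightarrow> nat"
  where "grid_index N T x = nat \<lceil>enn2real (min x (ennreal T)) * real N / T\<rceil>"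

definition grid_point :: "nat \<Rightarrow> real \<Rightarrow> nat \<Rightarrow> real"
  where "grid_point N T j = real j * T / real N"

lemma min_ennreal_real:
  assumes "0 \<le> T" shows "ennreal (enn2real (min x (ennreal T))) = min x (ennreal T)"
    "enn2real (min x (ennreal T)) \<le> T"
proof -
  have "min x (ennreal T) < top" by (simp add: min_less_iff_disj)
  then show *: "ennreal (enn2real (min x (ennreal T))) = min x (ennreal T)" by simp
  have "ennreal (enn2real (min x (ennreal T))) \<le> ennreal T" unfolding * by simp
  then show "enn2real (min x (ennreal T)) \<le> T" using assms by simp
qed

lemma grid_index_le_iff:
  assumes T: "0 < T" and N: "0 < N"
  shows "grid_index N T x \<le> j \<longleftrightarrow> enn2real (min x (ennreal T)) \<le> grid_point N T j"
  unfolding grid_index_def grid_point_def using T N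
  by (simp add: nat_ceiling_le_eq divide_le_eq le_divide_eq mult.commute)

lemma grid_index_bound: "0 < T \<Longrightarrow> 0 < N \<Longrightarrow> grid_index N T x \<le> N"
  using min_ennreal_real(2)[of T x] by (simp add: grid_index_le_iff) (simp add: grid_point_def)

lemma grid_point_less: "0 < T \<Longrightarrow> 0 < N \<Longrightarrow> j < N \<Longrightarrow> grid_point N T j < T"
  by (simp add: grid_point_def field_simps)

lemma grid_point_mono: "0 < T \<Longrightarrow> i \<le> j \<Longrightarrow> grid_point N T i \<le> grid_point N T j"
  by (simp add: grid_point_def divide_right_mono mult_right_mono)

lemma grid_point_nonneg: "0 < T \<Longrightarrow> 0 \<le> grid_point N T j"
  by (simp add: grid_point_def)

lemma grid_point_last: "0 < N \<Longrightarrow> grid_point N T N = T"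
  by (simp add: grid_point_def)

text \<open>The last index is different: for \<open>j = N\<close> the left side always holds, while
  \<open>x\<close> may exceed \<open>T\<close>.\<close>

lemma grid_index_le_iff':
  assumes T: "0 < T" and N: "0 < N" and j: "j < N"
  shows "grid_index N T x \<le> j \<longleftrightarrow> x \<le> ennreal (grid_point N T j)"
proof -
  have "grid_index N T x \<le> j \<longleftrightarrow> ennreal (enn2real (min x (ennreal T))) \<le> ennreal (grid_point N T j)"
    unfolding grid_index_le_iff[OF T N] using grid_point_nonneg[OF T] by simp
  also have "\<dots> \<longleftrightarrow> x \<le> ennreal (grid_point N T j)"
  proof -
    have "ennreal (grid_point N T j) < ennreal T"
      using grid_point_less[OF assms] grid_point_nonneg[OF T, of N j] by (simp add: ennreal_less_iff)
    then show ?thesis using T by (auto simp: min_ennreal_real(1) min_le_iff_disj not_le)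
  qed
  finally show ?thesis .
qed

lemma grid_index_mono:
  assumes T: "0 < T" and N: "0 < N" and xy: "x \<le> y"
  shows "grid_index N T x \<le> grid_index N T y"
proof -
  have "ennreal (enn2real (min x (ennreal T))) \<le> ennreal (enn2real (min y (ennreal T)))"
    using T xy by (simp add: min_ennreal_real(1) min.coboundedI1)
  then show ?thesis
    unfolding grid_index_def using T by (intro nat_mono ceiling_mono divide_right_mono mult_right_mono) simp_all
qed

lemma grid_point_index_tendsto:
  assumes T: "0 < T"
  shows "(\<lambda>k. grid_point (Suc k) T (grid_index (Suc k) T x)) \<longlonglongrightarrow> enn2real (min x (ennreal T))"
proof -
  let ?r = "enn2real (min x (ennreal T))"
  have bound: "norm (grid_point (Suc k) T (grid_index (Suc k) T x) - ?r) \<le> T * (1 / real (Suc k))" for k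
  proof -
    define n where "n = real (Suc k)"
    have n: "0 < n" by (simp add: n_def)
    have "0 \<le> ?r * n / T" using T n by simp
    then have "?r * n / T \<le> real (grid_index (Suc k) T x)"
      "real (grid_index (Suc k) T x) \<le> ?r * n / T + 1"
      unfolding grid_index_def n_def by linarith+
    then have "?r * n / T * T / n \<le> real (grid_index (Suc k) T x) * T / n"
      "real (grid_index (Suc k) T x) * T / n \<le> (?r * n / T + 1) * T / n"
      using T n by (intro divide_right_mono mult_right_mono; simp)+
    moreover have "?r * n / T * T / n = ?r" "(?r * n / T + 1) * T / n = ?r + T * (1 / n)"
      using T n by (simp_all add: field_simps)
    ultimately have "?r \<le> grid_point (Suc k) T (grid_index (Suc k) T x)"
      "grid_point (Suc k) T (grid_index (Suc k) T x) \<le> ?r + T * (1 / real (Suc k))"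
      unfolding grid_point_def n_def by simp_all
    then show ?thesis by simp
  qed
  have "(\<lambda>k. T * (1 / real (Suc k))) \<longlonglongrightarrow> T * 0"
    by (intro tendsto_intros LIMSEQ_Suc[OF lim_1_over_n])
  then have "(\<lambda>k. T * (1 / real (Suc k))) \<longlonglongrightarrow> 0"
    unfolding mult_zero_right .
  from Lim_null_comparison[OF always_eventually[OF allI[OF bound]] this] show ?thesis
    by (rule LIM_zero_cancel)
qed

context brownian_motion
begin

lemma stopping_time_measurable: "stopping_time F \<tau> \<Longrightarrow> \<tau> \<in> borel_measurable M"
  by (rule measurable_stopping_time[where F = F]) (use subalgebra_F in \<open>auto simp: subalgebra_def\<close>)

text \<open>This is how a weight that is measurable for \<open>pre_sigma \<rho>\<close> becomes a
  test function at a fixed time: it is cut off where \<open>\<rho>\<close> has not yet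
  occurred.\<close>

lemma pre_sigma_restrict_measurable:
  fixes B :: "'a \<Rightarrow> real"
  assumes \<rho>: "stopping_time F \<rho>" and B: "B \<in> borel_measurable (pre_sigma \<rho>)"
  shows "(\<lambda>\<omega>. if \<rho> \<omega> \<le> t then B \<omega> else 0) \<in> borel_measurable (F t)"
proof (rule measurableI)
  fix A :: "real set" assume A: "A \<in> sets borel"
  have 1: "{\<omega> \<in> B -` A \<inter> space M. \<rho> \<omega> \<le> t} \<in> sets (F t)"
    using sets_pre_sigmaD[OF \<rho> measurable_sets[OF B A]] unfolding space_pre_sigma .
  have 2: "{\<omega> \<in> space (F t). \<not> \<rho> \<omega> \<le> t} \<in> sets (F t)"
    using pred_intros_logic(2)[OF stopping_timeD[OF \<rho>, of t]] by (simp add: pred_def)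
  have "(\<lambda>\<omega>. if \<rho> \<omega> \<le> t then B \<omega> else 0) -` A \<inter> space (F t)
    = {\<omega> \<in> B -` A \<inter> space M. \<rho> \<omega> \<le> t} \<union> (if 0 \<in> A then {\<omega> \<in> space (F t). \<not> \<rho> \<omega> \<le> t} else {})"
    by (auto simp: space_F split: if_splits)
  also have "\<dots> \<in> sets (F t)" using 1 2 by auto
  finally show "(\<lambda>\<omega>. if \<rho> \<omega> \<le> t then B \<omega> else 0) -` A \<inter> space (F t) \<in> sets (F t)" .
qed simp

end

text \<open>\<open>D t\<close> is required to be \<open>M\<close>-measurable, as the Ito integral
  is, and the submartingale property is tested with weights known at time \<open>s\<close>. The
  power 2 is included so that samples at rounded stopping times have second moments bounded by that
  of \<open>D T\<close>.\<close>

locale continuous_submartingale = brownian_motion +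
  fixes D :: "real \<Rightarrow> 'a \<Rightarrow> real" and T :: real
  assumes T_pos: "0 < T"
    and D_measurable: "\<And>t. 0 \<le> t \<Longrightarrow> D t \<in> borel_measurable M"
    and D_nonneg: "\<And>t \<omega>. 0 \<le> D t \<omega>"
    and D_continuous: "\<And>\<omega>. \<omega> \<in> space M \<Longrightarrow> continuous_on {0..} (\<lambda>t. D t \<omega>)"
    and submartingale: "\<And>p s t z. p = 1 \<or> p = (2::nat) \<Longrightarrow> 0 \<le> s \<Longrightarrow> s \<le> t \<Longrightarrow>
      z \<in> borel_measurable (F (ennreal s)) \<Longrightarrow> (\<And>\<omega>. 0 \<le> z \<omega> \<and> z \<omega> \<le> 1) \<Longrightarrow>
      (\<E> \<omega>. ennreal (z \<omega> * D s \<omega> ^ p)) \<le> (\<E> \<omega>. ennreal (z \<omega> * D t \<omega> ^ p))"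
    and square_integrable: "(\<E> \<omega>. ennreal (D T \<omega> ^ 2)) < \<infinity>"
begin

lemma grid_index_measurable:
  assumes \<tau>: "stopping_time F \<tau>"
  shows "(\<lambda>\<omega>. grid_index N T (\<tau> \<omega>)) \<in> measurable M (count_space UNIV)"
proof -
  note [measurable] = stopping_time_measurable[OF \<tau>]
  have "(\<lambda>\<omega>. \<lceil>enn2real (min (\<tau> \<omega>) (ennreal T)) * real N / T\<rceil>) \<in> measurable M (count_space UNIV)"
    by measurable
  from measurable_compose[OF this, of nat "count_space UNIV"] show ?thesis
    unfolding grid_index_def by simp
qed

lemma grid_sample_measurable:
  assumes "g \<in> measurable M (count_space UNIV)"
  shows "(\<lambda>\<omega>. D (grid_point N T (g \<omega>)) \<omega>) \<in> borel_measurable M"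
  by (rule measurable_compose_countable[OF _ assms])
     (intro D_measurable grid_point_nonneg T_pos)

lemma grid_index_pred:
  assumes \<tau>: "stopping_time F \<tau>" and N: "0 < N"
  shows "Measurable.pred (F (ennreal (grid_point N T j))) (\<lambda>\<omega>. grid_index N T (\<tau> \<omega>) \<le> j)"
proof (cases "j < N")
  case True
  then show ?thesis
    using stopping_timeD[OF \<tau>] by (simp add: grid_index_le_iff'[OF T_pos N])
next
  case False
  then have "grid_index N T x \<le> j" for x
    using grid_index_bound[OF T_pos N, of x] by simp
  then show ?thesis by simp
qed

text \<open>Splitting by the value of the index, each piece is moved to time \<open>T\<close> by the
  submartingale property of the square. The bound is uniform in \<open>N\<close>, as the passage to
  the limit requires.\<close>

lemma grid_second_moment:
  assumes \<tau>: "stopping_time F \<tau>" and N: "0 < N"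
  shows "(\<E> \<omega>. ennreal (D (grid_point N T (grid_index N T (\<tau> \<omega>))) \<omega> ^ 2)) \<le> (\<E> \<omega>. ennreal (D T \<omega> ^ 2))"
proof -
  let ?i = "\<lambda>\<omega>. grid_index N T (\<tau> \<omega>)"
  note [measurable] = grid_index_measurable[OF \<tau>] D_measurable
  have gp: "0 \<le> grid_point N T j" for j by (rule grid_point_nonneg[OF T_pos])
  have one: "(\<Sum>j\<le>N. if ?i \<omega> = j then x else 0) = x" for \<omega> and x :: ennreal
    using grid_index_bound[OF T_pos N, of "\<tau> \<omega>"] by (simp add: sum.delta')
  have zm: "(\<lambda>\<omega>. if ?i \<omega> = j then 1 else 0 :: real) \<in> borel_measurable (F (ennreal (grid_point N T j)))" for j
  proof -
    have "Measurable.pred (F (ennreal (grid_point N T j))) (\<lambda>\<omega>. ?i \<omega> = j)"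
    proof (cases j)
      case 0
      then show ?thesis using grid_index_pred[OF \<tau> N, of 0] by simp
    next
      case (Suc l)
      have "Measurable.pred (F (ennreal (grid_point N T j))) (\<lambda>\<omega>. ?i \<omega> \<le> l)"
        by (rule measurable_F_mono[OF _ grid_index_pred[OF \<tau> N]])
           (use Suc grid_point_mono[OF T_pos, of l j N] in \<open>auto intro: ennreal_leI\<close>)
      moreover have "(?i \<omega> = j) = (?i \<omega> \<le> j \<and> \<not> ?i \<omega> \<le> l)" for \<omega> using Suc by auto
      ultimately show ?thesis
        using grid_index_pred[OF \<tau> N, of j] by (simp only:) (intro pred_intros_logic)
    qed
    then show ?thesis by (intro measurable_If_pred measurable_const) simp_all
  qed
  have "(\<E> \<omega>. ennreal (D (grid_point N T (?i \<omega>)) \<omega> ^ 2))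
      = (\<E> \<omega>. (\<Sum>j\<le>N. ennreal ((if ?i \<omega> = j then 1 else 0) * D (grid_point N T j) \<omega> ^ 2)))"
  proof (rule nn_integral_cong)
    fix \<omega>
    have "(\<Sum>j\<le>N. ennreal ((if ?i \<omega> = j then 1 else 0) * D (grid_point N T j) \<omega> ^ 2))
      = (\<Sum>j\<le>N. if ?i \<omega> = j then ennreal (D (grid_point N T (?i \<omega>)) \<omega> ^ 2) else 0)"
      by (intro sum.cong) auto
    then show "ennreal (D (grid_point N T (?i \<omega>)) \<omega> ^ 2)
      = (\<Sum>j\<le>N. ennreal ((if ?i \<omega> = j then 1 else 0) * D (grid_point N T j) \<omega> ^ 2))"
      unfolding one by simp
  qed
  also have "\<dots> = (\<Sum>j\<le>N. \<E> \<omega>. ennreal ((if ?i \<omega> = j then 1 else 0) * D (grid_point N T j) \<omega> ^ 2))"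
    using gp by (intro nn_integral_sum) measurable
  also have "\<dots> \<le> (\<Sum>j\<le>N. \<E> \<omega>. ennreal ((if ?i \<omega> = j then 1 else 0) * D T \<omega> ^ 2))"
  proof (rule sum_mono)
    fix j assume j: "j \<in> {..N}"
    have "grid_point N T j \<le> T"
      using grid_point_mono[OF T_pos, of j N N] j grid_point_last[OF N, of T] by simp
    then show "(\<E> \<omega>. ennreal ((if ?i \<omega> = j then 1 else 0) * D (grid_point N T j) \<omega> ^ 2))
      \<le> (\<E> \<omega>. ennreal ((if ?i \<omega> = j then 1 else 0) * D T \<omega> ^ 2))"
      by (intro submartingale[OF _ gp _ zm]) auto
  qed
  also have "\<dots> = (\<E> \<omega>. (\<Sum>j\<le>N. ennreal ((if ?i \<omega> = j then 1 else 0) * D T \<omega> ^ 2)))"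
    using T_pos by (intro nn_integral_sum[symmetric]) measurable
  also have "\<dots> = (\<E> \<omega>. ennreal (D T \<omega> ^ 2))"
  proof (rule nn_integral_cong)
    fix \<omega>
    have "(\<Sum>j\<le>N. ennreal ((if ?i \<omega> = j then 1 else 0) * D T \<omega> ^ 2))
      = (\<Sum>j\<le>N. if ?i \<omega> = j then ennreal (D T \<omega> ^ 2) else 0)"
      by (intro sum.cong) auto
    then show "(\<Sum>j\<le>N. ennreal ((if ?i \<omega> = j then 1 else 0) * D T \<omega> ^ 2)) = ennreal (D T \<omega> ^ 2)"
      unfolding one .
  qed
  finally show ?thesis .
qed

text \<open>Where the index of \<open>\<rho>\<close> is \<open>j\<close>, time is advanced from grid
  point \<open>j\<close> to the index of \<open>\<tau>\<close> one step at a time. At step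
  \<open>i\<close> only the part where \<open>\<tau>\<close> has not been reached moves, and this
  part is known at grid point \<open>i\<close>. The cut-off at \<open>ennreal T\<close> is there
  because \<open>B\<close> may otherwise depend on events after \<open>T\<close>.\<close>

lemma grid_optional_sampling:
  assumes \<rho>: "stopping_time F \<rho>" and \<tau>: "stopping_time F \<tau>" and N: "0 < N"
    and le: "\<And>\<omega>. \<omega> \<in> space M \<Longrightarrow> \<rho> \<omega> \<le> \<tau> \<omega>"
    and B: "B \<in> borel_measurable (pre_sigma \<rho>)" "\<And>\<omega>. 0 \<le> B \<omega> \<and> B \<omega> \<le> 1"
  shows "(\<E> \<omega>. ennreal ((if \<rho> \<omega> \<le> ennreal T then B \<omega> else 0) * D (grid_point N T (grid_index N T (\<rho> \<omega>))) \<omega>))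
    \<le> (\<E> \<omega>. ennreal ((if \<rho> \<omega> \<le> ennreal T then B \<omega> else 0) * D (grid_point N T (grid_index N T (\<tau> \<omega>))) \<omega>))"
proof -
  let ?i = "\<lambda>\<omega>. grid_index N T (\<rho> \<omega>)" and ?k = "\<lambda>\<omega>. grid_index N T (\<tau> \<omega>)" and ?g = "grid_point N T"
  let ?B = "\<lambda>\<omega>. if \<rho> \<omega> \<le> ennreal T then B \<omega> else 0"
  note [measurable] = grid_index_measurable[OF \<rho>] grid_index_measurable[OF \<tau>] D_measurable
  have gp: "0 \<le> ?g j" for j by (rule grid_point_nonneg[OF T_pos])
  have gT: "?g j \<le> T" if "j \<le> N" for j
    using grid_point_mono[OF T_pos that, of N] grid_point_last[OF N, of T] by simp
  have BM [measurable]: "?B \<in> borel_measurable M"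
    by (rule measurable_F_M[OF pre_sigma_restrict_measurable[OF \<rho> B(1)]])
  define z where "z j \<omega> = (if ?i \<omega> = j then ?B \<omega> else 0)" for j \<omega>
  have z01: "0 \<le> z j \<omega> \<and> z j \<omega> \<le> 1" for j \<omega> using B(2) by (simp add: z_def)
  have zM [measurable]: "z j \<in> borel_measurable M" for j unfolding z_def[abs_def] by measurable
  have Bz: "ennreal (?B \<omega> * x) = (\<Sum>j\<le>N. ennreal (z j \<omega> * x))" for \<omega> x
  proof -
    have "(\<Sum>j\<le>N. ennreal (z j \<omega> * x)) = (\<Sum>j\<le>N. if ?i \<omega> = j then ennreal (?B \<omega> * x) else 0)"
      by (intro sum.cong) (auto simp: z_def)
    then show ?thesis
      using grid_index_bound[OF T_pos N, of "\<rho> \<omega>"] by (simp add: sum.delta')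
  qed
  have zF: "z j \<in> borel_measurable (F (ennreal (?g j)))" if j: "j \<le> N" for j
  proof -
    \<comment> \<open>Each factor is measurable at grid point \<open>j\<close>. The cut-off in
      \<open>?B\<close> covers \<open>j = N\<close>, where the index alone does not tell whether
      \<open>\<rho>\<close> exceeds \<open>T\<close>.\<close>
    have eq: "z j \<omega> = (if \<rho> \<omega> \<le> ennreal (?g j) then B \<omega> else 0)
        * (if j \<noteq> 0 \<and> ?i \<omega> \<le> j - 1 then 0 else 1)" for \<omega>
    proof -
      have *: "?i \<omega> = j \<longleftrightarrow> ?i \<omega> \<le> j \<and> \<not> (j \<noteq> 0 \<and> ?i \<omega> \<le> j - 1)" by auto
      have "ennreal (?g j) \<le> ennreal T" using gT[OF j] by (rule ennreal_leI)
      moreover have "?i \<omega> \<le> j \<longleftrightarrow> \<rho> \<omega> \<le> ennreal (?g j)" if "\<rho> \<omega> \<le> ennreal T"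
        using grid_index_le_iff'[OF T_pos N, of j "\<rho> \<omega>"] j that grid_index_bound[OF T_pos N, of "\<rho> \<omega>"]
          grid_point_last[OF N, of T] by (cases "j = N") auto
      ultimately show ?thesis unfolding z_def * by (cases "\<rho> \<omega> \<le> ennreal T") (auto dest: order_trans)
    qed
    have "Measurable.pred (F (ennreal (?g j))) (\<lambda>\<omega>. ?i \<omega> \<le> j - 1)"
      by (rule measurable_F_mono[OF ennreal_leI grid_index_pred[OF \<rho> N]]) (simp add: grid_point_mono[OF T_pos])
    then show ?thesis
      unfolding eq[abs_def]
      by (intro borel_measurable_times pre_sigma_restrict_measurable[OF \<rho> B(1)] measurable_If_pred pred_intros_logic measurable_const) simp_all
  qed
  have each: "(\<E> \<omega>. ennreal (z j \<omega> * D (?g (?i \<omega>)) \<omega>)) \<le> (\<E> \<omega>. ennreal (z j \<omega> * D (?g (?k \<omega>)) \<omega>))"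
    if j: "j \<le> N" for j
  proof -
    \<comment> \<open>\<open>H i\<close> samples at the rounded \<open>\<tau>\<close> stopped at
      grid point \<open>i\<close>; it interpolates between the two sides.\<close>
    define H where "H i = (\<E> \<omega>. ennreal (z j \<omega> * D (?g (min i (?k \<omega>))) \<omega>))" for i
    have step: "H i \<le> H (Suc i)" if i: "j \<le> i" for i
    proof -
      \<comment> \<open>\<open>y\<close> is the weight where the rounded \<open>\<tau>\<close> lies
        beyond grid point \<open>i\<close>. The remaining part \<open>R\<close> is common to
        \<open>H i\<close> and \<open>H (Suc i)\<close>.\<close>
      define y where "y \<omega> = (if ?k \<omega> \<le> i then 0 else z j \<omega>)" for \<omega>
      define R where "R = (\<E> \<omega>. ennreal ((if ?k \<omega> \<le> i then z j \<omega> else 0) * D (?g (?k \<omega>)) \<omega>))"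
      have samp [measurable]: "(\<lambda>\<omega>. D (?g (?k \<omega>)) \<omega>) \<in> borel_measurable M"
        by (rule grid_sample_measurable) measurable
      have yF: "y \<in> borel_measurable (F (ennreal (?g i)))"
      proof -
        have "z j \<in> borel_measurable (F (ennreal (?g i)))"
          by (rule measurable_F_mono[OF ennreal_leI zF[OF j]]) (rule grid_point_mono[OF T_pos i])
        then show ?thesis unfolding y_def[abs_def]
          by (intro measurable_If_pred grid_index_pred[OF \<tau> N] measurable_const) simp_all
      qed
      have yM [measurable]: "y \<in> borel_measurable M" by (rule measurable_F_M[OF yF])
      have dec: "(\<E> \<omega>. ennreal (z j \<omega> * D (?g (min l (?k \<omega>))) \<omega>))
        = R + (\<E> \<omega>. ennreal (y \<omega> * D (?g l) \<omega> ^ 1))" if l: "l = i \<or> l = Suc i" for l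
      proof -
        have "(\<E> \<omega>. ennreal (z j \<omega> * D (?g (min l (?k \<omega>))) \<omega>))
          = (\<E> \<omega>. ennreal ((if ?k \<omega> \<le> i then z j \<omega> else 0) * D (?g (?k \<omega>)) \<omega>) + ennreal (y \<omega> * D (?g l) \<omega> ^ 1))"
          using l by (intro nn_integral_cong) (auto simp: y_def min_def)
        also have "\<dots> = R + (\<E> \<omega>. ennreal (y \<omega> * D (?g l) \<omega> ^ 1))"
          unfolding R_def using gp by (intro nn_integral_add) measurable
        finally show ?thesis .
      qed
      have "(\<E> \<omega>. ennreal (y \<omega> * D (?g i) \<omega> ^ 1)) \<le> (\<E> \<omega>. ennreal (y \<omega> * D (?g (Suc i)) \<omega> ^ 1))"
        by (rule submartingale[OF _ gp _ yF]) (use z01 grid_point_mono[OF T_pos] in \<open>auto simp: y_def\<close>)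
      then show ?thesis
        unfolding H_def by (subst (1 2) dec) (auto intro: add_left_mono)
    qed
    have "H j \<le> H (j + n)" for n
      by (induction n) (auto intro: order_trans[OF _ step])
    from this[of "N - j"] have "H j \<le> H N" using j by simp
    moreover have "H N = (\<E> \<omega>. ennreal (z j \<omega> * D (?g (?k \<omega>)) \<omega>))"
      unfolding H_def using grid_index_bound[OF T_pos N] by (simp add: min_absorb2)
    moreover have "H j = (\<E> \<omega>. ennreal (z j \<omega> * D (?g (?i \<omega>)) \<omega>))"
      unfolding H_def
    proof (rule nn_integral_cong)
      fix \<omega> assume "\<omega> \<in> space M"
      then have "?i \<omega> \<le> ?k \<omega>" by (intro grid_index_mono T_pos N le)
      then show "ennreal (z j \<omega> * D (?g (min j (?k \<omega>))) \<omega>) = ennreal (z j \<omega> * D (?g (?i \<omega>)) \<omega>)"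
        by (cases "?i \<omega> = j") (auto simp: z_def min_absorb1)
    qed
    ultimately show ?thesis by simp
  qed
  have samp [measurable]: "(\<lambda>\<omega>. D (?g (?k \<omega>)) \<omega>) \<in> borel_measurable M" "(\<lambda>\<omega>. D (?g (?i \<omega>)) \<omega>) \<in> borel_measurable M"
    by (intro grid_sample_measurable grid_index_measurable \<rho> \<tau>)+
  have "(\<E> \<omega>. ennreal (?B \<omega> * D (?g (?i \<omega>)) \<omega>)) = (\<Sum>j\<le>N. \<E> \<omega>. ennreal (z j \<omega> * D (?g (?i \<omega>)) \<omega>))"
    unfolding Bz by (intro nn_integral_sum) measurable
  also have "\<dots> \<le> (\<Sum>j\<le>N. \<E> \<omega>. ennreal (z j \<omega> * D (?g (?k \<omega>)) \<omega>))"
    by (intro sum_mono each) simp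
  also have "\<dots> = (\<E> \<omega>. ennreal (?B \<omega> * D (?g (?k \<omega>)) \<omega>))"
    unfolding Bz by (intro nn_integral_sum[symmetric]) measurable
  finally show ?thesis .
qed

lemma grid_sample_tendsto:
  assumes "\<omega> \<in> space M"
  shows "(\<lambda>k. D (grid_point (Suc k) T (grid_index (Suc k) T x)) \<omega>) \<longlonglongrightarrow> D (enn2real (min x (ennreal T))) \<omega>"
  by (rule continuous_on_tendsto_compose[OF D_continuous[OF assms] grid_point_index_tendsto[OF T_pos]])
     (auto simp: grid_point_nonneg[OF T_pos])

text \<open>The rounded times converge to the true ones and \<open>D\<close> has continuous paths.
  Fatou's lemma treats the left side, the uniform second moments of the samples the right
  side.\<close>

theorem optional_sampling:
  assumes \<rho>: "stopping_time F \<rho>" and \<tau>: "stopping_time F \<tau>"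
    and le: "\<And>\<omega>. \<omega> \<in> space M \<Longrightarrow> \<rho> \<omega> \<le> \<tau> \<omega>"
    and B: "B \<in> borel_measurable (pre_sigma \<rho>)" "\<And>\<omega>. 0 \<le> B \<omega> \<and> B \<omega> \<le> 1"
  shows "(\<lambda>\<omega>. D (enn2real (min (\<tau> \<omega>) (ennreal T))) \<omega>) \<in> borel_measurable M" (is ?meas)
    and "(\<E> \<omega>. ennreal ((if \<rho> \<omega> \<le> ennreal T then B \<omega> else 0) * D (enn2real (min (\<rho> \<omega>) (ennreal T))) \<omega>))
    \<le> (\<E> \<omega>. ennreal ((if \<rho> \<omega> \<le> ennreal T then B \<omega> else 0) * D (enn2real (min (\<tau> \<omega>) (ennreal T))) \<omega>))"
      (is ?ineq)
proof -
  let ?B = "\<lambda>\<omega>. if \<rho> \<omega> \<le> ennreal T then B \<omega> else 0"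
  let ?s = "\<lambda>k \<tau> \<omega>. D (grid_point (Suc k) T (grid_index (Suc k) T (\<tau> \<omega>))) \<omega>"
  have BM [measurable]: "?B \<in> borel_measurable M"
    by (rule measurable_F_M[OF pre_sigma_restrict_measurable[OF \<rho> B(1)]])
  have sm [measurable]: "?s k \<rho> \<in> borel_measurable M" "?s k \<tau> \<in> borel_measurable M" for k
    by (intro grid_sample_measurable grid_index_measurable \<rho> \<tau>)+
  show meas [measurable]: ?meas
    by (rule borel_measurable_LIMSEQ_metric[OF sm(2) grid_sample_tendsto])
  have sq: "(?B \<omega> * x)\<^sup>2 \<le> x\<^sup>2" for \<omega> x
    using B(2)[of \<omega>] mult_right_mono[of "(B \<omega>)\<^sup>2" 1 "x\<^sup>2"] by (auto simp: power_mult_distrib power_le_one)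
  have lim: "(\<lambda>k. ?B \<omega> * ?s k \<tau> \<omega>) \<longlonglongrightarrow> ?B \<omega> * D (enn2real (min (\<tau> \<omega>) (ennreal T))) \<omega>"
    if "\<omega> \<in> space M" for \<omega> and \<tau> :: "'a \<Rightarrow> ennreal"
    using grid_sample_tendsto[OF that, of "\<tau> \<omega>"] by (intro tendsto_mult tendsto_const)
  have "(\<E> \<omega>. ennreal (?B \<omega> * D (enn2real (min (\<rho> \<omega>) (ennreal T))) \<omega>))
    = (\<E> \<omega>. liminf (\<lambda>k. ennreal (?B \<omega> * ?s k \<rho> \<omega>)))"
    by (intro nn_integral_cong lim_imp_Liminf[OF sequentially_bot, symmetric] tendsto_ennrealI lim)
  also have "\<dots> \<le> liminf (\<lambda>k. \<E> \<omega>. ennreal (?B \<omega> * ?s k \<rho> \<omega>))"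
    by (rule nn_integral_liminf) measurable
  also have "\<dots> \<le> liminf (\<lambda>k. \<E> \<omega>. ennreal (?B \<omega> * ?s k \<tau> \<omega>))"
    by (intro Liminf_mono always_eventually allI grid_optional_sampling[OF \<rho> \<tau> _ le B]) simp
  also have "\<dots> \<le> (\<E> \<omega>. ennreal (?B \<omega> * D (enn2real (min (\<tau> \<omega>) (ennreal T))) \<omega>))"
  proof (rule nn_integral_liminf_le_L2_bounded)
    show "(\<lambda>\<omega>. ?B \<omega> * ?s k \<tau> \<omega>) \<in> borel_measurable M" for k by measurable
    show "(\<lambda>\<omega>. ?B \<omega> * D (enn2real (min (\<tau> \<omega>) (ennreal T))) \<omega>) \<in> borel_measurable M" by measurable
    show "0 \<le> ?B \<omega> * ?s k \<tau> \<omega>" for k \<omega> using B(2)[of \<omega>] D_nonneg by simp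
    show "AE \<omega> in M. (\<lambda>k. ?B \<omega> * ?s k \<tau> \<omega>) \<longlonglongrightarrow> ?B \<omega> * D (enn2real (min (\<tau> \<omega>) (ennreal T))) \<omega>"
      by (rule AE_I2[OF lim])
    fix k
    have "(\<E> \<omega>. ennreal ((?B \<omega> * ?s k \<tau> \<omega>)\<^sup>2)) \<le> (\<E> \<omega>. ennreal ((?s k \<tau> \<omega>)\<^sup>2))"
      by (intro nn_integral_mono ennreal_leI sq)
    also have "\<dots> \<le> (\<E> \<omega>. ennreal (D T \<omega> ^ 2))"
      by (rule grid_second_moment[OF \<tau>]) simp
    also have "\<dots> = ennreal (enn2real (\<E> \<omega>. ennreal (D T \<omega> ^ 2)))"
      using square_integrable by simp
    finally show "(\<E> \<omega>. ennreal ((?B \<omega> * ?s k \<tau> \<omega>)\<^sup>2)) \<le> ennreal (enn2real (\<E> \<omega>. ennreal (D T \<omega> ^ 2)))" .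
  qed
  finally show ?ineq .
qed

end

section \<open>The lower bound on the cost\<close>

text \<open>The period that ends with injection \<open>i\<close> starts here; the value 0 stands for
  the start of the process and not for an injection.\<close>

definition prev_time :: "(nat \<Rightarrow> ennreal) \<Rightarrow> nat \<Rightarrow> ennreal"
  where "prev_time \<tau> i = (case i of 0 \<Rightarrow> 0 | Suc j \<Rightarrow> \<tau> j)"

lemma prev_time_simps [simp]: "prev_time \<tau> 0 = 0" "prev_time \<tau> (Suc j) = \<tau> j"
  by (simp_all add: prev_time_def)

text \<open>Pathwise form of the conditions that \<open>control_policy\<close> imposes on the
  injection times.\<close>

locale injection_path =
  fixes \<tau> :: "nat \<Rightarrow> ennreal"
  assumes le: "\<And>i. \<tau> i \<le> \<tau> (Suc i)" and strict: "\<And>i. \<tau> i < \<infinity> \<Longrightarrow> \<tau> i < \<tau> (Suc i)"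
begin

lemma mono: "i \<le> j \<Longrightarrow> \<tau> i \<le> \<tau> j"
  by (rule lift_Suc_mono_le[of \<tau>, OF le])

lemma less: "i < j \<Longrightarrow> \<tau> i < \<infinity> \<Longrightarrow> \<tau> i < \<tau> j"
  using strict[of i] mono[of "Suc i" j] by (simp add: less_le_trans)

lemma injected_between:
  assumes "prev_time \<tau> i \<le> t" "t < \<tau> i"
  shows "{j. \<tau> j \<le> t} = {..<i}"
proof (intro set_eqI iffI)
  fix j assume "j \<in> {j. \<tau> j \<le> t}"
  then show "j \<in> {..<i}" using mono[of i j] assms(2) by (force simp: not_less[symmetric])
next
  fix j assume "j \<in> {..<i}"
  then obtain k where k: "i = Suc k" "j \<le> k" by (cases i) auto
  then show "j \<in> {j. \<tau> j \<le> t}" using mono[OF k(2)] assms(1) by auto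
qed

lemma injected_at:
  assumes "\<tau> i < \<infinity>"
  shows "{j. \<tau> j \<le> \<tau> i} = {..<Suc i}"
proof (intro set_eqI iffI)
  fix j assume "j \<in> {j. \<tau> j \<le> \<tau> i}"
  then show "j \<in> {..<Suc i}" using less[of i j] assms by (auto simp: not_less[symmetric] less_Suc_eq_le)
next
  fix j assume "j \<in> {..<Suc i}"
  then show "j \<in> {j. \<tau> j \<le> \<tau> i}" using mono[of j i] by auto
qed

end

text \<open>\<open>Z\<close> is the surplus without injections along one path.\<close>

locale nonneg_path = injection_path +
  fixes \<xi> :: "nat \<Rightarrow> real" and Z :: "real \<Rightarrow> real"
  assumes cont: "continuous_on {0..} Z" and Z0: "0 \<le> Z 0"
    and nonneg: "\<And>t. 0 \<le> t \<Longrightarrow> 0 \<le> Z t + (\<Sum>i | \<tau> i \<le> ennreal t. \<xi> i)"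
begin

lemma between: "0 \<le> t \<Longrightarrow> prev_time \<tau> i \<le> ennreal t \<Longrightarrow> ennreal t < \<tau> i \<Longrightarrow> 0 \<le> Z t + (\<Sum>j<i. \<xi> j)"
  using nonneg[of t] injected_between by simp

lemma after: "0 \<le> t \<Longrightarrow> \<tau> i = ennreal t \<Longrightarrow> 0 \<le> Z t + (\<Sum>j<Suc i. \<xi> j)"
  using nonneg[of t] injected_at[of i] by simp

text \<open>At an injection time the hypothesis sees only the surplus after the jump. Before the
  jump, the surplus is a limit of values from the period that ends there; the period is degenerate
  only for an injection at time 0, where \<open>Z0\<close> applies. The jump inequality will need
  this sign.\<close>

lemma before:
  assumes t: "0 \<le> t" "\<tau> i = ennreal t"
  shows "0 \<le> Z t + (\<Sum>j<i. \<xi> j)"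
proof (cases "prev_time \<tau> i < \<tau> i")
  case True
  define p where "p = enn2real (prev_time \<tau> i)"
  have "prev_time \<tau> i < top" using True by (rule less_le_trans) simp
  then have pe: "prev_time \<tau> i = ennreal p" by (simp add: p_def)
  have p: "0 \<le> p" "p < t" using True t unfolding pe by (simp_all add: p_def ennreal_less_iff)
  show ?thesis
  proof (rule continuous_ge_on_Ioo[of p t "\<lambda>t. Z t + (\<Sum>j<i. \<xi> j)"])
    show "continuous_on {p..t} (\<lambda>t. Z t + (\<Sum>j<i. \<xi> j))"
      using p by (intro continuous_intros continuous_on_subset[OF cont]) auto
    show "0 \<le> Z s + (\<Sum>j<i. \<xi> j)" if "s \<in> {p<..<t}" for s
      using that p t by (intro between) (auto simp: pe ennreal_less_iff intro: ennreal_leI)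
  qed (use p in auto)
next
  case False
  show ?thesis
  proof (cases i)
    case 0
    with False t have "t = 0" by simp
    with 0 Z0 show ?thesis by simp
  next
    case (Suc j)
    have "\<tau> j \<le> ennreal t" using le[of j] t(2) Suc by simp
    then have "\<tau> j < \<infinity>" by (rule le_less_trans) simp
    from strict[OF this] False Suc show ?thesis by simp
  qed
qed

end

section \<open>Time integrals of bounded controls\<close>

lemma set_integral_lipschitz:
  fixes h :: "real \<Rightarrow> real"
  assumes hm: "(\<lambda>s. h s * indicator {0<..} s) \<in> borel_measurable borel" and hb: "\<And>s. 0 < s \<Longrightarrow> \<bar>h s\<bar> \<le> m"
    and st: "0 \<le> s" "s \<le> t"
  shows "\<bar>(LINT s:{0<..t}|lborel. h s) - (LINT s:{0<..s}|lborel. h s)\<bar> \<le> m * (t - s)"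
proof -
  have int: "set_integrable lborel {a<..b} h" if "0 \<le> a" for a b
    unfolding set_integrable_def
  proof (rule integrableI_bounded_set[where A = "{a<..b}" and B = m])
    have "(\<lambda>s. indicator {a<..b} s *\<^sub>R h s) = (\<lambda>s. indicator {a<..b} s * (h s * indicator {0<..} s))"
      using that by (auto simp: indicator_def)
    then show "(\<lambda>s. indicator {a<..b} s *\<^sub>R h s) \<in> borel_measurable lborel"
      using hm by simp
    show "emeasure lborel {a<..b} < \<infinity>" by (cases "a \<le> b") auto
    show "AE x in lborel. x \<in> {a<..b} \<longrightarrow> norm (indicator {a<..b} x *\<^sub>R h x) \<le> m"
      using hb that by (intro AE_I2) (auto simp: indicator_def)
  qed auto
  have "{0<..t} = {0<..s} \<union> {s<..t}" using st by auto
  then have "(LINT s:{0<..t}|lborel. h s) = (LINT s:{0<..s}|lborel. h s) + (LINT s:{s<..t}|lborel. h s)"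
    using int[of 0 s] int[OF st(1), of t] by (simp add: set_integral_Un)
  moreover have "\<bar>LINT s:{s<..t}|lborel. h s\<bar> \<le> m * (t - s)"
  proof -
    have "\<bar>LINT s:{s<..t}|lborel. h s\<bar> \<le> (LINT s:{s<..t}|lborel. \<bar>h s\<bar>)"
      using set_integral_norm_bound[OF int[OF st(1), of t]] by simp
    also have "\<dots> \<le> (LINT s:{s<..t}|lborel. m)"
    proof (rule set_integral_mono)
      show "set_integrable lborel {s<..t} (\<lambda>s. \<bar>h s\<bar>)"
        by (rule set_integrable_abs[OF int[OF st(1)]])
      show "set_integrable lborel {s<..t} (\<lambda>s. m)"
        unfolding set_integrable_def using st by simp
    qed (use hb st in auto)
    also have "\<dots> = m * (t - s)"
      unfolding set_lebesgue_integral_def using st by (simp add: measure_def)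
    finally show ?thesis .
  qed
  ultimately show ?thesis by simp
qed

lemma set_integral_continuous:
  fixes h :: "real \<Rightarrow> real"
  assumes hm: "(\<lambda>s. h s * indicator {0<..} s) \<in> borel_measurable borel" and hb: "\<And>s. 0 < s \<Longrightarrow> \<bar>h s\<bar> \<le> m"
  shows "continuous_on {0..} (\<lambda>t. LINT s:{0<..t}|lborel. h s)"
proof -
  have "m-lipschitz_on {0..} (\<lambda>t. LINT s:{0<..t}|lborel. h s)"
  proof (rule lipschitz_onI)
    show "0 \<le> m" using hb[of 1] by linarith
    fix s t :: real assume "s \<in> {0..}" "t \<in> {0..}"
    then show "dist (LINT s:{0<..s}|lborel. h s) (LINT s:{0<..t}|lborel. h s) \<le> m * dist s t"
      using set_integral_lipschitz[OF hm hb, of s t] set_integral_lipschitz[OF hm hb, of t s]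
      by (cases "s \<le> t") (auto simp: dist_real_def abs_minus_commute)
  qed
  then show ?thesis by (rule lipschitz_on_continuous_on)
qed

context brownian_motion
begin

text \<open>After the coordinates are exchanged, the generating rectangles of the predictable
  sigma-algebra lie in the product sigma-algebra. The indicator is there because predictability
  concerns positive times only.\<close>

lemma predictable_measurable:
  assumes "predictable M F u"
  shows "(\<lambda>(\<omega>, s). u s \<omega> * indicator {0<..} s) \<in> borel_measurable (M \<Otimes>\<^sub>M lborel)"
proof -
  let ?\<Omega> = "space M \<times> {0<..} :: ('a \<times> real) set"
  let ?N = "restrict_space (M \<Otimes>\<^sub>M lborel) ?\<Omega>"
  have \<Omega>: "?\<Omega> \<in> sets (M \<Otimes>\<^sub>M lborel)" by (intro pair_measureI) auto
  have spN: "space ?N = ?\<Omega>" by (auto simp: space_restrict_space space_pair_measure)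
  have swap: "(\<lambda>(\<omega>, s). (s, \<omega>)) \<in> measurable ?N (predictable_sigma M F)"
    unfolding predictable_sigma_def
  proof (rule measurable_measure_of)
    show "{{s<..t} \<times> A |s t A. 0 \<le> s \<and> s < t \<and> A \<in> sets (F (ennreal s))} \<subseteq> Pow ({0<..} \<times> space M)"
      using sets.sets_into_space[of _ "F _"] by (fastforce simp: space_F)
    show "(\<lambda>(\<omega>, s). (s, \<omega>)) \<in> space ?N \<rightarrow> {0<..} \<times> space M"
      unfolding spN by auto
    fix G assume "G \<in> {{s<..t} \<times> A |s t A. 0 \<le> s \<and> s < t \<and> A \<in> sets (F (ennreal s))}"
    then obtain s t A where G: "G = {s<..t} \<times> A" "A \<in> sets (F (ennreal s))" by auto
    have A: "A \<in> sets M" using G(2) subalgebra_F unfolding subalgebra_def by blast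
    have "(\<lambda>(\<omega>, s). (s, \<omega>)) -` G \<inter> space ?N = (A \<times> {s<..t}) \<inter> ?\<Omega>"
      unfolding G spN by auto
    also have "\<dots> \<in> sets ?N"
      using A \<Omega> by (auto simp: sets_restrict_space_iff)
    finally show "(\<lambda>(\<omega>, s). (s, \<omega>)) -` G \<inter> space ?N \<in> sets ?N" .
  qed
  from measurable_compose[OF swap assms[unfolded predictable_def]]
  have "(\<lambda>p. u (snd p) (fst p)) \<in> borel_measurable ?N" by (simp add: case_prod_beta)
  then have "(\<lambda>p. indicator ?\<Omega> p *\<^sub>R u (snd p) (fst p)) \<in> borel_measurable (M \<Otimes>\<^sub>M lborel)"
    using \<Omega> by (subst (asm) borel_measurable_restrict_space_iff) auto
  also have "?this \<longleftrightarrow> ?thesis"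
    by (intro measurable_cong) (auto simp: space_pair_measure indicator_def)
  finally show ?thesis .
qed

lemma pre_sigma_measurable_M:
  assumes "stopping_time F \<rho>" "B \<in> borel_measurable (pre_sigma \<rho>)"
  shows "(B :: 'a \<Rightarrow> real) \<in> borel_measurable M"
  using measurable_F_M[OF pre_sigma_restrict_measurable[OF assms, of \<top>]] by simp

text \<open>All grids start at nonnegative times, so every elementary integral up to time 0
  vanishes.\<close>

lemma ito_integral_initial:
  assumes Y: "ito_integral_process M F w h Y"
  shows "AE \<omega> in M. Y 0 \<omega> = 0"
proof -
  have Ym [measurable]: "Y 0 \<in> borel_measurable M"
    by (rule ito_integral_process_measurable[OF Y]) simp
  obtain n t \<phi> where el: "\<And>k. elementary M F (n k) (t k) (\<phi> k)"
    and lim: "(\<lambda>k. \<E> \<omega>. ennreal ((elementary_integral w (n k) (t k) (\<phi> k) 0 \<omega> - Y 0 \<omega>)\<^sup>2)) \<longlonglongrightarrow> 0"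
    by (rule ito_integral_processE[OF Y order_refl]) (rule that; assumption)
  have "elementary_integral w (n k) (t k) (\<phi> k) 0 \<omega> = 0" for k \<omega>
  proof -
    have "0 \<le> t k i" if "i \<le> n k" for i
      using elementary_grid_mono(2)[OF el that order_refl] .
    then show ?thesis
      unfolding elementary_integral_def
      by (intro sum.neutral) (auto simp: min_absorb2 Suc_le_eq less_imp_le)
  qed
  then have "(\<lambda>k::nat. \<E> \<omega>. ennreal ((Y 0 \<omega>)\<^sup>2)) \<longlonglongrightarrow> 0"
    using lim by simp
  then have "(\<E> \<omega>. ennreal ((Y 0 \<omega>)\<^sup>2)) = 0"
    by (simp add: LIMSEQ_const_iff)
  then have "AE \<omega> in M. ennreal ((Y 0 \<omega>)\<^sup>2) = 0"
    by (subst (asm) nn_integral_0_iff_AE) auto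
  then show ?thesis by eventually_elim simp
qed

lemma discounted_exp_continuous_submartingale:
  assumes Y: "ito_integral_process M F w h Y" and m: "0 \<le> m" and T: "0 < T"
    and hm: "(\<lambda>(\<omega>, s). h s \<omega> * indicator {0<..} s) \<in> borel_measurable (M \<Otimes>\<^sub>M lborel)"
    and hb: "\<And>s \<omega>. 0 < s \<Longrightarrow> \<omega> \<in> space M \<Longrightarrow> 0 \<le> h s \<omega> \<and> h s \<omega> \<le> m"
    and \<beta>: "0 \<le> \<beta>" "0 \<le> \<kappa>"
  shows "continuous_submartingale M F w (discounted_exp \<beta> \<kappa> h Y) T"
proof (unfold_locales)
  show "0 < T" by fact
  show "discounted_exp \<beta> \<kappa> h Y t \<in> borel_measurable M" if "0 \<le> t" for t
    unfolding discounted_exp_def[abs_def]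
    using set_integral_measurable[OF hm] ito_integral_process_measurable[OF Y that] by measurable
  show "0 \<le> discounted_exp \<beta> \<kappa> h Y t \<omega>" for t \<omega> by (simp add: discounted_exp_def)
  show "continuous_on {0..} (\<lambda>t. discounted_exp \<beta> \<kappa> h Y t \<omega>)" if \<omega>: "\<omega> \<in> space M" for \<omega>
  proof -
    have "(\<lambda>s. h s \<omega> * indicator {0<..} s) \<in> borel_measurable borel"
      using measurable_Pair2[OF hm \<omega>] by simp
    moreover have "\<bar>h s \<omega>\<bar> \<le> m" if "0 < s" for s
      using hb[OF that \<omega>] by simp
    ultimately have "continuous_on {0..} (\<lambda>t. LINT s:{0<..t}|lborel. h s \<omega>)"
      by (rule set_integral_continuous)
    moreover have "continuous_on {0..} (\<lambda>t. Y t \<omega>)"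
      using Y \<omega> unfolding ito_integral_process_def by blast
    ultimately show ?thesis
      unfolding discounted_exp_def by (intro continuous_intros)
  qed
  show "(\<E> \<omega>. ennreal (z \<omega> * discounted_exp \<beta> \<kappa> h Y s \<omega> ^ p)) \<le> (\<E> \<omega>. ennreal (z \<omega> * discounted_exp \<beta> \<kappa> h Y t \<omega> ^ p))"
    if "p = 1 \<or> p = 2" "0 \<le> s" "s \<le> t" "z \<in> borel_measurable (F (ennreal s))" "\<And>\<omega>. 0 \<le> z \<omega> \<and> z \<omega> \<le> 1" for p s t z
    using that(1) by (intro discounted_exp_submartingale(1)[OF Y that(2,3) m hm hb \<beta> _ that(4,5)]) auto
  show "(\<E> \<omega>. ennreal (discounted_exp \<beta> \<kappa> h Y T \<omega> ^ 2)) < \<infinity>"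
    using T by (intro discounted_exp_submartingale(2)[OF Y order_refl _ m hm hb \<beta>, where z = "\<lambda>_. 0"]) auto
qed

text \<open>A telescoping sum over the injections, counted from 0. \<open>L i\<close> is the
  discounted value at the start of period \<open>i\<close>, \<open>R i\<close> the one just before
  injection \<open>i\<close>, or at \<open>T\<close> if that comes first. Optional sampling relates
  them within a period, the jump inequality across an injection. Once the start of a period lies
  beyond \<open>T\<close>, \<open>E i\<close> charges \<open>\<alpha> * exp (- r * T)\<close>, the
  largest discounted value possible at \<open>T\<close>; this is the extra term of the
  conclusion.\<close>

lemma cost_lower_bound_horizon:
  assumes \<pi>: "control_policy M F \<pi>" and x: "0 \<le> x"
    and X: "surplus_process M F w \<mu> \<sigma> \<delta> \<pi> x X" "AE \<omega> in M. \<forall>t\<ge>0. 0 \<le> X t \<omega>"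
    and fin: "cost M r K c \<pi> x < \<infinity>"
    and pos: "0 < \<mu>" "0 < \<sigma>" "0 < r" "0 < K" "0 \<le> c" "0 < \<beta>" "0 < \<alpha>"
    and hjb: "\<beta> * \<delta> - r = (\<mu> / \<sigma>)\<^sup>2 / 2"
    and jump: "\<And>y \<xi>. 0 \<le> y \<Longrightarrow> 0 \<le> \<xi> \<Longrightarrow> \<alpha> * exp (- \<beta> * y) \<le> \<alpha> * exp (- \<beta> * (y + \<xi>)) + (K + c * \<xi>)"
    and T: "0 < T"
  shows "ennreal (\<alpha> * exp (- \<beta> * x)) \<le> cost M r K c \<pi> x + ennreal (\<alpha> * exp (- r * T))"
proof -
  define u where "u = retention \<pi> x"
  define \<tau> where "\<tau> = inj_time \<pi> x"
  define \<xi> where "\<xi> = inj_size \<pi> x"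
  define \<kappa> where "\<kappa> = \<mu> / \<sigma>"
  define h where "h s \<omega> = \<sigma> * u s \<omega>" for s \<omega>
  have \<kappa>: "0 \<le> \<kappa>" "\<kappa> * \<sigma> = \<mu>" using pos by (simp_all add: \<kappa>_def)
  have ctrl: "predictable M F u" "\<And>s \<omega>. 0 < s \<Longrightarrow> \<omega> \<in> space M \<Longrightarrow> 0 \<le> u s \<omega> \<and> u s \<omega> \<le> 1"
    "\<And>i. stopping_time F (\<tau> i)"
    "\<And>i \<omega>. \<omega> \<in> space M \<Longrightarrow> \<tau> i \<omega> \<le> \<tau> (Suc i) \<omega>"
    "\<And>i \<omega>. \<omega> \<in> space M \<Longrightarrow> \<tau> i \<omega> < \<infinity> \<Longrightarrow> \<tau> i \<omega> < \<tau> (Suc i) \<omega>"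
    "\<And>i. \<xi> i \<in> borel_measurable (pre_sigma (\<tau> i))"
    "\<And>i \<omega>. \<omega> \<in> space M \<Longrightarrow> 0 < \<xi> i \<omega>"
    using \<pi> x unfolding control_policy_def u_def \<tau>_def \<xi>_def by auto
  from X(1) obtain Y where Y: "ito_integral_process M F w h Y"
    and Xeq: "\<And>t \<omega>. 0 \<le> t \<Longrightarrow> \<omega> \<in> space M \<Longrightarrow> X t \<omega> = x + (LINT s:{0<..t}|lborel. \<mu> * u s \<omega> - \<delta>) + Y t \<omega>
      + (\<Sum>i | \<tau> i \<omega> \<le> ennreal t. \<xi> i \<omega>)"
    unfolding surplus_process_def u_def \<tau>_def \<xi>_def h_def[abs_def] by auto
  have um: "(\<lambda>(\<omega>, s). u s \<omega> * indicator {0<..} s) \<in> borel_measurable (M \<Otimes>\<^sub>M lborel)"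
    by (rule predictable_measurable[OF ctrl(1)])
  have hm: "(\<lambda>(\<omega>, s). h s \<omega> * indicator {0<..} s) \<in> borel_measurable (M \<Otimes>\<^sub>M lborel)"
    using borel_measurable_times[OF borel_measurable_const[of \<sigma>] um]
    by (simp add: h_def case_prod_beta mult.assoc)
  have hb: "0 \<le> h s \<omega> \<and> h s \<omega> \<le> \<sigma>" if "0 < s" "\<omega> \<in> space M" for s \<omega>
    using ctrl(2)[OF that] pos unfolding h_def by (simp add: mult_left_le)
  define D where "D = discounted_exp \<beta> \<kappa> h Y"
  interpret D: continuous_submartingale M F w D T
    unfolding D_def using pos \<kappa> T by (intro discounted_exp_continuous_submartingale[OF Y _ _ hm hb]) auto
  define Z where "Z t \<omega> = x + (LINT s:{0<..t}|lborel. \<mu> * u s \<omega> - \<delta>) + Y t \<omega>" for t \<omega>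
  have drift: "(LINT s:{0<..t}|lborel. \<mu> * u s \<omega> - \<delta>) = \<kappa> * (LINT s:{0<..t}|lborel. h s \<omega>) - \<delta> * t"
    if \<omega>: "\<omega> \<in> space M" and t: "0 \<le> t" for t \<omega>
  proof -
    have "set_integrable lborel {0<..t} (\<lambda>s. \<mu> * u s \<omega>)"
      unfolding set_integrable_def
    proof (rule integrableI_bounded_set[where A = "{0<..t}" and B = \<mu>])
      have "(\<lambda>s. u s \<omega> * indicator {0<..} s) \<in> borel_measurable borel"
        using measurable_Pair2[OF um \<omega>] by simp
      moreover have "(\<lambda>s. indicator {0<..t} s *\<^sub>R (\<mu> * u s \<omega>)) = (\<lambda>s. \<mu> * (u s \<omega> * indicator {0<..} s) * indicator {0<..t} s)"
        by (auto simp: indicator_def)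
      ultimately show "(\<lambda>s. indicator {0<..t} s *\<^sub>R (\<mu> * u s \<omega>)) \<in> borel_measurable lborel" by simp
      show "AE s in lborel. s \<in> {0<..t} \<longrightarrow> norm (indicator {0<..t} s *\<^sub>R (\<mu> * u s \<omega>)) \<le> \<mu>"
        using ctrl(2)[OF _ \<omega>] pos by (intro AE_I2) (auto simp: abs_mult mult_left_le)
      show "emeasure lborel {0<..t} < \<infinity>" using t by simp
    qed auto
    moreover have "set_integrable lborel {0<..t} (\<lambda>s. \<delta>)"
      unfolding set_integrable_def using t by simp
    ultimately have "(LINT s:{0<..t}|lborel. \<mu> * u s \<omega> - \<delta>) = (LINT s:{0<..t}|lborel. \<mu> * u s \<omega>) - (LINT s:{0<..t}|lborel. \<delta>)"
      by (rule set_integral_diff(2))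
    also have "(LINT s:{0<..t}|lborel. \<delta>) = \<delta> * t"
      unfolding set_lebesgue_integral_def using t by (simp add: measure_def)
    also have "(LINT s:{0<..t}|lborel. \<mu> * u s \<omega>) = \<kappa> * (LINT s:{0<..t}|lborel. h s \<omega>)"
      unfolding h_def \<kappa>(2)[symmetric] by (simp add: mult.assoc)
    finally show ?thesis .
  qed
  \<comment> \<open>Here the choice of \<open>\<beta>\<close> enters:
    \<open>\<kappa>\<^sup>2 / 2 = \<beta> * \<delta> - r\<close> accounts for the debt rate and the
    discounting together.\<close>
  have DZ: "exp (- \<beta> * x) * D t \<omega> = exp (- r * t) * exp (- \<beta> * Z t \<omega>)" if "\<omega> \<in> space M" "0 \<le> t" for t \<omega>
  proof -
    have hjb': "\<kappa>\<^sup>2 / 2 = \<beta> * \<delta> - r"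
      unfolding \<kappa>_def by (rule hjb[symmetric])
    have "- \<beta> * x + ((\<beta> * \<delta> - r) * t - \<beta> * (Y t \<omega> + \<kappa> * (LINT s:{0<..t}|lborel. h s \<omega>)))
      = - r * t + (- \<beta> * (x + (\<kappa> * (LINT s:{0<..t}|lborel. h s \<omega>) - \<delta> * t) + Y t \<omega>))"
      by (simp add: algebra_simps)
    then show ?thesis
      unfolding D_def discounted_exp_def Z_def drift[OF that] hjb' exp_add[symmetric] by (simp only:)
  qed
  have path: "AE \<omega> in M. \<omega> \<in> space M \<and> Y 0 \<omega> = 0 \<and> nonneg_path (\<lambda>i. \<tau> i \<omega>) (\<lambda>i. \<xi> i \<omega>) (\<lambda>t. Z t \<omega>)"
    using X(2) ito_integral_initial[OF Y] AE_space
  proof eventually_elim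
    case (elim \<omega>)
    then have \<omega>: "\<omega> \<in> space M" by simp
    have "(\<lambda>s. h s \<omega> * indicator {0<..} s) \<in> borel_measurable borel"
      using measurable_Pair2[OF hm \<omega>] by simp
    moreover have "\<bar>h s \<omega>\<bar> \<le> \<sigma>" if "0 < s" for s
      using hb[OF that \<omega>] by simp
    ultimately have "continuous_on {0..} (\<lambda>t. LINT s:{0<..t}|lborel. h s \<omega>)"
      by (rule set_integral_continuous)
    moreover have "continuous_on {0..} (\<lambda>t. Y t \<omega>)"
      using Y \<omega> unfolding ito_integral_process_def by blast
    ultimately have "continuous_on {0..} (\<lambda>t. x + (\<kappa> * (LINT s:{0<..t}|lborel. h s \<omega>) - \<delta> * t) + Y t \<omega>)"
      by (intro continuous_intros)
    then have "continuous_on {0..} (\<lambda>t. Z t \<omega>)"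
      by (rule continuous_on_eq) (simp add: Z_def drift[OF \<omega>])
    moreover have "0 \<le> Z 0 \<omega>" using elim(2) x unfolding Z_def drift[OF \<omega> order_refl] by (simp add: set_lebesgue_integral_def)
    moreover have "0 \<le> Z t \<omega> + (\<Sum>i | \<tau> i \<omega> \<le> ennreal t. \<xi> i \<omega>)" if "0 \<le> t" for t
      using elim(1)[rule_format, OF that] unfolding Xeq[OF that \<omega>] Z_def .
    ultimately show ?case
      by (intro conjI \<omega> elim(2) nonneg_path.intro injection_path.intro nonneg_path_axioms.intro ctrl(4,5)[OF \<omega>])
  qed
  define \<rho> where "\<rho> i \<omega> = prev_time (\<lambda>i. \<tau> i \<omega>) i" for i \<omega>
  define S where "S i \<omega> = (\<Sum>j<i. \<xi> j \<omega>)" for i \<omega>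
  \<comment> \<open>Injection sizes are known to be positive on \<open>space M\<close> only, while
    optional sampling asks for a weight in [0, 1] everywhere; hence the \<open>max\<close>.\<close>
  define B where "B i \<omega> = exp (- \<beta> * max 0 (S i \<omega>))" for i \<omega>
  have \<rho>0: "\<rho> 0 = (\<lambda>_. 0)" and \<rho>Suc: "\<rho> (Suc i) = \<tau> i" for i by (auto simp: \<rho>_def)
  have \<rho>st: "stopping_time F (\<rho> i)" for i
    by (cases i) (simp_all add: \<rho>0 \<rho>Suc ctrl stopping_time_const)
  have \<rho>le: "\<rho> i \<omega> \<le> \<tau> i \<omega>" if "\<omega> \<in> space M" for i \<omega>
    using ctrl(4)[OF that] by (cases i) (simp_all add: \<rho>0 \<rho>Suc)
  have \<tau>mono: "\<tau> i \<omega> \<le> \<tau> j \<omega>" if "\<omega> \<in> space M" "i \<le> j" for i j \<omega>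
    by (rule lift_Suc_mono_le[of "\<lambda>i. \<tau> i \<omega>", OF ctrl(4)[OF that(1)] that(2)])
  have B01: "0 \<le> B i \<omega> \<and> B i \<omega> \<le> 1" for i \<omega> using pos by (simp add: B_def)
  have Bm: "B i \<in> borel_measurable (pre_sigma (\<rho> i))" for i
  proof -
    have "\<xi> j \<in> borel_measurable (pre_sigma (\<rho> i))" if j: "j < i" for j
    proof -
      obtain k where k: "i = Suc k" "j \<le> k" using j by (cases i) auto
      have "sets (pre_sigma (\<tau> j)) \<subseteq> sets (pre_sigma (\<rho> i))"
        unfolding k \<rho>Suc using \<tau>mono k(2) by (intro mono_pre_sigma ctrl) auto
      then show ?thesis
        using ctrl(6)[of j] by (auto simp: measurable_def space_pre_sigma)
    qed
    then have "S i \<in> borel_measurable (pre_sigma (\<rho> i))"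
      unfolding S_def[abs_def] by (intro borel_measurable_sum) auto
    then show ?thesis unfolding B_def[abs_def] by measurable
  qed
  have Seq: "max 0 (S i \<omega>) = S i \<omega>" if "\<omega> \<in> space M" for i \<omega>
    using ctrl(7)[OF that] unfolding S_def by (simp add: sum_nonneg less_imp_le)
  define \<theta> where "\<theta> y = enn2real (min y (ennreal T))" for y
  define C where "C i \<omega> = (if \<tau> i \<omega> < \<infinity> then exp (- r * enn2real (\<tau> i \<omega>)) * (K + c * \<xi> i \<omega>) else 0)" for i \<omega>
  define L where "L i \<omega> = \<alpha> * exp (- \<beta> * x) * ((if \<rho> i \<omega> \<le> ennreal T then B i \<omega> else 0) * D (\<theta> (\<rho> i \<omega>)) \<omega>)" for i \<omega>
  define R where "R i \<omega> = \<alpha> * exp (- \<beta> * x) * ((if \<rho> i \<omega> \<le> ennreal T then B i \<omega> else 0) * D (\<theta> (\<tau> i \<omega>)) \<omega>)" for i \<omega>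
  define E where "E i \<omega> = \<alpha> * exp (- r * T) * (if \<rho> i \<omega> \<le> ennreal T then 0 else 1)" for i \<omega>
  have \<xi>M [measurable]: "\<xi> i \<in> borel_measurable M" for i
    by (rule pre_sigma_measurable_M[OF ctrl(3,6)])
  have \<tau>M [measurable]: "\<tau> i \<in> borel_measurable M" for i
    by (rule stopping_time_measurable[OF ctrl(3)])
  have \<rho>M [measurable]: "\<rho> i \<in> borel_measurable M" for i
    by (rule stopping_time_measurable[OF \<rho>st])
  have BM [measurable]: "B i \<in> borel_measurable M" for i
    by (rule pre_sigma_measurable_M[OF \<rho>st Bm])
  have CM [measurable]: "C i \<in> borel_measurable M" for i unfolding C_def[abs_def] by measurable
  have EM [measurable]: "E i \<in> borel_measurable M" for i unfolding E_def[abs_def] by measurable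
  have Dm [measurable]: "(\<lambda>\<omega>. D (\<theta> (\<rho> i \<omega>)) \<omega>) \<in> borel_measurable M" "(\<lambda>\<omega>. D (\<theta> (\<tau> i \<omega>)) \<omega>) \<in> borel_measurable M" for i
    unfolding \<theta>_def using D.optional_sampling(1)[OF \<rho>st \<rho>st order_refl Bm B01]
      D.optional_sampling(1)[OF \<rho>st ctrl(3) \<rho>le Bm B01] by auto
  have LM [measurable]: "L i \<in> borel_measurable M" "R i \<in> borel_measurable M" for i
    unfolding L_def[abs_def] R_def[abs_def] by measurable
  have nn: "0 \<le> L i \<omega>" "0 \<le> R i \<omega>" "0 \<le> E i \<omega>" for i \<omega>
    unfolding L_def R_def E_def using pos B01[of i \<omega>] D.D_nonneg by auto
  have C0: "0 \<le> C i \<omega>" if "\<omega> \<in> space M" for i \<omega>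
    unfolding C_def using ctrl(7)[OF that, of i] pos by (auto intro!: mult_nonneg_nonneg add_nonneg_nonneg)
  have cost_eq: "cost M r K c \<pi> x = (\<Sum>i. \<E> \<omega>. ennreal (C i \<omega>))"
  proof -
    have "cost M r K c \<pi> x = (\<E> \<omega>. (\<Sum>i. ennreal (C i \<omega>)))"
      unfolding cost_def C_def \<tau>_def \<xi>_def injection_cost_def
      by (intro nn_integral_cong arg_cong[where f = suminf] ext) auto
    then show ?thesis by (simp add: nn_integral_suminf)
  qed
  have sampling: "(\<E> \<omega>. ennreal (L i \<omega>)) \<le> (\<E> \<omega>. ennreal (R i \<omega>))" for i
  proof -
    have "(\<E> \<omega>. ennreal (L i \<omega>)) = ennreal (\<alpha> * exp (- \<beta> * x)) *
      (\<E> \<omega>. ennreal ((if \<rho> i \<omega> \<le> ennreal T then B i \<omega> else 0) * D (\<theta> (\<rho> i \<omega>)) \<omega>))"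
      unfolding L_def using pos by (subst nn_integral_cmult[symmetric]) (auto simp: ennreal_mult')
    also have "\<dots> \<le> ennreal (\<alpha> * exp (- \<beta> * x)) *
      (\<E> \<omega>. ennreal ((if \<rho> i \<omega> \<le> ennreal T then B i \<omega> else 0) * D (\<theta> (\<tau> i \<omega>)) \<omega>))"
      unfolding \<theta>_def by (intro mult_left_mono D.optional_sampling(2)[OF \<rho>st ctrl(3) \<rho>le Bm B01]) auto
    also have "\<dots> = (\<E> \<omega>. ennreal (R i \<omega>))"
      unfolding R_def using pos by (subst nn_integral_cmult[symmetric]) (auto simp: ennreal_mult')
    finally show ?thesis .
  qed
  have \<theta>0: "0 \<le> \<theta> y" for y by (simp add: \<theta>_def)
  have \<theta>le: "y = ennreal (\<theta> y)" if "y \<le> ennreal T" for y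
    using min_ennreal_real(1)[of T y] that T by (simp add: \<theta>_def min_absorb1)
  have \<theta>gt: "\<theta> y = T" if "\<not> y \<le> ennreal T" for y
    using that T by (simp add: \<theta>_def min_absorb2)
  \<comment> \<open>The weight \<open>B i\<close> turns \<open>D\<close> into the discounted value
    of the surplus that includes the first \<open>i\<close> injections.\<close>
  have val: "\<alpha> * exp (- \<beta> * x) * (B i \<omega> * D t \<omega>) = \<alpha> * exp (- r * t) * exp (- \<beta> * (Z t \<omega> + S i \<omega>))"
    if "\<omega> \<in> space M" "0 \<le> t" for i t \<omega>
  proof -
    have "\<alpha> * exp (- \<beta> * x) * (B i \<omega> * D t \<omega>) = \<alpha> * B i \<omega> * (exp (- \<beta> * x) * D t \<omega>)" by simp
    also have "\<dots> = \<alpha> * exp (- r * t) * (exp (- \<beta> * Z t \<omega>) * exp (- \<beta> * S i \<omega>))"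
      unfolding DZ[OF that] B_def Seq[OF that(1)] by simp
    also have "exp (- \<beta> * Z t \<omega>) * exp (- \<beta> * S i \<omega>) = exp (- \<beta> * (Z t \<omega> + S i \<omega>))"
      unfolding exp_add[symmetric] by (simp add: algebra_simps)
    finally show ?thesis .
  qed
  have step: "AE \<omega> in M. R i \<omega> + E i \<omega> \<le> L (Suc i) \<omega> + E (Suc i) \<omega> + C i \<omega>" for i
    using path
  proof eventually_elim
    case (elim \<omega>)
    then have \<omega>: "\<omega> \<in> space M" by simp
    interpret p: nonneg_path "\<lambda>i. \<tau> i \<omega>" "\<lambda>i. \<xi> i \<omega>" "\<lambda>t. Z t \<omega>" using elim by simp
    \<comment> \<open>Either injection \<open>i\<close> takes place by time \<open>T\<close>, or
      \<open>T\<close> falls into the period before it, or \<open>T\<close> was passed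
      earlier.\<close>
    consider (inj) "\<tau> i \<omega> \<le> ennreal T" | (mid) "\<rho> i \<omega> \<le> ennreal T" "\<not> \<tau> i \<omega> \<le> ennreal T"
      | (late) "\<not> \<rho> i \<omega> \<le> ennreal T" by auto
    then show ?case
    proof cases
      case inj
      define t where "t = \<theta> (\<tau> i \<omega>)"
      have t: "0 \<le> t" "\<tau> i \<omega> = ennreal t" using \<theta>0 \<theta>le[OF inj] by (simp_all add: t_def)
      have \<rho>T: "\<rho> i \<omega> \<le> ennreal T" using \<rho>le[OF \<omega>, of i] inj by (rule order_trans)
      have "exp (- r * t) * (\<alpha> * exp (- \<beta> * (Z t \<omega> + S i \<omega>)))
          \<le> exp (- r * t) * (\<alpha> * exp (- \<beta> * ((Z t \<omega> + S i \<omega>) + \<xi> i \<omega>)) + (K + c * \<xi> i \<omega>))"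
        using p.before[OF t] ctrl(7)[OF \<omega>, of i] by (intro mult_left_mono jump) (auto simp: S_def)
      moreover have "S (Suc i) \<omega> = S i \<omega> + \<xi> i \<omega>" by (simp add: S_def)
      moreover have "R i \<omega> = \<alpha> * exp (- r * t) * exp (- \<beta> * (Z t \<omega> + S i \<omega>))"
        using \<rho>T val[OF \<omega> t(1), of i] by (simp add: R_def t_def[symmetric])
      moreover have "L (Suc i) \<omega> = \<alpha> * exp (- r * t) * exp (- \<beta> * (Z t \<omega> + S (Suc i) \<omega>))"
        using inj val[OF \<omega> t(1), of "Suc i"] by (simp add: L_def \<rho>Suc t_def[symmetric])
      moreover have "C i \<omega> = exp (- r * t) * (K + c * \<xi> i \<omega>)"
        using t by (simp add: C_def)
      ultimately show ?thesis
        using \<rho>T inj by (simp add: E_def \<rho>Suc distrib_left mult_ac add.assoc)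
    next
      case mid
      have "0 \<le> Z T \<omega> + S i \<omega>"
        using p.between[of T i] mid T by (simp add: S_def \<rho>_def not_le)
      then have "\<alpha> * exp (- r * T) * exp (- \<beta> * (Z T \<omega> + S i \<omega>)) \<le> \<alpha> * exp (- r * T) * 1"
        using pos by (intro mult_left_mono) auto
      moreover have "R i \<omega> = \<alpha> * exp (- r * T) * exp (- \<beta> * (Z T \<omega> + S i \<omega>))"
        using mid \<theta>gt[OF mid(2)] val[OF \<omega>, of T i] T by (simp add: R_def)
      ultimately have "R i \<omega> \<le> \<alpha> * exp (- r * T)" by simp
      then show ?thesis
        using mid nn(1)[of "Suc i" \<omega>] C0[OF \<omega>, of i] by (simp add: E_def \<rho>Suc)
    next
      case late
      then have "\<not> \<tau> i \<omega> \<le> ennreal T" using \<rho>le[OF \<omega>, of i] by auto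
      then show ?thesis
        using late nn(1)[of "Suc i" \<omega>] C0[OF \<omega>, of i] by (simp add: E_def R_def \<rho>Suc)
    qed
  qed
  define V where "V i = (\<E> \<omega>. ennreal (L i \<omega>)) + (\<E> \<omega>. ennreal (E i \<omega>))" for i
  have Vstep: "V i \<le> V (Suc i) + (\<E> \<omega>. ennreal (C i \<omega>))" for i
  proof -
    have "V i \<le> (\<E> \<omega>. ennreal (R i \<omega>) + ennreal (E i \<omega>))"
      unfolding V_def using sampling[of i] by (simp add: nn_integral_add add_right_mono)
    also have "\<dots> \<le> (\<E> \<omega>. ennreal (L (Suc i) \<omega>) + ennreal (E (Suc i) \<omega>) + ennreal (C i \<omega>))"
    proof (rule nn_integral_mono_AE)
      show "AE \<omega> in M. ennreal (R i \<omega>) + ennreal (E i \<omega>) \<le> ennreal (L (Suc i) \<omega>) + ennreal (E (Suc i) \<omega>) + ennreal (C i \<omega>)"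
        using step[of i] AE_space
      proof eventually_elim
        case (elim \<omega>)
        then show ?case
          using nn[of i \<omega>] nn[of "Suc i" \<omega>] C0[of \<omega> i]
          by (simp add: ennreal_plus[symmetric] del: ennreal_plus)
      qed
    qed
    also have "\<dots> = V (Suc i) + (\<E> \<omega>. ennreal (C i \<omega>))"
      by (simp add: V_def nn_integral_add)
    finally show ?thesis .
  qed
  have Vsum: "V 0 \<le> V n + (\<Sum>i<n. \<E> \<omega>. ennreal (C i \<omega>))" for n
  proof (induction n)
    case (Suc n)
    have "V 0 \<le> (V (Suc n) + (\<E> \<omega>. ennreal (C n \<omega>))) + (\<Sum>i<n. \<E> \<omega>. ennreal (C i \<omega>))"
      using Suc Vstep[of n] by (meson add_right_mono order_trans)
    then show ?case by (simp add: ac_simps)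
  qed simp
  have V0: "ennreal (\<alpha> * exp (- \<beta> * x)) \<le> V 0"
  proof -
    have "AE \<omega> in M. ennreal (\<alpha> * exp (- \<beta> * x)) \<le> ennreal (L 0 \<omega>)"
      using path
    proof eventually_elim
      case (elim \<omega>)
      then have "D 0 \<omega> = 1" by (simp add: D_def discounted_exp_def set_lebesgue_integral_def)
      then show ?case by (simp add: L_def \<rho>0 B_def S_def \<theta>_def)
    qed
    then have "(\<E> \<omega>. ennreal (\<alpha> * exp (- \<beta> * x))) \<le> (\<E> \<omega>. ennreal (L 0 \<omega>))"
      by (rule nn_integral_mono_AE)
    then have "ennreal (\<alpha> * exp (- \<beta> * x)) \<le> (\<E> \<omega>. ennreal (L 0 \<omega>))"
      by (simp add: emeasure_space_1)
    then show ?thesis unfolding V_def by (rule add_increasing2[OF zero_le])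
  qed
  \<comment> \<open>Up to \<open>T\<close>, the value after injection \<open>n\<close> is at most a
    constant times the cost \<open>C n\<close>, because an injection costs at least
    \<open>K\<close>. The mean costs have a finite sum, so these terms vanish in the limit; finite
    cost thus takes care of injections that accumulate before \<open>T\<close>.\<close>
  have Vlim: "V (Suc n) \<le> ennreal (\<alpha> * exp (r * T) / K) * (\<E> \<omega>. ennreal (C n \<omega>)) + ennreal (\<alpha> * exp (- r * T))" for n
  proof -
    have "(\<E> \<omega>. ennreal (L (Suc n) \<omega>)) \<le> (\<E> \<omega>. ennreal (\<alpha> * exp (r * T) / K) * ennreal (C n \<omega>))"
    proof (rule nn_integral_mono_AE)
      show "AE \<omega> in M. ennreal (L (Suc n) \<omega>) \<le> ennreal (\<alpha> * exp (r * T) / K) * ennreal (C n \<omega>)"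
        using path
      proof eventually_elim
        case (elim \<omega>)
        then have \<omega>: "\<omega> \<in> space M" by simp
        interpret p: nonneg_path "\<lambda>i. \<tau> i \<omega>" "\<lambda>i. \<xi> i \<omega>" "\<lambda>t. Z t \<omega>" using elim by simp
        show ?case
        proof (cases "\<tau> n \<omega> \<le> ennreal T")
          case True
          define t where "t = \<theta> (\<tau> n \<omega>)"
          have t: "0 \<le> t" "\<tau> n \<omega> = ennreal t" using \<theta>0 \<theta>le[OF True] by (simp_all add: t_def)
          have tT: "t \<le> T" using True T unfolding t(2) by simp
          have X0: "0 \<le> Z t \<omega> + S (Suc n) \<omega>" using p.after[OF t] by (simp add: S_def)
          have "L (Suc n) \<omega> = \<alpha> * exp (- r * t) * exp (- \<beta> * (Z t \<omega> + S (Suc n) \<omega>))"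
            using True val[OF \<omega> t(1), of "Suc n"] by (simp add: L_def \<rho>Suc t_def[symmetric])
          also have "\<dots> \<le> \<alpha> * exp (- r * t) * 1"
            using X0 pos by (intro mult_left_mono) auto
          also have "\<dots> \<le> \<alpha> * exp (- r * t) * exp (r * T)"
            using pos T by (intro mult_left_mono) auto
          also have "\<dots> = \<alpha> * exp (r * T) / K * (exp (- r * t) * K)"
            using pos by simp
          also have "\<dots> \<le> \<alpha> * exp (r * T) / K * C n \<omega>"
            using pos t ctrl(7)[OF \<omega>, of n] by (intro mult_left_mono) (simp_all add: C_def)
          finally have "ennreal (L (Suc n) \<omega>) \<le> ennreal (\<alpha> * exp (r * T) / K * C n \<omega>)"
            by (rule ennreal_leI)
          then show ?thesis
            using pos by (subst (asm) ennreal_mult') simp_all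
        next
          case False
          then show ?thesis by (simp add: L_def \<rho>Suc)
        qed
      qed
    qed
    also have "\<dots> = ennreal (\<alpha> * exp (r * T) / K) * (\<E> \<omega>. ennreal (C n \<omega>))"
      by (rule nn_integral_cmult) measurable
    finally have 1: "(\<E> \<omega>. ennreal (L (Suc n) \<omega>)) \<le> ennreal (\<alpha> * exp (r * T) / K) * (\<E> \<omega>. ennreal (C n \<omega>))" .
    have "(\<E> \<omega>. ennreal (E (Suc n) \<omega>)) \<le> (\<E> \<omega>. ennreal (\<alpha> * exp (- r * T)))"
      using pos by (intro nn_integral_mono ennreal_leI) (simp add: E_def)
    then have "(\<E> \<omega>. ennreal (E (Suc n) \<omega>)) \<le> ennreal (\<alpha> * exp (- r * T))"
      by (simp add: emeasure_space_1)
    with 1 show ?thesis unfolding V_def by (rule add_mono)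
  qed
  have Csum: "(\<lambda>n. \<Sum>i<n. \<E> \<omega>. ennreal (C i \<omega>)) \<longlonglongrightarrow> cost M r K c \<pi> x"
    unfolding cost_eq by (rule summable_LIMSEQ) simp
  have Czero: "(\<lambda>n. \<E> \<omega>. ennreal (C n \<omega>)) \<longlonglongrightarrow> 0"
    using fin unfolding cost_eq by (intro ennreal_suminf_finite_LIMSEQ_zero) simp
  have "ennreal (\<alpha> * exp (- \<beta> * x)) \<le> (ennreal (\<alpha> * exp (r * T) / K) * (\<E> \<omega>. ennreal (C n \<omega>)) + ennreal (\<alpha> * exp (- r * T)))
      + (\<Sum>i<Suc n. \<E> \<omega>. ennreal (C i \<omega>))" for n
    using V0 Vsum[of "Suc n"] Vlim[of n] by (meson add_right_mono order_trans)
  moreover have "(\<lambda>n. (ennreal (\<alpha> * exp (r * T) / K) * (\<E> \<omega>. ennreal (C n \<omega>)) + ennreal (\<alpha> * exp (- r * T)))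
      + (\<Sum>i<Suc n. \<E> \<omega>. ennreal (C i \<omega>))) \<longlonglongrightarrow>
      (ennreal (\<alpha> * exp (r * T) / K) * 0 + ennreal (\<alpha> * exp (- r * T))) + cost M r K c \<pi> x"
    by (intro tendsto_add tendsto_const ennreal_tendsto_cmult Czero LIMSEQ_Suc[OF Csum]) simp
  ultimately have "ennreal (\<alpha> * exp (- \<beta> * x)) \<le> (ennreal (\<alpha> * exp (r * T) / K) * 0 + ennreal (\<alpha> * exp (- r * T))) + cost M r K c \<pi> x"
    by (intro LIMSEQ_le_const) auto
  then show ?thesis by (simp add: add.commute)
qed

lemma cost_lower_bound:
  assumes "control_policy M F \<pi>" "0 \<le> x"
    and "surplus_process M F w \<mu> \<sigma> \<delta> \<pi> x X" "AE \<omega> in M. \<forall>t\<ge>0. 0 \<le> X t \<omega>"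
    and "cost M r K c \<pi> x < \<infinity>"
    and "0 < \<mu>" "0 < \<sigma>" "0 < r" "0 < K" "0 \<le> c" "0 < \<beta>" "0 < \<alpha>"
    and "\<beta> * \<delta> - r = (\<mu> / \<sigma>)\<^sup>2 / 2"
    and "\<And>y \<xi>. 0 \<le> y \<Longrightarrow> 0 \<le> \<xi> \<Longrightarrow> \<alpha> * exp (- \<beta> * y) \<le> \<alpha> * exp (- \<beta> * (y + \<xi>)) + (K + c * \<xi>)"
  shows "ennreal (\<alpha> * exp (- \<beta> * x)) \<le> cost M r K c \<pi> x"
proof -
  have "ennreal (\<alpha> * exp (- \<beta> * x)) \<le> cost M r K c \<pi> x + ennreal (\<alpha> * exp (- r * real (Suc n)))" for n
    using assms by (intro cost_lower_bound_horizon) auto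
  moreover have "(\<lambda>n. \<alpha> * exp (- r * real (Suc n))) \<longlonglongrightarrow> 0"
  proof -
    have "(\<lambda>n. \<alpha> * exp (- r) ^ Suc n) \<longlonglongrightarrow> \<alpha> * 0"
      using assms by (intro tendsto_mult tendsto_const LIMSEQ_Suc LIMSEQ_power_zero) simp
    moreover have "exp (- r) ^ Suc n = exp (- r * real (Suc n))" for n
      by (simp only: exp_of_nat_mult[symmetric] mult.commute)
    ultimately show ?thesis by (simp only: mult_zero_right)
  qed
  from tendsto_add[OF tendsto_const tendsto_ennrealI[OF this]]
  have "(\<lambda>n. cost M r K c \<pi> x + ennreal (\<alpha> * exp (- r * real (Suc n)))) \<longlonglongrightarrow> cost M r K c \<pi> x + ennreal 0" .
  ultimately have "ennreal (\<alpha> * exp (- \<beta> * x)) \<le> cost M r K c \<pi> x + ennreal 0"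
    by (intro LIMSEQ_le_const) auto
  then show ?thesis by simp
qed

end

section \<open>Successive ruin times of a path\<close>

context injection_path
begin

text \<open>Pathwise form of \<open>surplus_before\<close>, for constant injections added to
  \<open>z\<close>.\<close>

definition before_injection :: "(real \<Rightarrow> real) \<Rightarrow> real \<Rightarrow> real \<Rightarrow> real" where
  "before_injection z \<xi> t = z t + (\<Sum>i | \<tau> i \<le> ennreal t. \<xi>) - (\<Sum>i | \<tau> i = ennreal t. \<xi>)"

text \<open>After the preceding injection and up to \<open>\<tau> i\<close> inclusive, exactly
  \<open>i\<close> injections count: at \<open>\<tau> i\<close> itself, injection \<open>i\<close>
  enters the first sum and is removed by the second. For \<open>i = 0\<close> the period includes
  time 0.\<close>

lemma before_injection_eq:
  assumes "i = 0 \<or> prev_time \<tau> i < ennreal t" "ennreal t \<le> \<tau> i"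
  shows "before_injection z \<xi> t = z t + real i * \<xi>"
proof -
  have lt: "\<tau> j < ennreal t" if j: "j < i" for j
  proof -
    obtain k where k: "i = Suc k" "j \<le> k" using j by (cases i) auto
    then show ?thesis using assms(1) mono[OF k(2)] by (auto intro: le_less_trans)
  qed
  show ?thesis
  proof (cases "ennreal t = \<tau> i")
    case True
    have fin: "\<tau> i < \<infinity>" unfolding True[symmetric] by simp
    have ne: "\<tau> j \<noteq> ennreal t" if j: "j \<noteq> i" for j
    proof (cases "j < i")
      case False
      then have "i < j" using j by simp
      from less[OF this fin] show ?thesis unfolding True[symmetric] by simp
    qed (auto dest: lt)
    have "\<tau> j = ennreal t \<longleftrightarrow> j = i" for j
      using ne[of j] True[symmetric] by (cases "j = i") simp_all
    then have "{j. \<tau> j = ennreal t} = {i}" by simp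
    moreover have "{j. \<tau> j \<le> ennreal t} = {..<Suc i}"
      unfolding True by (rule injected_at[OF fin])
    ultimately show ?thesis by (simp add: before_injection_def algebra_simps)
  next
    case False
    then have t: "ennreal t < \<tau> i" using assms(2) by simp
    have "{j. \<tau> j = ennreal t} = {}"
    proof -
      have "\<tau> j \<noteq> ennreal t" for j
      proof (cases "j < i")
        case False
        then have "\<tau> i \<le> \<tau> j" by (intro mono) simp
        with t show ?thesis by (metis leD)
      qed (auto dest: lt)
      then show ?thesis by blast
    qed
    moreover have "prev_time \<tau> i \<le> ennreal t" using assms(1) by auto
    ultimately show ?thesis
      using injected_between[OF _ t] by (simp add: before_injection_def)
  qed
qed

end

text \<open>The times are ruin times of a surplus that they themselves drive. The lemmas below
  resolve this circularity: injection \<open>i\<close> takes place when \<open>z\<close>, the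
  surplus without injections, first reaches \<open>- real i * \<xi>\<close>.\<close>

locale ruin_path = injection_path +
  fixes z :: "real \<Rightarrow> real" and \<xi> :: real
  assumes cont: "continuous_on {0..} z" and z0: "0 \<le> z 0" and \<xi>: "0 < \<xi>"
    and first: "\<tau> 0 = Inf {ennreal t | t. 0 \<le> t \<and> before_injection z \<xi> t = 0}"
    and succ: "\<And>i. \<tau> (Suc i) = Inf {ennreal t | t. 0 \<le> t \<and> \<tau> i < ennreal t \<and> before_injection z \<xi> t = 0}"
begin

lemma ruin_eq: "\<tau> i = Inf {ennreal t | t. 0 \<le> t \<and> (i = 0 \<or> prev_time \<tau> i < ennreal t) \<and> before_injection z \<xi> t = 0}"
  by (cases i) (simp_all add: first[symmetric] succ[symmetric])

lemma not_ruined: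
  assumes "0 \<le> t" "i = 0 \<or> prev_time \<tau> i < ennreal t" "ennreal t < \<tau> i"
  shows "z t \<noteq> - real i * \<xi>"
proof
  assume "z t = - real i * \<xi>"
  then have "before_injection z \<xi> t = 0"
    using before_injection_eq[of i t z \<xi>] assms(2,3) by simp
  then have "\<tau> i \<le> ennreal t"
    using assms(1,2) by (subst ruin_eq) (intro Inf_lower, blast)
  then show False using assms(3) by simp
qed

text \<open>By the intermediate value theorem, \<open>z\<close> cannot get below its level without a
  ruin, which \<open>not_ruined\<close> excludes. For \<open>i \<noteq> 0\<close> the starting time
  \<open>p\<close> of the period is no candidate for ruin, so strictness at \<open>p\<close> is
  assumed.\<close>

lemma level_aux:
  assumes p: "0 \<le> p" "p \<le> t" "i = 0 \<and> p = 0 \<or> prev_time \<tau> i = ennreal p" "- real i * \<xi> \<le> z p" "i \<noteq> 0 \<Longrightarrow> - real i * \<xi> < z p"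
    and t: "ennreal t < \<tau> i"
  shows "- real i * \<xi> < z t"
proof -
  have ne: "z s \<noteq> - real i * \<xi>" if s: "p \<le> s" "s \<le> t" for s
  proof (cases "s = p \<and> i \<noteq> 0")
    case False
    have "ennreal s < \<tau> i" using t s(2) by (auto intro: le_less_trans ennreal_leI)
    then show ?thesis using s p False by (intro not_ruined) (auto simp: ennreal_less_iff)
  qed (use p(5) in auto)
  show ?thesis
  proof (rule ccontr)
    assume "\<not> - real i * \<xi> < z t"
    then have "\<exists>s\<ge>p. s \<le> t \<and> z s = - real i * \<xi>"
      using p by (intro IVT2' continuous_on_subset[OF cont]) auto
    then show False using ne by auto
  qed
qed

text \<open>The lower bound is continuity. If \<open>z t\<close> were above the level, it would stay
  above for a while, no ruin would occur at \<open>t\<close> or shortly afterwards, and the infimum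
  would exceed \<open>t\<close>.\<close>

lemma hits_level:
  assumes p: "0 \<le> p" "p \<le> t" "i = 0 \<and> p = 0 \<or> prev_time \<tau> i = ennreal p \<and> p < t"
      "- real i * \<xi> \<le> z p" "i \<noteq> 0 \<Longrightarrow> - real i * \<xi> < z p"
    and t: "\<tau> i = ennreal t"
  shows "z t = - real i * \<xi>"
proof (rule antisym)
  show ge: "- real i * \<xi> \<le> z t"
  proof (cases "p < t")
    case True
    show ?thesis
    proof (rule continuous_ge_on_Ioo[of p t z])
      show "continuous_on {p..t} z" using p by (intro continuous_on_subset[OF cont]) auto
      show "- real i * \<xi> \<le> z s" if "s \<in> {p<..<t}" for s
      proof (rule less_imp_le, rule level_aux[OF p(1) _ _ p(4,5)])
        show "p \<le> s" using that by simp
        show "i = 0 \<and> p = 0 \<or> prev_time \<tau> i = ennreal p" using p(3) by blast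
        show "ennreal s < \<tau> i" using that p(1) unfolding t by (simp add: ennreal_less_iff)
      qed
    qed (use True in auto)
  next
    case False
    then show ?thesis using p by auto
  qed
  show "z t \<le> - real i * \<xi>"
  proof (rule ccontr)
    assume "\<not> z t \<le> - real i * \<xi>"
    then have gt: "- real i * \<xi> < z t" by simp
    have t0: "0 \<le> t" using p by simp
    from cont[unfolded continuous_on_iff, rule_format, of t "z t + real i * \<xi>"] gt t0
    obtain d where d: "0 < d" "\<And>s. 0 \<le> s \<Longrightarrow> \<bar>s - t\<bar> < d \<Longrightarrow> \<bar>z s - z t\<bar> < z t + real i * \<xi>"
      by (auto simp: dist_real_def)
    have "\<tau> i < \<tau> (Suc i)" using strict[of i] t by simp
    then obtain q where q: "ennreal t < q" "q < \<tau> (Suc i)" using dense unfolding t by blast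
    \<comment> \<open>The radius \<open>d\<close> keeps \<open>z\<close> above
      \<open>- real i * \<xi>\<close>, and \<open>e\<close> keeps the candidate times below
      \<open>\<tau> (Suc i)\<close>, so that after \<open>t\<close> exactly \<open>Suc i\<close>
      injections count and the surplus before injection is positive.\<close>
    define e where "e = enn2real q - t"
    have "q < \<top>" using q(2) by (rule less_le_trans) simp
    then have qe: "q = ennreal (t + e)" by (simp add: e_def)
    have e: "0 < e" using q(1) t0 unfolding qe by (simp add: ennreal_less_iff)
    have "ennreal (t + min d e) \<le> \<tau> i"
      unfolding ruin_eq[of i]
    proof (rule Inf_greatest, clarsimp simp only: mem_Collect_eq)
      fix s assume s: "0 \<le> s" "i = 0 \<or> prev_time \<tau> i < ennreal s" "before_injection z \<xi> s = 0"
      have "\<tau> i \<le> ennreal s"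
        using s by (subst ruin_eq) (intro Inf_lower, blast)
      then have ts: "t \<le> s" using s(1) t by simp
      show "ennreal (t + min d e) \<le> ennreal s"
      proof (rule ccontr)
        assume "\<not> ennreal (t + min d e) \<le> ennreal s"
        then have "\<not> t + min d e \<le> s" using ennreal_leI by blast
        then have sd: "s < t + d" "s < t + e" by auto
        have zs: "- real i * \<xi> < z s" using d(2)[OF s(1)] ts sd by auto
        show False
        proof (cases "s = t")
          case True
          then show False using before_injection_eq[OF s(2), of z \<xi>] s(3) t gt by simp
        next
          case False
          have "ennreal s \<le> \<tau> (Suc i)"
            using q(2) sd(2) unfolding qe by (meson ennreal_leI less_imp_le order_trans)
          moreover have "\<tau> i < ennreal s" using False ts t t0 by (simp add: ennreal_less_iff)
          ultimately show False
            using before_injection_eq[of "Suc i" s z \<xi>] s(3) zs \<xi> by (simp add: algebra_simps)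
        qed
      qed
    qed
    then show False unfolding t using d(1) e t0 by (simp add: ennreal_le_iff2)
  qed
qed

text \<open>The period after injection \<open>i\<close> starts at height
  \<open>- real i * \<xi>\<close>, strictly above the next level, so the two preceding lemmas apply
  with \<open>p\<close> the time of injection \<open>i\<close>.\<close>

lemma levels:
  "(\<forall>t\<ge>0. ennreal t < \<tau> i \<longrightarrow> - real i * \<xi> < z t) \<and> (\<forall>t\<ge>0. \<tau> i = ennreal t \<longrightarrow> z t = - real i * \<xi>)"
proof (induction i)
  case 0
  show ?case
  proof (intro conjI allI impI)
    show "- real 0 * \<xi> < z t" if "0 \<le> t" "ennreal t < \<tau> 0" for t
      by (rule level_aux[of 0]) (use z0 that in simp_all)
    show "z t = - real 0 * \<xi>" if "0 \<le> t" "\<tau> 0 = ennreal t" for t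
      by (rule hits_level[of 0]) (use z0 that in simp_all)
  qed
next
  case (Suc i)
  show ?case
  proof (cases "\<tau> i")
    case (real p)
    have zp: "z p = - real i * \<xi>" using Suc real by blast
    have le: "- real (Suc i) * \<xi> < - real i * \<xi>" using \<xi> by (simp add: algebra_simps)
    show ?thesis
    proof (intro conjI allI impI)
      fix t :: real assume t: "0 \<le> t" "ennreal t < \<tau> (Suc i)"
      show "- real (Suc i) * \<xi> < z t"
      proof (cases "t < p")
        case True
        then have "ennreal t < \<tau> i" using t(1) real by (simp add: ennreal_less_iff)
        with Suc t(1) have "- real i * \<xi> < z t" by blast
        then show ?thesis using le by (rule order_less_trans[rotated])
      next
        case False
        then have "p \<le> t" by simp
        show ?thesis
          by (rule level_aux[OF real(1) \<open>p \<le> t\<close> _ _ _ t(2)]) (use real zp le in simp_all)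
      qed
    next
      fix t :: real assume t: "0 \<le> t" "\<tau> (Suc i) = ennreal t"
      have "p < t" using strict[of i] real t by (simp add: ennreal_less_iff)
      then show "z t = - real (Suc i) * \<xi>"
        by (intro hits_level[OF real(1) _ _ _ _ t(2)]) (use real zp le in simp_all)
    qed
  next
    case top
    have "\<tau> (Suc i) = \<top>" using local.le[of i] unfolding top by (simp add: top_unique)
    moreover have "- real (Suc i) * \<xi> < z t" if "0 \<le> t" for t
    proof -
      have "ennreal t < \<tau> i" using top by simp
      with Suc that have "- real i * \<xi> < z t" by blast
      moreover have "- real (Suc i) * \<xi> < - real i * \<xi>" using \<xi> by (simp add: algebra_simps)
      ultimately show "- real (Suc i) * \<xi> < z t" by (rule order_less_trans[rotated])
    qed
    ultimately show ?thesis by auto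
  qed
qed

text \<open>Infinitely many injections up to \<open>t\<close> would force the continuous
  \<open>z\<close> through arbitrarily low levels on a compact interval.\<close>

lemma eventually_after:
  assumes "0 \<le> t" obtains i where "ennreal t < \<tau> i"
proof (rule ccontr)
  assume "\<not> thesis"
  then have le_t: "\<tau> i \<le> ennreal t" for i using that not_less by blast
  have "compact (z ` {0..t})"
    by (intro compact_continuous_image continuous_on_subset[OF cont]) auto
  from compact_imp_bounded[OF this] obtain b where "\<forall>y\<in>z ` {0..t}. norm y \<le> b"
    unfolding bounded_iff by blast
  then have b: "\<bar>z s\<bar> \<le> b" if "s \<in> {0..t}" for s
    using that by simp
  obtain n :: nat where n: "b < real n * \<xi>"
    using reals_Archimedean3[OF \<xi>] by blast
  show False
  proof (cases "\<tau> n")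
    case (real p)
    then have "p \<in> {0..t}" using le_t[of n] assms by simp
    moreover have "z p = - real n * \<xi>" using levels[of n] real by simp
    ultimately show False using b[of p] n by simp
  next
    case top
    then show False using le_t[of n] by (simp add: top_unique)
  qed
qed

lemma surplus_nonneg:
  assumes t: "0 \<le> t" shows "0 \<le> z t + (\<Sum>i | \<tau> i \<le> ennreal t. \<xi>)"
proof -
  \<comment> \<open>\<open>i\<close> is the number of injections up to \<open>t\<close>.\<close>
  define i where "i = (LEAST i. ennreal t < \<tau> i)"
  obtain j where "ennreal t < \<tau> j" by (rule eventually_after[OF t])
  then have i: "ennreal t < \<tau> i" unfolding i_def by (rule LeastI)
  have "prev_time \<tau> i \<le> ennreal t"
  proof (cases i)
    case (Suc k)
    then have "\<not> ennreal t < \<tau> k" unfolding i_def by (intro not_less_Least) simp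
    then show ?thesis using Suc by simp
  qed simp
  then have "{j. \<tau> j \<le> ennreal t} = {..<i}" by (rule injected_between[OF _ i])
  moreover have "- real i * \<xi> < z t" using levels[of i] t i by blast
  ultimately show ?thesis by simp
qed

end

section \<open>Hitting times of levels by a continuous path\<close>

definition hitting_time :: "(real \<Rightarrow> real) \<Rightarrow> real \<Rightarrow> ennreal"
  where "hitting_time z l = Inf {ennreal t | t. 0 \<le> t \<and> z t = l}"

lemma hitting_time_attained:
  assumes cont: "continuous_on {0..} z" and fin: "hitting_time z l < \<infinity>"
  obtains t where "0 \<le> t" "hitting_time z l = ennreal t" "z t = l"
proof -
  define S where "S = {t \<in> {0..}. z t = l}"
  have cl: "closed S" unfolding S_def
    using continuous_closed_preimage_constant[OF cont, of l] by simp
  have ne: "S \<noteq> {}"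
  proof
    assume "S = {}"
    then have "{ennreal t | t. 0 \<le> t \<and> z t = l} = {}" by (auto simp: S_def)
    then have "hitting_time z l = \<top>" unfolding hitting_time_def by (simp only: Inf_empty)
    then show False using fin by simp
  qed
  have bdd: "bdd_below S" by (rule bdd_belowI[of _ 0]) (auto simp: S_def)
  have "Inf S \<in> S" by (rule closed_contains_Inf[OF ne bdd cl])
  then have I: "0 \<le> Inf S" "z (Inf S) = l" by (auto simp: S_def)
  have "hitting_time z l = ennreal (Inf S)"
  proof (rule antisym)
    show "hitting_time z l \<le> ennreal (Inf S)"
      unfolding hitting_time_def using I by (intro Inf_lower) auto
    show "ennreal (Inf S) \<le> hitting_time z l"
      unfolding hitting_time_def
      by (rule Inf_greatest) (auto intro!: ennreal_leI cInf_lower bdd simp: S_def)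
  qed
  then show thesis using I that by blast
qed

lemma hitting_time_le: "0 \<le> t \<Longrightarrow> z t = l \<Longrightarrow> hitting_time z l \<le> ennreal t"
  unfolding hitting_time_def by (intro Inf_lower) auto

lemma hitting_time_le_below:
  assumes cont: "continuous_on {0..} z" and "l \<le> z 0" "0 \<le> t" "z t \<le> l"
  shows "hitting_time z l \<le> ennreal t"
proof -
  have "\<exists>s\<ge>0. s \<le> t \<and> z s = l"
    using assms by (intro IVT2' continuous_on_subset[OF cont]) auto
  then obtain s where s: "0 \<le> s" "s \<le> t" "z s = l" by auto
  have "hitting_time z l \<le> ennreal s" using hitting_time_le[of s z l] s by simp
  also have "\<dots> \<le> ennreal t" using s(2) by (rule ennreal_leI)
  finally show ?thesis .
qed

text \<open>The right side says that the minimum of \<open>z\<close> on the compact interval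
  \<open>{0..s}\<close> is at most \<open>l\<close>, in terms of countably many values up to time
  \<open>s\<close>. So a hitting time is a stopping time even for a filtration that is not
  right-continuous.\<close>

lemma hitting_time_le_iff:
  assumes cont: "continuous_on {0..} z" and l: "l \<le> z 0" and s: "0 \<le> s"
  shows "hitting_time z l \<le> ennreal s \<longleftrightarrow> (\<forall>n. \<exists>q\<in>\<rat> \<inter> {0..s}. z q < l + 1 / real (Suc n))"
proof
  assume "hitting_time z l \<le> ennreal s"
  then obtain t where t: "0 \<le> t" "hitting_time z l = ennreal t" "z t = l" "t \<le> s"
    using s by (metis ennreal_le_iff ennreal_less_top hitting_time_attained[OF cont] infinity_ennreal_def le_less_trans)
  show "\<forall>n. \<exists>q\<in>\<rat> \<inter> {0..s}. z q < l + 1 / real (Suc n)"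
  proof
    fix n
    show "\<exists>q\<in>\<rat> \<inter> {0..s}. z q < l + 1 / real (Suc n)"
    proof (cases "s = 0")
      \<comment> \<open>For \<open>s = 0\<close> the interval has no interior; the point 0 itself is
        the rational required.\<close>
      case True
      then show ?thesis using t by (intro bexI[of _ 0]) auto
    next
      case False
      then have s0: "0 < s" using s by simp
      from cont[unfolded continuous_on_iff, rule_format, of t "1 / real (Suc n)"] t(1)
      obtain d where d: "0 < d" "\<And>q. 0 \<le> q \<Longrightarrow> \<bar>q - t\<bar> < d \<Longrightarrow> \<bar>z q - z t\<bar> < 1 / real (Suc n)"
        by (auto simp: dist_real_def)
      have "max 0 (t - d) < min s (t + d)" using t d(1) s0 by auto
      then obtain q where q: "q \<in> \<rat>" "max 0 (t - d) < q" "q < min s (t + d)"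
        using Rats_dense_in_real by blast
      have "\<bar>z q - z t\<bar> < 1 / real (Suc n)" using q by (intro d(2)) auto
      then have "z q < l + 1 / real (Suc n)" using t(3) by linarith
      then show ?thesis using q by (intro bexI[of _ q]) auto
    qed
  qed
next
  assume *: "\<forall>n. \<exists>q\<in>\<rat> \<inter> {0..s}. z q < l + 1 / real (Suc n)"
  have "continuous_on {0..s} z" by (rule continuous_on_subset[OF cont]) auto
  then obtain t where t: "t \<in> {0..s}" "\<And>y. y \<in> {0..s} \<Longrightarrow> z t \<le> z y"
    using continuous_attains_inf[of "{0..s}" z] s by auto
  have "z t \<le> l"
  proof (rule ccontr)
    assume "\<not> z t \<le> l"
    then obtain n where n: "inverse (real (Suc n)) < z t - l" using reals_Archimedean[of "z t - l"] by auto
    from * obtain q where "q \<in> {0..s}" "z q < l + 1 / real (Suc n)" by blast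
    with t(2)[of q] n show False by (simp add: inverse_eq_divide)
  qed
  then have "hitting_time z l \<le> ennreal t" using t(1) by (intro hitting_time_le_below cont l) auto
  also have "\<dots> \<le> ennreal s" using t(1) by (intro ennreal_leI) simp
  finally show "hitting_time z l \<le> ennreal s" .
qed

lemma hitting_times_injection_path:
  assumes cont: "continuous_on {0..} z" and z0: "0 \<le> z 0" and \<xi>: "0 < \<xi>"
  shows "injection_path (\<lambda>i. hitting_time z (- real i * \<xi>))"
proof -
  let ?H = "\<lambda>i. hitting_time z (- real i * \<xi>)"
  have lt: "?H i < ?H (Suc i)" if fin: "?H i < \<infinity>" for i
  proof (cases "?H (Suc i) < \<infinity>")
    case True
    from hitting_time_attained[OF cont True] obtain t
      where t: "0 \<le> t" "?H (Suc i) = ennreal t" "z t = - real (Suc i) * \<xi>" by blast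
    have "0 \<le> real i * \<xi>" using \<xi> by simp
    then have "- real i * \<xi> \<le> z 0" using z0 by simp
    then have "?H i \<le> ennreal t"
      using t \<xi> by (intro hitting_time_le_below cont) (auto simp: algebra_simps)
    moreover have "?H i \<noteq> ennreal t"
    proof
      assume "?H i = ennreal t"
      moreover from hitting_time_attained[OF cont fin] obtain s
        where "0 \<le> s" "?H i = ennreal s" "z s = - real i * \<xi>" by blast
      ultimately have "z t = - real i * \<xi>" using t(1) by simp
      then show False using t(3) \<xi> by (simp add: algebra_simps)
    qed
    ultimately show ?thesis unfolding t(2) by simp
  next
    case False
    then show ?thesis using fin by (simp add: not_less top_unique)
  qed
  have finite_prev: "?H i < \<infinity>" if fin: "?H (Suc i) < \<infinity>" for i
  proof -
    from hitting_time_attained[OF cont fin] obtain t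
      where t: "0 \<le> t" "z t = - real (Suc i) * \<xi>" by blast
    have "0 \<le> real i * \<xi>" using \<xi> by simp
    then have "- real i * \<xi> \<le> z 0" using z0 by simp
    then have "?H i \<le> ennreal t"
      using t \<xi> by (intro hitting_time_le_below cont) (auto simp: algebra_simps)
    then show ?thesis by (rule le_less_trans) simp
  qed
  show ?thesis
  proof
    show "?H i \<le> ?H (Suc i)" for i
      using lt[of i] finite_prev[of i] by (cases "?H (Suc i) < \<infinity>") (auto simp: not_less top_unique intro: less_imp_le)
    show "?H i < \<infinity> \<Longrightarrow> ?H i < ?H (Suc i)" for i by (rule lt)
  qed
qed

text \<open>A converse to \<open>levels\<close>: the hitting times of
  \<open>- real i * \<xi>\<close> solve the circular equations for ruin times. This provides the
  existence of the policy.\<close>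

lemma hitting_times_ruin:
  assumes cont: "continuous_on {0..} z" and z0: "0 \<le> z 0" and \<xi>: "0 < \<xi>"
  defines "H \<equiv> \<lambda>i. hitting_time z (- real i * \<xi>)"
  shows "H i = Inf {ennreal t | t. 0 \<le> t \<and> (i = 0 \<or> prev_time H i < ennreal t) \<and> injection_path.before_injection H z \<xi> t = 0}"
proof -
  interpret injection_path H unfolding H_def by (rule hitting_times_injection_path[OF cont z0 \<xi>])
  show ?thesis
  proof (rule antisym)
    show "H i \<le> Inf {ennreal t | t. 0 \<le> t \<and> (i = 0 \<or> prev_time H i < ennreal t) \<and> before_injection z \<xi> t = 0}"
    proof (rule Inf_greatest, clarsimp simp only: mem_Collect_eq)
      fix t assume t: "0 \<le> t" "i = 0 \<or> prev_time H i < ennreal t" "before_injection z \<xi> t = 0"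
      show "H i \<le> ennreal t"
      proof (rule ccontr)
        assume n: "\<not> H i \<le> ennreal t"
        then have "ennreal t \<le> H i" by simp
        from before_injection_eq[OF t(2) this, of z \<xi>] have "z t = - real i * \<xi>" using t(3) by simp
        then have "H i \<le> ennreal t" unfolding H_def by (rule hitting_time_le[OF t(1)])
        with n show False by simp
      qed
    qed
    show "Inf {ennreal t | t. 0 \<le> t \<and> (i = 0 \<or> prev_time H i < ennreal t) \<and> before_injection z \<xi> t = 0} \<le> H i"
    proof (cases "H i < \<infinity>")
      case True
      from hitting_time_attained[OF cont True[unfolded H_def]] obtain t
        where t: "0 \<le> t" "H i = ennreal t" "z t = - real i * \<xi>" unfolding H_def by blast
      have pr: "i = 0 \<or> prev_time H i < ennreal t"
      proof (cases i)
        case (Suc j)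
        then have "H j \<le> ennreal t" using le[of j] t(2) by simp
        then have "H j < \<infinity>" by (rule le_less_trans) simp
        from strict[OF this] show ?thesis using Suc t(2) by simp
      qed simp
      have "before_injection z \<xi> t = 0"
        using before_injection_eq[OF pr, of z \<xi>] t by simp
      then show ?thesis unfolding t(2) using pr t(1) by (intro Inf_lower) blast
    next
      case False
      then show ?thesis by (simp add: not_less top_unique)
    qed
  qed
qed

section \<open>The policy of injecting at ruin\<close>

context brownian_motion
begin

lemma stopping_time_hitting_time:
  assumes cont: "\<And>\<omega>. \<omega> \<in> space M \<Longrightarrow> continuous_on {0..} (\<lambda>t. z t \<omega>)"
    and z0: "\<And>\<omega>. \<omega> \<in> space M \<Longrightarrow> l \<le> z 0 \<omega>"
    and meas: "\<And>q s. 0 \<le> q \<Longrightarrow> q \<le> s \<Longrightarrow> z q \<in> borel_measurable (F (ennreal s))"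
  shows "stopping_time F (\<lambda>\<omega>. hitting_time (\<lambda>t. z t \<omega>) l)"
proof (rule stopping_timeI)
  fix t
  show "Measurable.pred (F t) (\<lambda>\<omega>. hitting_time (\<lambda>t. z t \<omega>) l \<le> t)"
  proof (cases t)
    case (real s)
    have "Measurable.pred (F t) (\<lambda>\<omega>. \<forall>n. \<exists>q\<in>\<rat> \<inter> {0..s}. z q \<omega> < l + 1 / real (Suc n))"
    proof (rule pred_intros_countable(1), rule measurable_pred_countable(2))
      show "countable (\<rat> \<inter> {0..s})" by (intro countable_Int1 countable_rat)
      show "Measurable.pred (F t) (\<lambda>\<omega>. z q \<omega> < l + 1 / real (Suc n))" if "q \<in> \<rat> \<inter> {0..s}" for n q
      proof -
        have "z q \<in> borel_measurable (F t)" unfolding real(2) using that by (intro meas) auto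
        then show ?thesis
          unfolding pred_def by (intro borel_measurable_less measurable_const) simp_all
      qed
    qed
    also have "?this \<longleftrightarrow> Measurable.pred (F t) (\<lambda>\<omega>. hitting_time (\<lambda>t. z t \<omega>) l \<le> t)"
      unfolding real(2) using hitting_time_le_iff[OF cont z0 real(1)]
      by (intro measurable_cong) (simp add: space_F)
    finally show ?thesis .
  qed simp
qed

lemma ito_integral_const:
  "ito_integral_process M F w (\<lambda>s \<omega>. a) (\<lambda>t \<omega>. a * (w t \<omega> - w 0 \<omega>))"
  unfolding ito_integral_process_def
proof (intro conjI ballI allI impI)
  show "continuous_on {0..} (\<lambda>t. a * (w t \<omega> - w 0 \<omega>))" if "\<omega> \<in> space M" for \<omega>
    by (intro continuous_intros continuous_paths that)
  fix T :: real assume T: "0 \<le> T"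
  show "(\<lambda>\<omega>. a * (w T \<omega> - w 0 \<omega>)) \<in> borel_measurable M"
    using T by (intro borel_measurable_times borel_measurable_diff w_measurable) auto
  show "\<exists>n t \<phi>. (\<forall>k::nat. elementary M F (n k) (t k) (\<phi> k)) \<and>
        (\<lambda>k. \<E> \<omega>. (\<integral>\<^sup>+s\<in>{0<..T}.
            ennreal ((elementary_process (n k) (t k) (\<phi> k) s \<omega> - a)\<^sup>2) \<partial>lborel)) \<longlonglongrightarrow> 0 \<and>
        (\<lambda>k. \<E> \<omega>. ennreal ((elementary_integral w (n k) (t k) (\<phi> k) T \<omega> - a * (w T \<omega> - w 0 \<omega>))\<^sup>2))
          \<longlonglongrightarrow> 0"
  proof (intro exI conjI allI)
    \<comment> \<open>A single cell suffices. It ends at \<open>T + 1\<close> because the grid must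
      increase strictly even for \<open>T = 0\<close>.\<close>
    let ?t = "\<lambda>i::nat. real i * (T + 1)" and ?\<phi> = "\<lambda>(i::nat) (\<omega>::'a). a"
    show "elementary M F 1 ?t ?\<phi>"
      using T by (auto simp: elementary_def)
    have zero: "ennreal ((elementary_process 1 ?t ?\<phi> s \<omega> - a)\<^sup>2) * indicator {0<..T} s = 0" for s \<omega>
      by (auto simp: elementary_process_def indicator_def)
    show "(\<lambda>k::nat. \<E> \<omega>. (\<integral>\<^sup>+s\<in>{0<..T}. ennreal ((elementary_process 1 ?t ?\<phi> s \<omega> - a)\<^sup>2) \<partial>lborel)) \<longlonglongrightarrow> 0"
      unfolding zero by simp
    show "(\<lambda>k::nat. \<E> \<omega>. ennreal ((elementary_integral w 1 ?t ?\<phi> T \<omega> - a * (w T \<omega> - w 0 \<omega>))\<^sup>2)) \<longlonglongrightarrow> 0"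
      using T by (simp add: elementary_integral_def)
  qed
qed

text \<open>The Ito integral in a surplus process is an arbitrary version;
  \<open>ito_integral_limit\<close> identifies it with the explicit one. The integrand is prescribed
  at positive times only, as in \<open>constant_controls\<close>.\<close>

lemma ito_integral_const_unique:
  assumes Y: "ito_integral_process M F w h Y" and T: "0 \<le> T"
    and h: "\<And>s \<omega>. 0 < s \<Longrightarrow> \<omega> \<in> space M \<Longrightarrow> h s \<omega> = a"
  shows "AE \<omega> in M. Y T \<omega> = a * (w T \<omega> - w 0 \<omega>)"
proof -
  let ?t = "\<lambda>i::nat. real i * (T + 1)" and ?\<phi> = "\<lambda>(i::nat) (\<omega>::'a). a"
  have Ym [measurable]: "Y T \<in> borel_measurable M"
    by (rule ito_integral_process_measurable[OF Y T])
  have [measurable]: "w T \<in> borel_measurable M" "w 0 \<in> borel_measurable M" using T by auto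
  have "(\<lambda>(\<omega>, s). a * indicator {0<..T} s) \<in> borel_measurable (M \<Otimes>\<^sub>M lborel)" by simp
  also have "?this \<longleftrightarrow> (\<lambda>(\<omega>, s). h s \<omega> * indicator {0<..T} s) \<in> borel_measurable (M \<Otimes>\<^sub>M lborel)"
    using h by (intro measurable_cong) (auto simp: space_pair_measure indicator_def)
  finally have hm: "(\<lambda>(\<omega>, s). h s \<omega> * indicator {0<..T} s) \<in> borel_measurable (M \<Otimes>\<^sub>M lborel)" .
  have "(\<lambda>k::nat. \<E> \<omega>. ennreal ((elementary_integral w 1 ?t ?\<phi> T \<omega> - Y T \<omega>)\<^sup>2)) \<longlonglongrightarrow> 0"
  proof (rule ito_integral_limit[OF Y T hm])
    show "elementary M F 1 ?t ?\<phi>" for k :: nat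
      using T by (auto simp: elementary_def)
    have zero: "ennreal ((elementary_process 1 ?t ?\<phi> s \<omega> - h s \<omega>)\<^sup>2) * indicator {0<..T} s = 0" if "\<omega> \<in> space M" for s \<omega>
      using h[OF _ that] by (auto simp: elementary_process_def indicator_def)
    have "(\<integral>\<^sup>+s\<in>{0<..T}. ennreal ((elementary_process 1 ?t ?\<phi> s \<omega> - h s \<omega>)\<^sup>2) \<partial>lborel) = 0" if "\<omega> \<in> space M" for \<omega>
      unfolding zero[OF that] by simp
    then have "(\<E> \<omega>. (\<integral>\<^sup>+s\<in>{0<..T}. ennreal ((elementary_process 1 ?t ?\<phi> s \<omega> - h s \<omega>)\<^sup>2) \<partial>lborel)) = (\<E> \<omega>. 0)"
      by (intro nn_integral_cong)
    then show "(\<lambda>k::nat. \<E> \<omega>. (\<integral>\<^sup>+s\<in>{0<..T}. ennreal ((elementary_process 1 ?t ?\<phi> s \<omega> - h s \<omega>)\<^sup>2) \<partial>lborel)) \<longlonglongrightarrow> 0"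
      by simp
  qed
  then have "(\<lambda>k::nat. \<E> \<omega>. ennreal ((a * (w T \<omega> - w 0 \<omega>) - Y T \<omega>)\<^sup>2)) \<longlonglongrightarrow> 0"
    using T by (simp add: elementary_integral_def)
  then have "(\<E> \<omega>. ennreal ((a * (w T \<omega> - w 0 \<omega>) - Y T \<omega>)\<^sup>2)) = 0"
    by (simp add: LIMSEQ_const_iff)
  then have "AE \<omega> in M. ennreal ((a * (w T \<omega> - w 0 \<omega>) - Y T \<omega>)\<^sup>2) = 0"
    by (subst (asm) nn_integral_0_iff_AE) auto
  then show ?thesis by eventually_elim simp
qed

lemma set_integral_const: "0 \<le> t \<Longrightarrow> (LINT s:{0<..t}|lborel. (a::real)) = a * t"
  unfolding set_lebesgue_integral_def by (simp add: measure_def)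

text \<open>Almost every path of a policy of the prescribed form fits \<open>ruin_path\<close>, so
  the description by levels holds for every such policy and not only for the one constructed
  below.\<close>

lemma ruin_policy_path:
  assumes \<pi>: "control_policy M F \<pi>" and x: "0 \<le> x" and \<xi>: "0 < \<xi>"
    and const: "constant_controls M u \<xi> \<pi>"
    and Y: "ito_integral_process M F w (\<lambda>s \<omega>. \<sigma> * retention \<pi> x s \<omega>) Y"
    and X: "\<And>t \<omega>. 0 \<le> t \<Longrightarrow> \<omega> \<in> space M \<Longrightarrow> X t \<omega> =
        x + (LINT s:{0<..t}|lborel. \<mu> * retention \<pi> x s \<omega> - \<delta>) + Y t \<omega>
          + (\<Sum>i | inj_time \<pi> x i \<omega> \<le> ennreal t. inj_size \<pi> x i \<omega>)"
    and ruin: "AE \<omega> in M. \<forall>i. inj_time \<pi> x i \<omega> = ruin_time \<pi> x X i \<omega>"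
  shows "AE \<omega> in M. ruin_path (\<lambda>i. inj_time \<pi> x i \<omega>) (\<lambda>t. x + (\<mu> * u - \<delta>) * t + Y t \<omega>) \<xi> \<and>
    (\<forall>t\<ge>0. X t \<omega> = x + (\<mu> * u - \<delta>) * t + Y t \<omega> + (\<Sum>i | inj_time \<pi> x i \<omega> \<le> ennreal t. \<xi>))"
  using ruin ito_integral_initial[OF Y] AE_space
proof eventually_elim
  case (elim \<omega>)
  then have \<omega>: "\<omega> \<in> space M" by simp
  let ?z = "\<lambda>t. x + (\<mu> * u - \<delta>) * t + Y t \<omega>"
  have ret: "retention \<pi> x s \<omega> = u" if "0 < s" for s
    using const x \<omega> that unfolding constant_controls_def by blast
  have size: "inj_size \<pi> x i \<omega> = \<xi>" for i
    using const x \<omega> unfolding constant_controls_def by blast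
  have drift: "(LINT s:{0<..t}|lborel. \<mu> * retention \<pi> x s \<omega> - \<delta>) = (\<mu> * u - \<delta>) * t" if "0 \<le> t" for t
  proof -
    have "(LINT s:{0<..t}|lborel. \<mu> * retention \<pi> x s \<omega> - \<delta>) = (LINT s:{0<..t}|lborel. \<mu> * u - \<delta>)"
      by (intro set_lebesgue_integral_cong) (auto simp: ret)
    then show ?thesis using set_integral_const[OF that] by simp
  qed
  have Xt: "X t \<omega> = ?z t + (\<Sum>i | inj_time \<pi> x i \<omega> \<le> ennreal t. \<xi>)" if "0 \<le> t" for t
    using X[OF that \<omega>] drift[OF that] by (simp add: size)
  have inj: "injection_path (\<lambda>i. inj_time \<pi> x i \<omega>)"
    using \<pi> x \<omega> unfolding control_policy_def by (intro injection_path.intro) blast+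
  have before: "surplus_before \<pi> x X t \<omega> = injection_path.before_injection (\<lambda>i. inj_time \<pi> x i \<omega>) ?z \<xi> t" if "0 \<le> t" for t
    unfolding surplus_before_def injection_path.before_injection_def[OF inj] Xt[OF that] size ..
  have "ruin_path (\<lambda>i. inj_time \<pi> x i \<omega>) ?z \<xi>"
  proof (intro ruin_path.intro inj ruin_path_axioms.intro)
    have "continuous_on {0..} (\<lambda>t. Y t \<omega>)"
      using Y \<omega> unfolding ito_integral_process_def by blast
    then show "continuous_on {0..} ?z" by (intro continuous_intros)
    show "0 \<le> ?z 0" using x elim(2) by simp
    have eq: "{ennreal t | t. 0 \<le> t \<and> surplus_before \<pi> x X t \<omega> = 0}
      = {ennreal t | t. 0 \<le> t \<and> injection_path.before_injection (\<lambda>i. inj_time \<pi> x i \<omega>) ?z \<xi> t = 0}"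
      using before by (intro Collect_cong ex_cong1) auto
    show "inj_time \<pi> x 0 \<omega> = Inf {ennreal t | t. 0 \<le> t \<and> injection_path.before_injection (\<lambda>i. inj_time \<pi> x i \<omega>) ?z \<xi> t = 0}"
      using elim(1)[rule_format, of 0] unfolding ruin_time.simps eq .
    fix i
    have eq: "{ennreal t | t. 0 \<le> t \<and> inj_time \<pi> x i \<omega> < ennreal t \<and> surplus_before \<pi> x X t \<omega> = 0}
      = {ennreal t | t. 0 \<le> t \<and> inj_time \<pi> x i \<omega> < ennreal t \<and> injection_path.before_injection (\<lambda>i. inj_time \<pi> x i \<omega>) ?z \<xi> t = 0}"
      using before by (intro Collect_cong ex_cong1) auto
    show "inj_time \<pi> x (Suc i) \<omega> = Inf {ennreal t | t. 0 \<le> t \<and> inj_time \<pi> x i \<omega> < ennreal t \<and>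
        injection_path.before_injection (\<lambda>i. inj_time \<pi> x i \<omega>) ?z \<xi> t = 0}"
      using elim(1)[rule_format, of "Suc i"] unfolding ruin_time.simps eq .
  qed (rule \<xi>)
  then show ?case using Xt by blast
qed

text \<open>
  Comparing \<open>\<tau>\<close> with the horizon \<open>T\<close> instead of time \<open>0\<close>, the submartingale inequality alone bounds the
  mean of the process at \<open>\<tau>\<close> on \<open>\<tau> \<le> T\<close> by its mean at \<open>T\<close>, which is \<open>1\<close>.
\<close>

lemma discounted_hitting_time_le:
  fixes \<tau> :: "'a \<Rightarrow> ennreal"
  assumes Y: "ito_integral_process M F w h Y" and h: "\<And>s \<omega>. 0 < s \<Longrightarrow> \<omega> \<in> space M \<Longrightarrow> h s \<omega> = a"
    and pos: "0 < \<beta>" "0 \<le> \<kappa>" "\<beta> * a = \<kappa>" and hjb: "\<kappa>\<^sup>2 / 2 = \<beta> * \<delta> - r" and m: "\<kappa> * a = m"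
    and \<tau>: "stopping_time F \<tau>"
    and level: "AE \<omega> in M. \<forall>t\<ge>0. \<tau> \<omega> = ennreal t \<longrightarrow> x + (m - \<delta>) * t + Y t \<omega> = - l"
  shows "(\<E> \<omega>. (if \<tau> \<omega> < \<infinity> then ennreal (exp (- r * enn2real (\<tau> \<omega>))) else 0)) \<le> ennreal (exp (- \<beta> * (x + l)))"
proof -
  have a0: "0 \<le> a" using pos by (metis less_eq_real_def mult_less_cancel_left_pos mult_zero_right not_le)
  have hm: "(\<lambda>(\<omega>, s). h s \<omega> * indicator {0<..} s) \<in> borel_measurable (M \<Otimes>\<^sub>M lborel)"
  proof -
    have "(\<lambda>p. if (0::real) < snd p then a else 0) \<in> borel_measurable (M \<Otimes>\<^sub>M lborel)" by measurable
    also have "?this \<longleftrightarrow> ?thesis"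
      using h by (intro measurable_cong) (auto simp: space_pair_measure indicator_def)
    finally show ?thesis .
  qed
  have [measurable]: "\<tau> \<in> borel_measurable M" by (rule stopping_time_measurable[OF \<tau>])
  have inth: "(LINT s:{0<..t}|lborel. h s \<omega>) = a * t" if "\<omega> \<in> space M" "0 \<le> t" for t \<omega>
  proof -
    have "(LINT s:{0<..t}|lborel. h s \<omega>) = (LINT s:{0<..t}|lborel. a)"
      using h that(1) by (intro set_lebesgue_integral_cong) auto
    then show ?thesis using set_integral_const[OF that(2)] by simp
  qed
  have finite_horizon: "(\<E> \<omega>. (if \<tau> \<omega> \<le> ennreal T then ennreal (exp (- r * enn2real (\<tau> \<omega>))) else 0))
      \<le> ennreal (exp (- \<beta> * (x + l)))" if T: "0 < T" for T
  proof -
    define D where "D = discounted_exp \<beta> \<kappa> h Y"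
    interpret D: continuous_submartingale M F w D T
      unfolding D_def using pos a0 T by (intro discounted_exp_continuous_submartingale[where m = a, OF Y _ _ hm]) (auto simp: h)
    have YT: "AE \<omega> in M. Y T \<omega> = a * (w T \<omega> - w 0 \<omega>)"
      by (rule ito_integral_const_unique[OF Y less_imp_le[OF T]]) (rule h)
    \<comment> \<open>Since \<open>\<beta> * a = \<kappa>\<close>, the process is the exponential
      martingale of \<open>- \<kappa>\<close> times the Brownian motion.\<close>
    have mean: "(\<E> \<omega>. ennreal (D T \<omega>)) = 1"
    proof -
      have "(\<E> \<omega>. ennreal (D T \<omega>))
        = (\<E> \<omega>. ennreal (exp (- (\<kappa>\<^sup>2 / 2 * T))) * ennreal (exp (- \<kappa> * (w T \<omega> - w 0 \<omega>))))"
      proof (rule nn_integral_cong_AE)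
        show "AE \<omega> in M. ennreal (D T \<omega>) = ennreal (exp (- (\<kappa>\<^sup>2 / 2 * T))) * ennreal (exp (- \<kappa> * (w T \<omega> - w 0 \<omega>)))"
          using YT AE_space
        proof eventually_elim
          case (elim \<omega>)
          have "\<beta> * (a * (w T \<omega> - w 0 \<omega>) + \<kappa> * (a * T)) = \<kappa> * (w T \<omega> - w 0 \<omega>) + \<kappa>\<^sup>2 * T"
            unfolding pos(3)[symmetric] by (simp add: algebra_simps power2_eq_square)
          then have "\<kappa>\<^sup>2 / 2 * T - \<beta> * (Y T \<omega> + \<kappa> * (LINT s:{0<..T}|lborel. h s \<omega>))
            = - (\<kappa>\<^sup>2 / 2 * T) + - \<kappa> * (w T \<omega> - w 0 \<omega>)"
            unfolding elim(1) inth[OF elim(2) less_imp_le[OF T]] by simp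
          then show ?case
            unfolding D_def discounted_exp_def by (simp only: exp_add ennreal_mult' exp_ge_zero)
        qed
      qed
      also have "\<dots> = (\<E> \<omega>. ennreal (exp (- (\<kappa>\<^sup>2 / 2 * T))) * ennreal (exp ((- \<kappa>)\<^sup>2 * (T - 0) / 2)))"
        using T by (intro nn_integral_exp_increment) auto
      also have "ennreal (exp (- (\<kappa>\<^sup>2 / 2 * T))) * ennreal (exp ((- \<kappa>)\<^sup>2 * (T - 0) / 2)) = 1"
        by (simp add: ennreal_mult'[symmetric] exp_add[symmetric])
      finally show ?thesis by (simp add: emeasure_space_1)
    qed
    have "(\<E> \<omega>. ennreal ((if \<tau> \<omega> \<le> ennreal T then 1 else 0) * D (enn2real (min (\<tau> \<omega>) (ennreal T))) \<omega>))
      \<le> (\<E> \<omega>. ennreal ((if \<tau> \<omega> \<le> ennreal T then 1 else 0) * D (enn2real (min \<top> (ennreal T))) \<omega>))"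
      by (intro D.optional_sampling(2)[OF \<tau> stopping_time_const, of \<top> "\<lambda>_. 1"]) auto
    also have "\<dots> \<le> (\<E> \<omega>. ennreal (D T \<omega>))"
      using T D.D_nonneg by (intro nn_integral_mono ennreal_leI) (simp add: min_absorb2)
    finally have samp: "(\<E> \<omega>. ennreal ((if \<tau> \<omega> \<le> ennreal T then 1 else 0) * D (enn2real (min (\<tau> \<omega>) (ennreal T))) \<omega>)) \<le> 1"
      unfolding mean .
    have "(\<E> \<omega>. (if \<tau> \<omega> \<le> ennreal T then ennreal (exp (- r * enn2real (\<tau> \<omega>))) else 0))
      = (\<E> \<omega>. ennreal (exp (- \<beta> * (x + l))) * ennreal ((if \<tau> \<omega> \<le> ennreal T then 1 else 0) * D (enn2real (min (\<tau> \<omega>) (ennreal T))) \<omega>))"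
    proof (rule nn_integral_cong_AE)
      show "AE \<omega> in M. (if \<tau> \<omega> \<le> ennreal T then ennreal (exp (- r * enn2real (\<tau> \<omega>))) else 0) =
        ennreal (exp (- \<beta> * (x + l))) * ennreal ((if \<tau> \<omega> \<le> ennreal T then 1 else 0) * D (enn2real (min (\<tau> \<omega>) (ennreal T))) \<omega>)"
        using level AE_space
      proof eventually_elim
        case (elim \<omega>)
        show ?case
        proof (cases "\<tau> \<omega> \<le> ennreal T")
          case True
          define t where "t = enn2real (min (\<tau> \<omega>) (ennreal T))"
          have t: "0 \<le> t" "\<tau> \<omega> = ennreal t"
            using min_ennreal_real(1)[of T "\<tau> \<omega>"] True T by (simp_all add: t_def min_absorb1)
          have "x + (m - \<delta>) * t + Y t \<omega> = - l" using elim(1) t by blast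
          \<comment> \<open>Substituting the level for \<open>Y t\<close> leaves the discount
            factor, up to a constant.\<close>
          then have lev: "Y t \<omega> = - l - x - (m - \<delta>) * t" by simp
          have "- \<beta> * (x + l) + (\<kappa>\<^sup>2 / 2 * t - \<beta> * (Y t \<omega> + \<kappa> * (LINT s:{0<..t}|lborel. h s \<omega>))) = - r * t"
            unfolding hjb lev inth[OF elim(2) t(1)] m[symmetric] by (simp add: algebra_simps)
          then have "exp (- \<beta> * (x + l)) * D t \<omega> = exp (- r * t)"
            unfolding D_def discounted_exp_def exp_add[symmetric] by (simp only:)
          then show ?thesis
            using True t by (simp add: t_def[symmetric] ennreal_mult'[symmetric])
        qed simp
      qed
    qed
    also have "\<dots> = ennreal (exp (- \<beta> * (x + l))) * (\<E> \<omega>. ennreal ((if \<tau> \<omega> \<le> ennreal T then 1 else 0) * D (enn2real (min (\<tau> \<omega>) (ennreal T))) \<omega>))"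
    proof (rule nn_integral_cmult)
      have [measurable]: "(\<lambda>\<omega>. D (enn2real (min (\<tau> \<omega>) (ennreal T))) \<omega>) \<in> borel_measurable M"
        by (rule D.optional_sampling(1)[OF \<tau> \<tau>, of "\<lambda>_. 1"]) auto
      show "(\<lambda>\<omega>. ennreal ((if \<tau> \<omega> \<le> ennreal T then 1 else 0) * D (enn2real (min (\<tau> \<omega>) (ennreal T))) \<omega>)) \<in> borel_measurable M"
        by measurable
    qed
    also have "\<dots> \<le> ennreal (exp (- \<beta> * (x + l))) * 1"
      by (rule mult_left_mono[OF samp]) simp
    finally show ?thesis by simp
  qed
  \<comment> \<open>Fatou's lemma along the horizons \<open>Suc n\<close> removes the restriction to
    a finite horizon.\<close>
  let ?f = "\<lambda>n \<omega>. if \<tau> \<omega> \<le> ennreal (real (Suc n)) then ennreal (exp (- r * enn2real (\<tau> \<omega>))) else 0"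
  have "(\<E> \<omega>. (if \<tau> \<omega> < \<infinity> then ennreal (exp (- r * enn2real (\<tau> \<omega>))) else 0)) \<le> (\<E> \<omega>. liminf (\<lambda>n. ?f n \<omega>))"
  proof (rule nn_integral_mono)
    fix \<omega>
    show "(if \<tau> \<omega> < \<infinity> then ennreal (exp (- r * enn2real (\<tau> \<omega>))) else 0) \<le> liminf (\<lambda>n. ?f n \<omega>)"
    proof (cases "\<tau> \<omega>")
      case (real t)
      obtain N where N: "t \<le> real N" using real_arch_simple by blast
      have "\<forall>\<^sub>F n in sequentially. ennreal (exp (- r * enn2real (\<tau> \<omega>))) \<le> ?f n \<omega>"
        using eventually_ge_at_top[of N]
      proof eventually_elim
        case (elim n)
        then have "\<tau> \<omega> \<le> ennreal (real (Suc n))" unfolding real(2) using N by (intro ennreal_leI) simp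
        then show ?case by simp
      qed
      then show ?thesis by (simp add: Liminf_bounded)
    qed simp
  qed
  also have "\<dots> \<le> liminf (\<lambda>n. \<E> \<omega>. ?f n \<omega>)"
    by (rule nn_integral_liminf) measurable
  also have "\<dots> \<le> liminf (\<lambda>n::nat. ennreal (exp (- \<beta> * (x + l))))"
    by (intro Liminf_mono always_eventually allI finite_horizon) simp
  finally show ?thesis by (simp add: Liminf_const)
qed

lemma ruin_policy_cost:
  assumes \<pi>: "control_policy M F \<pi>" and x: "0 \<le> x" and \<xi>: "0 < \<xi>"
    and const: "constant_controls M u \<xi> \<pi>" and ruin: "injects_at_ruin M F w \<mu> \<sigma> \<delta> \<pi>"
    and pos: "0 < \<beta>" "0 \<le> \<kappa>" "\<beta> * (\<sigma> * u) = \<kappa>" "\<kappa> * \<sigma> = \<mu>" and hjb: "\<kappa>\<^sup>2 / 2 = \<beta> * \<delta> - r"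
    and K: "0 \<le> K + c * \<xi>" "K + c * \<xi> = \<alpha> * (1 - exp (- \<beta> * \<xi>))"
  shows "\<exists>X. surplus_process M F w \<mu> \<sigma> \<delta> \<pi> x X \<and> (AE \<omega> in M. \<forall>t\<ge>0. 0 \<le> X t \<omega>)"
    and "cost M r K c \<pi> x \<le> ennreal (\<alpha> * exp (- \<beta> * x))"
proof -
  from ruin x obtain X where X: "surplus_process M F w \<mu> \<sigma> \<delta> \<pi> x X"
    and rt: "AE \<omega> in M. \<forall>i. inj_time \<pi> x i \<omega> = ruin_time \<pi> x X i \<omega>"
    unfolding injects_at_ruin_def by blast
  from X obtain Y where Y: "ito_integral_process M F w (\<lambda>s \<omega>. \<sigma> * retention \<pi> x s \<omega>) Y"
    and Xt: "\<And>t \<omega>. 0 \<le> t \<Longrightarrow> \<omega> \<in> space M \<Longrightarrow> X t \<omega> =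
        x + (LINT s:{0<..t}|lborel. \<mu> * retention \<pi> x s \<omega> - \<delta>) + Y t \<omega>
          + (\<Sum>i | inj_time \<pi> x i \<omega> \<le> ennreal t. inj_size \<pi> x i \<omega>)"
    unfolding surplus_process_def by blast
  have path: "AE \<omega> in M. ruin_path (\<lambda>i. inj_time \<pi> x i \<omega>) (\<lambda>t. x + (\<mu> * u - \<delta>) * t + Y t \<omega>) \<xi> \<and>
    (\<forall>t\<ge>0. X t \<omega> = x + (\<mu> * u - \<delta>) * t + Y t \<omega> + (\<Sum>i | inj_time \<pi> x i \<omega> \<le> ennreal t. \<xi>))"
    by (rule ruin_policy_path[OF \<pi> x \<xi> const Y _ rt]) (rule Xt)
  have "AE \<omega> in M. \<forall>t\<ge>0. 0 \<le> X t \<omega>"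
    using path
  proof eventually_elim
    case (elim \<omega>)
    then interpret ruin_path "\<lambda>i. inj_time \<pi> x i \<omega>" "\<lambda>t. x + (\<mu> * u - \<delta>) * t + Y t \<omega>" \<xi> by simp
    show ?case
    proof (intro allI impI)
      fix t :: real assume t: "0 \<le> t"
      with elim have "X t \<omega> = x + (\<mu> * u - \<delta>) * t + Y t \<omega> + (\<Sum>i | inj_time \<pi> x i \<omega> \<le> ennreal t. \<xi>)" by blast
      then show "0 \<le> X t \<omega>" using surplus_nonneg[OF t] by (simp only:)
    qed
  qed
  with X show "\<exists>X. surplus_process M F w \<mu> \<sigma> \<delta> \<pi> x X \<and> (AE \<omega> in M. \<forall>t\<ge>0. 0 \<le> X t \<omega>)" by blast
  have st: "stopping_time F (inj_time \<pi> x i)" for i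
    using \<pi> x unfolding control_policy_def by blast
  note [measurable] = stopping_time_measurable[OF st]
  have disc: "(\<E> \<omega>. (if inj_time \<pi> x i \<omega> < \<infinity> then ennreal (exp (- r * enn2real (inj_time \<pi> x i \<omega>))) else 0))
      \<le> ennreal (exp (- \<beta> * (x + real i * \<xi>)))" for i
  proof (rule discounted_hitting_time_le[OF Y _ pos(1-3) hjb refl st])
    show "\<sigma> * retention \<pi> x s \<omega> = \<sigma> * u" if "0 < s" "\<omega> \<in> space M" for s \<omega>
      using const x that unfolding constant_controls_def by simp
    have \<mu>u: "\<kappa> * (\<sigma> * u) = \<mu> * u" unfolding pos(4)[symmetric] by simp
    show "AE \<omega> in M. \<forall>t\<ge>0. inj_time \<pi> x i \<omega> = ennreal t \<longrightarrow> x + (\<kappa> * (\<sigma> * u) - \<delta>) * t + Y t \<omega> = - (real i * \<xi>)"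
      unfolding \<mu>u using path
    proof eventually_elim
      case (elim \<omega>)
      then interpret ruin_path "\<lambda>i. inj_time \<pi> x i \<omega>" "\<lambda>t. x + (\<mu> * u - \<delta>) * t + Y t \<omega>" \<xi> by simp
      show ?case using levels[of i] by simp
    qed
  qed
  have "cost M r K c \<pi> x = (\<E> \<omega>. (\<Sum>i. ennreal (K + c * \<xi>) * (if inj_time \<pi> x i \<omega> < \<infinity>
      then ennreal (exp (- r * enn2real (inj_time \<pi> x i \<omega>))) else 0)))"
    unfolding cost_def
  proof (intro nn_integral_cong arg_cong[where f = suminf] ext)
    fix \<omega> i assume "\<omega> \<in> space M"
    then have "inj_size \<pi> x i \<omega> = \<xi>" using const x unfolding constant_controls_def by blast
    then show "(if inj_time \<pi> x i \<omega> < \<infinity>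
      then ennreal (exp (- r * enn2real (inj_time \<pi> x i \<omega>)) * injection_cost K c (inj_size \<pi> x i \<omega>)) else 0) =
      ennreal (K + c * \<xi>) * (if inj_time \<pi> x i \<omega> < \<infinity> then ennreal (exp (- r * enn2real (inj_time \<pi> x i \<omega>))) else 0)"
      using K(1) by (simp add: injection_cost_def ennreal_mult' mult.commute)
  qed
  also have "\<dots> = (\<Sum>i. ennreal (K + c * \<xi>) * (\<E> \<omega>. (if inj_time \<pi> x i \<omega> < \<infinity>
      then ennreal (exp (- r * enn2real (inj_time \<pi> x i \<omega>))) else 0)))"
    by (simp add: nn_integral_suminf nn_integral_cmult)
  also have "\<dots> \<le> (\<Sum>i. ennreal (K + c * \<xi>) * ennreal (exp (- \<beta> * (x + real i * \<xi>))))"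
    by (intro suminf_le summableI mult_left_mono disc) simp
  also have "\<dots> = (\<Sum>i. ennreal ((K + c * \<xi>) * exp (- \<beta> * x) * exp (- \<beta> * \<xi>) ^ i))"
  proof (intro arg_cong[where f = suminf] ext)
    fix i
    have "exp (- \<beta> * (x + real i * \<xi>)) = exp (- \<beta> * x) * exp (- \<beta> * \<xi>) ^ i"
      by (simp add: exp_of_nat_mult[symmetric] exp_add[symmetric] algebra_simps)
    then show "ennreal (K + c * \<xi>) * ennreal (exp (- \<beta> * (x + real i * \<xi>))) = ennreal ((K + c * \<xi>) * exp (- \<beta> * x) * exp (- \<beta> * \<xi>) ^ i)"
      using K(1) by (simp add: ennreal_mult'[symmetric] mult.assoc)
  qed
  also have "\<dots> = ennreal (\<alpha> * exp (- \<beta> * x))"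
  proof (rule suminf_ennreal_eq)
    show "0 \<le> (K + c * \<xi>) * exp (- \<beta> * x) * exp (- \<beta> * \<xi>) ^ i" for i using K(1) by simp
    have lt: "exp (- \<beta> * \<xi>) < 1" using pos \<xi> by simp
    have "(\<lambda>i. (K + c * \<xi>) * exp (- \<beta> * x) * exp (- \<beta> * \<xi>) ^ i) sums ((K + c * \<xi>) * exp (- \<beta> * x) * (1 / (1 - exp (- \<beta> * \<xi>))))"
      using lt by (intro sums_mult geometric_sums) simp
    \<comment> \<open>By \<open>K(2)\<close> one injection costs exactly the difference of the
      values at surplus 0 and at surplus \<open>\<xi>\<close>, which cancels the denominator of the
      geometric series.\<close>
    also have "(K + c * \<xi>) * exp (- \<beta> * x) * (1 / (1 - exp (- \<beta> * \<xi>))) = \<alpha> * exp (- \<beta> * x)"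
      unfolding K(2) using pos \<xi> by simp
    finally show "(\<lambda>i. (K + c * \<xi>) * exp (- \<beta> * x) * exp (- \<beta> * \<xi>) ^ i) sums (\<alpha> * exp (- \<beta> * x))" .
  qed
  finally show "cost M r K c \<pi> x \<le> ennreal (\<alpha> * exp (- \<beta> * x))" .
qed

text \<open>Under constant retention the surplus without injections is explicit and does not depend
  on the injections, so the times can be defined outright as hitting times of
  \<open>- real i * \<xi>\<close> instead of recursively.\<close>

lemma ruin_policy_exists:
  assumes u: "0 \<le> u" "u \<le> 1" and \<xi>: "0 < \<xi>"
  shows "\<exists>\<pi>. control_policy M F \<pi> \<and> constant_controls M u \<xi> \<pi> \<and> injects_at_ruin M F w \<mu> \<sigma> \<delta> \<pi>"
proof -
  \<comment> \<open>Subtracting \<open>w 0\<close> makes every path start at \<open>x\<close>, since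
    \<open>w 0\<close> is 0 only almost surely.\<close>
  define z where "z x t \<omega> = x + (\<mu> * u - \<delta>) * t + (\<sigma> * u) * (w t \<omega> - w 0 \<omega>)" for x t \<omega>
  define H where "H x i \<omega> = hitting_time (\<lambda>t. z x t \<omega>) (- real i * \<xi>)" for x i \<omega>
  define \<pi> where "\<pi> = \<lparr>retention = \<lambda>x s \<omega>. u, inj_time = H, inj_size = \<lambda>x i \<omega>. \<xi>\<rparr>"
  have [simp]: "retention \<pi> x s \<omega> = u" "inj_time \<pi> = H" "inj_size \<pi> x i = (\<lambda>\<omega>. \<xi>)" "retention \<pi> x = (\<lambda>s \<omega>. u)" for x s \<omega> i
    by (simp_all add: \<pi>_def)
  have zc: "continuous_on {0..} (\<lambda>t. z x t \<omega>)" if "\<omega> \<in> space M" for x \<omega>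
    unfolding z_def by (intro continuous_intros continuous_paths that)
  have z0: "z x 0 \<omega> = x" for x \<omega> by (simp add: z_def)
  have path: "injection_path (\<lambda>i. H x i \<omega>)" if "0 \<le> x" "\<omega> \<in> space M" for x \<omega>
    unfolding H_def using that by (intro hitting_times_injection_path zc \<xi>) (auto simp: z0)
  have "control_policy M F \<pi>"
    unfolding control_policy_def
  proof (intro allI impI conjI ballI)
    fix x :: real assume x: "0 \<le> x"
    show "predictable M F (retention \<pi> x)" by (simp add: predictable_def)
    show "retention \<pi> x s \<omega> \<in> {0..1}" for s \<omega> using u by simp
    show "stopping_time F (inj_time \<pi> x i)" for i
    proof -
      have "stopping_time F (\<lambda>\<omega>. hitting_time (\<lambda>t. z x t \<omega>) (- real i * \<xi>))"
      proof (rule stopping_time_hitting_time[OF zc])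
        have "0 \<le> real i * \<xi>" using \<xi> by simp
        then show "- real i * \<xi> \<le> z x 0 \<omega>" for \<omega> using x by (simp add: z0)
        show "z x q \<in> borel_measurable (F (ennreal s))" if "0 \<le> q" "q \<le> s" for q s
          unfolding z_def[abs_def] using that
          by (intro borel_measurable_add borel_measurable_times borel_measurable_diff borel_measurable_const w_measurable_F) auto
      qed
      then show ?thesis by (simp add: H_def[abs_def])
    qed
    show "inj_time \<pi> x i \<omega> \<le> inj_time \<pi> x (Suc i) \<omega>" if "\<omega> \<in> space M" for i \<omega>
      using injection_path.le[OF path[OF x that]] by simp
    show "inj_time \<pi> x i \<omega> < inj_time \<pi> x (Suc i) \<omega>" if "\<omega> \<in> space M" "inj_time \<pi> x i \<omega> < \<infinity>" for i \<omega>
      using injection_path.strict[OF path[OF x that(1)]] that(2) by simp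
    show "inj_size \<pi> x i \<in> borel_measurable (pre_sigma (inj_time \<pi> x i))" for i by simp
    show "0 < inj_size \<pi> x i \<omega>" for i \<omega> using \<xi> by simp
  qed
  moreover have "constant_controls M u \<xi> \<pi>"
    by (simp add: constant_controls_def)
  moreover have "injects_at_ruin M F w \<mu> \<sigma> \<delta> \<pi>"
    unfolding injects_at_ruin_def
  proof (intro allI impI)
    fix x :: real assume x: "0 \<le> x"
    define X where "X t \<omega> = z x t \<omega> + (\<Sum>i | H x i \<omega> \<le> ennreal t. \<xi>)" for t \<omega>
    have "surplus_process M F w \<mu> \<sigma> \<delta> \<pi> x X"
      unfolding surplus_process_def
    proof (intro exI conjI allI impI ballI)
      show "ito_integral_process M F w (\<lambda>s \<omega>. \<sigma> * retention \<pi> x s \<omega>) (\<lambda>t \<omega>. (\<sigma> * u) * (w t \<omega> - w 0 \<omega>))"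
        using ito_integral_const[of "\<sigma> * u"] by simp
      fix t \<omega> assume "0 \<le> (t::real)"
      then show "X t \<omega> = x + (LINT s:{0<..t}|lborel. \<mu> * retention \<pi> x s \<omega> - \<delta>) + \<sigma> * u * (w t \<omega> - w 0 \<omega>)
        + (\<Sum>i | inj_time \<pi> x i \<omega> \<le> ennreal t. inj_size \<pi> x i \<omega>)"
        using set_integral_const[of t "\<mu> * u - \<delta>"] by (simp add: X_def z_def)
    qed
    moreover have "AE \<omega> in M. \<forall>i. inj_time \<pi> x i \<omega> = ruin_time \<pi> x X i \<omega>"
    proof (rule AE_I2, rule allI)
      fix \<omega> i assume \<omega>: "\<omega> \<in> space M"
      have before: "surplus_before \<pi> x X t \<omega> = injection_path.before_injection (\<lambda>i. H x i \<omega>) (\<lambda>t. z x t \<omega>) \<xi> t" for t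
        unfolding surplus_before_def injection_path.before_injection_def[OF path[OF x \<omega>]] X_def by simp
      have eq: "H x i \<omega> = Inf {ennreal t | t. 0 \<le> t \<and> (i = 0 \<or> prev_time (\<lambda>i. H x i \<omega>) i < ennreal t) \<and>
          surplus_before \<pi> x X t \<omega> = 0}"
        unfolding before H_def
        by (rule hitting_times_ruin[OF zc[OF \<omega>] _ \<xi>]) (simp add: z0 x)
      show "inj_time \<pi> x i \<omega> = ruin_time \<pi> x X i \<omega>"
        using eq by (cases i) simp_all
    qed
    ultimately show "\<exists>X. surplus_process M F w \<mu> \<sigma> \<delta> \<pi> x X \<and> (AE \<omega> in M. \<forall>i. inj_time \<pi> x i \<omega> = ruin_time \<pi> x X i \<omega>)"
      by blast
  qed
  ultimately show ?thesis by blast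
qed

end

section \<open>The constants of the value function and the optimality of the policy\<close>

lemma alpha_unique:
  fixes K b :: real
  assumes K: "0 < K" and b: "0 < b"
  shows "\<exists>!\<alpha>. \<alpha> \<in> {b<..} \<and> K + b * ln (\<alpha> / b) + b - \<alpha> = 0"
proof -
  let ?g = "\<lambda>\<alpha>. K + b * ln (\<alpha> / b) + b - \<alpha>"
  \<comment> \<open>Above \<open>b\<close> the logarithmic term grows with slope less than 1, so
    \<open>?g\<close> decreases strictly.\<close>
  have dec: "?g t < ?g s" if "b < s" "s < t" for s t
  proof -
    have "ln (t / b) - ln (s / b) = ln (t / s)"
      using that b by (simp add: ln_div)
    also have "\<dots> \<le> t / s - 1" using that b by (intro ln_le_minus_one) simp
    also have "\<dots> = (t - s) / s" using that b by (simp add: field_simps)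
    finally have "b * (ln (t / b) - ln (s / b)) \<le> b * ((t - s) / s)"
      using b by (intro mult_left_mono) simp_all
    also have "\<dots> = b / s * (t - s)" by simp
    also have "\<dots> < 1 * (t - s)" using that b by (intro mult_strict_right_mono) simp_all
    finally show ?thesis by (simp add: algebra_simps)
  qed
  \<comment> \<open>The bound \<open>ln y \<le> y - 1\<close> at \<open>y = B / b / 2\<close>
    together with \<open>ln 2 \<le> 1\<close> gives \<open>b * ln (B / b) \<le> B / 2\<close>. With
    \<open>K + b = B / 2\<close> this makes \<open>?g B\<close> at most 0.\<close>
  define B where "B = 2 * (K + b)"
  have B: "b < B" "0 < B" using K b by (auto simp: B_def)
  have "?g B \<le> 0"
  proof -
    have "ln (B / b / 2) \<le> B / b / 2 - 1" using B b by (intro ln_le_minus_one) simp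
    moreover have "ln (B / b / 2) = ln (B / b) - ln 2" using ln_div[of "B / b" 2] B b by simp
    moreover have "ln (2::real) \<le> 1" using ln_le_minus_one[of 2] by simp
    ultimately have "b * ln (B / b) \<le> b * (B / b / 2)" using b by (intro mult_left_mono) simp_all
    moreover have "b * (B / b / 2) = K + b" using b by (simp add: B_def)
    ultimately show ?thesis by (simp add: B_def)
  qed
  moreover have "0 \<le> ?g b" using K b by simp
  moreover have "continuous_on {b..B} ?g"
    using b by (intro continuous_intros) auto
  ultimately obtain \<alpha> where \<alpha>: "b \<le> \<alpha>" "\<alpha> \<le> B" "?g \<alpha> = 0"
    using IVT2'[of ?g B 0 b] B by auto
  have "\<alpha> \<noteq> b" using \<alpha>(3) K b by auto
  show ?thesis
  proof (rule ex1I[of _ \<alpha>])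
    show "\<alpha> \<in> {b<..} \<and> ?g \<alpha> = 0" using \<alpha> \<open>\<alpha> \<noteq> b\<close> by auto
    fix y assume "y \<in> {b<..} \<and> ?g y = 0"
    then show "y = \<alpha>"
      using dec[of y \<alpha>] dec[of \<alpha> y] \<alpha> \<open>\<alpha> \<noteq> b\<close> by (cases y \<alpha> rule: linorder_cases) auto
  qed
qed

text \<open>The fact \<open>c\<close> is the first-order condition for \<open>\<xi>\<close> to
  minimise \<open>K + c * \<zeta> + \<alpha> * exp (- \<beta> * \<zeta>)\<close> over
  \<open>\<zeta>\<close>, and the fact \<open>K\<close> says that the minimum is
  \<open>\<alpha>\<close>. The tangent of the exponential at \<open>\<xi>\<close> thus gives the
  case \<open>y = 0\<close>; for larger \<open>y\<close> the drop in value shrinks by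
  \<open>exp (- \<beta> * y)\<close> while the cost stays the same.\<close>

lemma jump_inequality:
  fixes \<alpha> \<beta> c K \<xi> y \<zeta> :: real
  assumes pos: "0 < \<alpha>" "0 < \<beta>" and c: "\<alpha> * exp (- \<beta> * \<xi>) = c / \<beta>" and K: "K + c * \<xi> + c / \<beta> = \<alpha>"
    and y: "0 \<le> y" "0 \<le> \<zeta>"
  shows "\<alpha> * exp (- \<beta> * y) \<le> \<alpha> * exp (- \<beta> * (y + \<zeta>)) + (K + c * \<zeta>)"
proof -
  have "c / \<beta> * (1 + (- \<beta> * (\<zeta> - \<xi>))) \<le> c / \<beta> * exp (- \<beta> * (\<zeta> - \<xi>))"
    using pos c exp_ge_add_one_self[of "- \<beta> * (\<zeta> - \<xi>)"]
    by (intro mult_left_mono) (auto simp: c[symmetric])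
  also have "\<dots> = \<alpha> * exp (- \<beta> * \<zeta>)"
    unfolding c[symmetric] mult.assoc exp_add[symmetric] by (simp add: algebra_simps)
  finally have "c / \<beta> * (1 + (- \<beta> * (\<zeta> - \<xi>))) \<le> \<alpha> * exp (- \<beta> * \<zeta>)" .
  moreover have "c / \<beta> * (1 + (- \<beta> * (\<zeta> - \<xi>))) = c / \<beta> - c * \<zeta> + c * \<xi>"
    using pos by (simp add: field_simps)
  ultimately have "\<alpha> - \<alpha> * exp (- \<beta> * \<zeta>) \<le> K + c * \<zeta>"
    using K by linarith
  moreover have "\<alpha> * exp (- \<beta> * y) * (1 - exp (- \<beta> * \<zeta>)) \<le> \<alpha> * 1 * (1 - exp (- \<beta> * \<zeta>))"
    using pos y by (intro mult_right_mono mult_left_mono) auto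
  moreover have "exp (- \<beta> * (y + \<zeta>)) = exp (- \<beta> * y) * exp (- \<beta> * \<zeta>)"
    by (simp add: exp_add[symmetric] algebra_simps)
  ultimately show ?thesis by (simp add: algebra_simps)
qed

theorem theorem4p1:
  fixes M :: "'a measure" and F :: "ennreal \<Rightarrow> 'a measure" and w :: "real \<Rightarrow> 'a \<Rightarrow> real"
    and \<mu> \<sigma> \<delta> r K c \<beta> :: real
  assumes "brownian_motion M F w"
    and "\<mu> > 0" and "\<sigma> > 0" and "\<delta> > 0" and "r > 0" and "K > 0" and "c \<ge> 1"
    and "\<delta> < (\<mu>\<^sup>2 + 2 * r * \<sigma>\<^sup>2) / (2 * \<mu>)"
    and "\<beta> = 1 / \<delta> * (r + 1 / 2 * (\<mu>\<^sup>2 / \<sigma>\<^sup>2))"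
  shows "(\<exists>!\<alpha>. \<alpha> \<in> {c / \<beta><..} \<and> K + c / \<beta> * ln (\<alpha> * \<beta> / c) + c / \<beta> - \<alpha> = 0) \<and>
    (\<forall>\<alpha>\<in>{c / \<beta><..}. K + c / \<beta> * ln (\<alpha> * \<beta> / c) + c / \<beta> - \<alpha> = 0 \<longrightarrow>
      (\<forall>x\<ge>0. value_function M F w \<mu> \<sigma> \<delta> r K c x = ennreal (\<alpha> * exp (- \<beta> * x))) \<and>
      (let is_star = (\<lambda>\<pi>. control_policy M F \<pi> \<and>
             constant_controls M (2 * \<delta> * \<mu> / (2 * r * \<sigma>\<^sup>2 + \<mu>\<^sup>2)) (1 / \<beta> * ln (\<alpha> * \<beta> / c)) \<pi> \<and>
             injects_at_ruin M F w \<mu> \<sigma> \<delta> \<pi>)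
       in (\<exists>\<pi>. is_star \<pi>) \<and>
          (\<forall>\<pi>. is_star \<pi> \<longrightarrow> optimal_policy M F w \<mu> \<sigma> \<delta> r K c \<pi>)))"
proof -
  interpret brownian_motion M F w by fact
  note hyp = assms(2-8)
  define \<kappa> where "\<kappa> = \<mu> / \<sigma>"
  define u where "u = 2 * \<delta> * \<mu> / (2 * r * \<sigma>\<^sup>2 + \<mu>\<^sup>2)"
  have \<kappa>: "0 \<le> \<kappa>" "\<kappa> * \<sigma> = \<mu>" using hyp by (simp_all add: \<kappa>_def)
  have \<beta>\<delta>: "\<beta> * \<delta> = r + \<mu>\<^sup>2 / \<sigma>\<^sup>2 / 2" using hyp unfolding assms(9) by simp
  have "0 < \<beta> * \<delta>" unfolding \<beta>\<delta> using hyp by (intro add_pos_nonneg) auto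
  then have \<beta>: "0 < \<beta>" using hyp by (simp add: zero_less_mult_iff)
  have hjb: "\<kappa>\<^sup>2 / 2 = \<beta> * \<delta> - r" unfolding \<beta>\<delta> by (simp add: \<kappa>_def power_divide)
  have den: "0 < 2 * r * \<sigma>\<^sup>2 + \<mu>\<^sup>2" using hyp by (intro add_pos_pos) auto
  have \<beta>u: "\<beta> * (\<sigma> * u) = \<kappa>"
  proof -
    have "\<beta> = (2 * r * \<sigma>\<^sup>2 + \<mu>\<^sup>2) / (2 * \<delta> * \<sigma>\<^sup>2)"
      unfolding assms(9) using hyp by (simp add: field_simps)
    then have "\<beta> * (\<sigma> * u) = (2 * r * \<sigma>\<^sup>2 + \<mu>\<^sup>2) / (2 * \<delta> * \<sigma>\<^sup>2) * (\<sigma> * (2 * \<delta> * \<mu> / (2 * r * \<sigma>\<^sup>2 + \<mu>\<^sup>2)))"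
      by (simp only: u_def)
    also have "\<dots> = \<mu> / \<sigma>" using den hyp by (simp add: power2_eq_square)
    finally show ?thesis by (simp only: \<kappa>_def)
  qed
  have u: "0 \<le> u" "u \<le> 1"
    using den hyp by (simp_all add: u_def divide_le_eq less_divide_eq mult_ac)
  have cb: "0 < c / \<beta>" using hyp \<beta> by simp
  have ln_eq: "\<alpha> * \<beta> / c = \<alpha> / (c / \<beta>)" for \<alpha> by simp
  show ?thesis
  proof (intro conjI ballI impI allI)
    show "\<exists>!\<alpha>. \<alpha> \<in> {c / \<beta><..} \<and> K + c / \<beta> * ln (\<alpha> * \<beta> / c) + c / \<beta> - \<alpha> = 0"
      unfolding ln_eq by (rule alpha_unique[OF hyp(5) cb])
    fix \<alpha> assume \<alpha>: "\<alpha> \<in> {c / \<beta><..}" and root: "K + c / \<beta> * ln (\<alpha> * \<beta> / c) + c / \<beta> - \<alpha> = 0"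
    define \<xi> where "\<xi> = 1 / \<beta> * ln (\<alpha> * \<beta> / c)"
    have \<alpha>0: "0 < \<alpha>" using \<alpha> cb by simp
    have c0: "0 < c" using hyp by simp
    have one: "1 < \<alpha> * \<beta> / c" using \<alpha> \<beta> c0 by (simp add: field_simps)
    have \<xi>: "0 < \<xi>" using one \<beta> by (simp add: \<xi>_def)
    have "exp (- \<beta> * \<xi>) = 1 / (\<alpha> * \<beta> / c)"
      using one \<beta> by (simp add: \<xi>_def exp_minus inverse_eq_divide)
    then have foc: "\<alpha> * exp (- \<beta> * \<xi>) = c / \<beta>" using \<alpha>0 \<beta> c0 by simp
    have K: "K + c * \<xi> + c / \<beta> = \<alpha>" using root by (simp add: \<xi>_def)
    have K': "K + c * \<xi> = \<alpha> * (1 - exp (- \<beta> * \<xi>))"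
      using K foc by (simp add: right_diff_distrib)
    have K0: "0 \<le> K + c * \<xi>" using hyp \<xi> by simp
    define is_star where "is_star \<pi> \<longleftrightarrow> control_policy M F \<pi> \<and> constant_controls M u \<xi> \<pi> \<and> injects_at_ruin M F w \<mu> \<sigma> \<delta> \<pi>" for \<pi>
    \<comment> \<open>Kept for an arbitrary policy of the prescribed form, because optimality is
      claimed for all of them and existence separately.\<close>
    note star = ruin_policy_cost[OF _ _ \<xi> _ _ \<beta> \<kappa>(1) \<beta>u \<kappa>(2) hjb K0 K']
    have star_cost: "cost M r K c \<pi> x \<le> ennreal (\<alpha> * exp (- \<beta> * x))" if "is_star \<pi>" "0 \<le> x" for \<pi> x
      using star(2) that unfolding is_star_def by blast
    have star_adm: "\<pi> \<in> admissible M F w \<mu> \<sigma> \<delta> r K c" if "is_star \<pi>" for \<pi>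
      unfolding admissible_def mem_Collect_eq
    proof (intro conjI allI impI)
      show "control_policy M F \<pi>" using that unfolding is_star_def by blast
      fix x :: real assume x: "0 \<le> x"
      show "\<exists>X. surplus_process M F w \<mu> \<sigma> \<delta> \<pi> x X \<and> (AE \<omega> in M. \<forall>t\<ge>0. 0 \<le> X t \<omega>)"
        using star(1) that x unfolding is_star_def by blast
      show "cost M r K c \<pi> x < \<infinity>"
        using star_cost[OF that x] by (rule le_less_trans) simp
    qed
    have lower: "ennreal (\<alpha> * exp (- \<beta> * x)) \<le> cost M r K c \<pi> x"
      if "\<pi> \<in> admissible M F w \<mu> \<sigma> \<delta> r K c" "0 \<le> x" for \<pi> x
    proof -
      from that obtain X where adm: "control_policy M F \<pi>" "surplus_process M F w \<mu> \<sigma> \<delta> \<pi> x X"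
        "AE \<omega> in M. \<forall>t\<ge>0. 0 \<le> X t \<omega>" "cost M r K c \<pi> x < \<infinity>"
        unfolding admissible_def by blast
      show ?thesis
      proof (rule cost_lower_bound[OF adm(1) that(2) adm(2-4)])
        show "\<beta> * \<delta> - r = (\<mu> / \<sigma>)\<^sup>2 / 2" using hjb by (simp add: \<kappa>_def)
        show "\<alpha> * exp (- \<beta> * y) \<le> \<alpha> * exp (- \<beta> * (y + \<zeta>)) + (K + c * \<zeta>)" if "0 \<le> y" "0 \<le> \<zeta>" for y \<zeta>
          by (rule jump_inequality[OF \<alpha>0 \<beta> foc K that])
      qed (use hyp \<beta> \<alpha>0 in auto)
    qed
    obtain \<pi>0 where \<pi>0: "is_star \<pi>0"
      using ruin_policy_exists[OF u \<xi>] unfolding is_star_def by blast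
    have val: "value_function M F w \<mu> \<sigma> \<delta> r K c x = ennreal (\<alpha> * exp (- \<beta> * x))" if "0 \<le> x" for x
      unfolding value_function_def
    proof (rule antisym)
      show "(INF \<pi>\<in>admissible M F w \<mu> \<sigma> \<delta> r K c. cost M r K c \<pi> x) \<le> ennreal (\<alpha> * exp (- \<beta> * x))"
        by (rule INF_lower2[where i = \<pi>0]) (rule star_adm[OF \<pi>0], rule star_cost[OF \<pi>0 that])
      show "ennreal (\<alpha> * exp (- \<beta> * x)) \<le> (INF \<pi>\<in>admissible M F w \<mu> \<sigma> \<delta> r K c. cost M r K c \<pi> x)"
        by (rule INF_greatest) (rule lower[OF _ that])
    qed
    then show "value_function M F w \<mu> \<sigma> \<delta> r K c x = ennreal (\<alpha> * exp (- \<beta> * x))" if "0 \<le> x" for x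
      using that by blast
    have opt: "optimal_policy M F w \<mu> \<sigma> \<delta> r K c \<pi>" if "is_star \<pi>" for \<pi>
      unfolding optimal_policy_def
      using star_adm[OF that] star_cost[OF that] lower[OF star_adm[OF that]] val by (auto intro: antisym)
    show "let is_star = (\<lambda>\<pi>. control_policy M F \<pi> \<and>
             constant_controls M (2 * \<delta> * \<mu> / (2 * r * \<sigma>\<^sup>2 + \<mu>\<^sup>2)) (1 / \<beta> * ln (\<alpha> * \<beta> / c)) \<pi> \<and>
             injects_at_ruin M F w \<mu> \<sigma> \<delta> \<pi>)
       in (\<exists>\<pi>. is_star \<pi>) \<and>
          (\<forall>\<pi>. is_star \<pi> \<longrightarrow> optimal_policy M F w \<mu> \<sigma> \<delta> r K c \<pi>)"
      unfolding Let_def u_def[symmetric] \<xi>_def[symmetric] is_star_def[symmetric]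
      using \<pi>0 opt by blast
  qed
qed

end
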